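(* Let $k$ be a positive integer and let $\mathbb{B}:\mathcal{D}_{\mathrm{alg}}(k)\to\mathcal{D}_{\mathrm{alg}}(k)$ be the bijection defined by $R_{\mathbb{B}(\mu)}=\eta_\mu$ for all $\mu\in\mathcal{D}_{\mathrm{alg}}(k)$. Then $\mathbb{B}$ is a homomorphism for free multiplicative convolution $\boxtimes$, that is, $$\mathbb{B}(\mu\boxtimes\nu)=\mathbb{B}(\mu)\boxtimes\mathbb{B}(\nu),\qquad\forall\,\mu,\nu\in\mathcal{D}_{\mathrm{alg}}(k).$$
   Context: **Series.** $\mathbb{C}_0\langle\langle z_1,\ldots,z_k\rangle\rangle$ is the space of formal power series with complex coefficients and vanishing constant term in non-commuting indeterminates $z_1,\ldots,z_k$; $\mathrm{Cf}_{(i_1,\ldots,i_n)}(f)$ is the coefficient of $z_{i_1}\cdots z_{i_n}$ in $f$. For a partition $\pi$ of $\{1,\ldots,n\}$, $\mathrm{Cf}_{(i_1,\ldots,i_n);\pi}(f)$ is the product over the blocks $B=\{b_1<\cdots<b_m\}$ of $\pi$ of the coefficients $\mathrm{Cf}_{(i_{b_1},\ldots,i_{b_m})}(f)$. $NC(n)$ is the set of non-crossing partitions of $\{1,\ldots,n\}$. **Distributions.** $\mathcal{D}_{\mathrm{alg}}(k)$ is the set of linear functionals $\mu:\mathbb{C}\langle X_1,\ldots,X_k\rangle\to\mathbb{C}$ (on non-commutative polynomials) with $\mu(1)=1$. A non-commutative probability space $(\mathcal{M},\varphi)$ is a unital algebra $\mathcal{M}$ over $\mathbb{C}$ with a linear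 functional $\varphi$, $\varphi(1_{\mathcal{M}})=1$; the joint distribution of $x_1,\ldots,x_k\in\mathcal{M}$ is the $\mu\in\mathcal{D}_{\mathrm{alg}}(k)$ with $\mu(X_{i_1}\cdots X_{i_n})=\varphi(x_{i_1}\cdots x_{i_n})$ for all $n\ge1$ and all $i_1,\ldots,i_n$. **Transforms.** For $\mu\in\mathcal{D}_{\mathrm{alg}}(k)$: the moment series $M_\mu$ has $\mathrm{Cf}_{(i_1,\ldots,i_n)}(M_\mu)=\mu(X_{i_1}\cdots X_{i_n})$. The $R$-transform $R_\mu$ is the unique series in $\mathbb{C}_0\langle\langle z_1,\ldots,z_k\rangle\rangle$ with $\mathrm{Cf}_{(i_1,\ldots,i_n)}(M_\mu)=\sum_{\pi\in NC(n)}\mathrm{Cf}_{(i_1,\ldots,i_n);\pi}(R_\mu)$ for all $n\ge1$, $1\le i_1,\ldots,i_n\le k$. The $\eta$-series is $\eta_\mu=M_\mu(1+M_\mu)^{-1}$; equivalently, it is the unique series with $\mathrm{Cf}_{(i_1,\ldots,i_n)}(M_\mu)=\sum_{\pi}\mathrm{Cf}_{(i_1,\ldots,i_n);\pi}(\eta_\mu)$, the sum being over partitions $\pi$ of $\{1,\ldots,n\}$ all of whose blocks are intervals. Both $\mu\mapsto R_\mu$ and $\mu\mapsto\eta_\mu$ are bijections from $\mathcal{D}_{\mathrm{alg}}(k)$ onto $\mathbb{C}_0\langle\langle z_1,\ldots,z_k\rangle\rangle$, so $\mathbb{B}=R^{-1}\circ\eta$ is a well-defined bijection. **Free multiplicative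 convolution.** Given $\mu,\nu\in\mathcal{D}_{\mathrm{alg}}(k)$, one can find elements $x_1,\ldots,x_k,y_1,\ldots,y_k$ in a non-commutative probability space $(\mathcal{M},\varphi)$ such that $x_1,\ldots,x_k$ have joint distribution $\mu$, $y_1,\ldots,y_k$ have joint distribution $\nu$, and $\{x_1,\ldots,x_k\}$ is freely independent from $\{y_1,\ldots,y_k\}$ (i.e. the unital subalgebras $\mathcal{A}_1,\mathcal{A}_2$ they generate satisfy $\varphi(a_1\cdots a_n)=0$ whenever $a_j\in\mathcal{A}_{r_j}$, $\varphi(a_j)=0$ and $r_j\ne r_{j+1}$ for all $j$). The joint distribution of $x_1y_1,\ldots,x_ky_k$ depends only on $\mu$ and $\nu$, and $\mu\boxtimes\nu$ is defined to be this joint distribution. *)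

theory Defs
  imports Complex_Main "HOL-Library.Poly_Mapping" "HOL-Library.Disjoint_Sets"
begin

section \<open>Non-commutative polynomials\<close>

text \<open>
  The indeterminates are indexed by a type \<open>'k\<close>.  Words form the free monoid, written
  additively because \<^theory>\<open>HOL-Library.Poly_Mapping\<close> multiplies by adding exponents;
  the ring \<open>'k ncpoly\<close> is then the monoid algebra of the free monoid, with its library product.
\<close>

datatype 'k free_monoid = Word (letters: "'k list")

instantiation free_monoid :: (type) monoid_add
begin
definition "0 = Word []"
definition "u + v = Word (letters u @ letters v)"
instance
  by standard (simp_all add: zero_free_monoid_def plus_free_monoid_def)
end

type_synonym 'k ncpoly = "'k free_monoid \<Rightarrow>\<^sub>0 complex"

definition ncp_scale :: "complex \<Rightarrow> 'k ncpoly \<Rightarrow> 'k ncpoly"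
  where "ncp_scale c p = Poly_Mapping.map ((*) c) p"

definition ncp_var :: "'k \<Rightarrow> 'k ncpoly"
  where "ncp_var i = Poly_Mapping.single (Word [i]) 1"

text \<open>The product \<open>x\<^bsub>i1\<^esub> \<dots> x\<^bsub>in\<^esub>\<close> along the word \<open>[i1, \<dots>, in]\<close>.\<close>

definition word_prod :: "('k \<Rightarrow> 'm::monoid_mult) \<Rightarrow> 'k list \<Rightarrow> 'm"
  where "word_prod x w = prod_list (map x w)"


section \<open>Non-commutative probability spaces\<close>

locale nc_prob_space = Vector_Spaces.linear scale "(*)" \<phi>
  for scale :: "complex \<Rightarrow> 'm::ring_1 \<Rightarrow> 'm" and \<phi> :: "'m \<Rightarrow> complex" +
  assumes mult_scale_left: "scale c a * b = scale c (a * b)"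
    and mult_scale_right: "a * scale c b = scale c (a * b)"
    and phi_one: "\<phi> 1 = 1"

definition D_alg :: "('k ncpoly \<Rightarrow> complex) set"
  where "D_alg = {\<mu>. Vector_Spaces.linear ncp_scale (*) \<mu> \<and> \<mu> 1 = 1}"

definition has_joint_distribution ::
    "('m::ring_1 \<Rightarrow> complex) \<Rightarrow> ('k \<Rightarrow> 'm) \<Rightarrow> ('k ncpoly \<Rightarrow> complex) \<Rightarrow> bool"
  where "has_joint_distribution \<phi> x \<mu> \<longleftrightarrow>
    \<mu> \<in> D_alg \<and> (\<forall>w. w \<noteq> [] \<longrightarrow> \<mu> (word_prod ncp_var w) = \<phi> (word_prod x w))"

definition unital_subalgebra :: "(complex \<Rightarrow> 'm::ring_1 \<Rightarrow> 'm) \<Rightarrow> 'm set \<Rightarrow> bool"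
  where "unital_subalgebra scale A \<longleftrightarrow>
    1 \<in> A \<and> (\<forall>a\<in>A. \<forall>b\<in>A. a + b \<in> A \<and> a * b \<in> A) \<and> (\<forall>c. \<forall>a\<in>A. scale c a \<in> A)"

text \<open>
  Free independence of two sets.  An entry \<open>(r, a)\<close> of the list \<open>as\<close> is a factor \<open>a\<close> together
  with the choice \<open>r\<close> of the subalgebra it is taken from.
\<close>

definition freely_independent ::
    "(complex \<Rightarrow> 'm::ring_1 \<Rightarrow> 'm) \<Rightarrow> ('m \<Rightarrow> complex) \<Rightarrow> 'm set \<Rightarrow> 'm set \<Rightarrow> bool"
  where "freely_independent scale \<phi> S T \<longleftrightarrow>
    (\<forall>as :: (bool \<times> 'm) list.
       as \<noteq> [] \<longrightarrow>
       (\<forall>(r, a) \<in> set as. a \<in> unital_subalgebra scale hull (if r then S else T) \<and> \<phi> a = 0) \<longrightarrow>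
       (\<forall>j. Suc j < length as \<longrightarrow> fst (as ! j) \<noteq> fst (as ! Suc j)) \<longrightarrow>
       \<phi> (prod_list (map snd as)) = 0)"

definition free_realization ::
    "(complex \<Rightarrow> 'm::ring_1 \<Rightarrow> 'm) \<Rightarrow> ('m \<Rightarrow> complex) \<Rightarrow> ('k \<Rightarrow> 'm) \<Rightarrow> ('k \<Rightarrow> 'm) \<Rightarrow>
     ('k ncpoly \<Rightarrow> complex) \<Rightarrow> ('k ncpoly \<Rightarrow> complex) \<Rightarrow> bool"
  where "free_realization scale \<phi> x y \<mu> \<nu> \<longleftrightarrow>
    nc_prob_space scale \<phi> \<and> has_joint_distribution \<phi> x \<mu> \<and> has_joint_distribution \<phi> y \<nu> \<and>
    freely_independent scale \<phi> (range x) (range y)"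

text \<open>
  HOL cannot quantify over the carrier type of the probability space inside a definition.
  Hence the elements are taken to be the two families of indeterminates of the free algebra on
  \<open>'k + 'k\<close>; this loses nothing, because every realization, over whatever algebra, pulls
  back to this one.  That the result is the same for all realizations is
  theorem \<open>boxtimes_eqI\<close> below.
\<close>

definition boxtimes ::
    "('k ncpoly \<Rightarrow> complex) \<Rightarrow> ('k ncpoly \<Rightarrow> complex) \<Rightarrow> 'k ncpoly \<Rightarrow> complex"
    (infixl \<open>\<boxtimes>\<close> 70)
  where "\<mu> \<boxtimes> \<nu> = (THE \<rho>. \<exists>\<phi> :: ('k + 'k) ncpoly \<Rightarrow> complex.
    free_realization ncp_scale \<phi> (\<lambda>i. ncp_var (Inl i)) (\<lambda>i. ncp_var (Inr i)) \<mu> \<nu> \<and>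
    has_joint_distribution \<phi> (\<lambda>i. ncp_var (Inl i) * ncp_var (Inr i)) \<rho>)"


section \<open>Formal power series in non-commuting indeterminates\<close>

text \<open>A series is its family of coefficients: \<open>f [i1, \<dots>, in]\<close> is \<open>Cf\<^bsub>(i1,\<dots>,in)\<^esub>(f)\<close>.\<close>

type_synonym 'k ncseries = "'k list \<Rightarrow> complex"

definition C0_series :: "'k ncseries set"
  where "C0_series = {f. f [] = 0}"

definition ncs_one :: "'k ncseries"
  where "ncs_one w = (if w = [] then 1 else 0)"

definition ncs_add :: "'k ncseries \<Rightarrow> 'k ncseries \<Rightarrow> 'k ncseries"
  where "ncs_add f g w = f w + g w"

definition ncs_mult :: "'k ncseries \<Rightarrow> 'k ncseries \<Rightarrow> 'k ncseries"
  where "ncs_mult f g w = (\<Sum>n\<le>length w. f (take n w) * g (drop n w))"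

definition ncs_inverse :: "'k ncseries \<Rightarrow> 'k ncseries"
  where "ncs_inverse f = (THE g. ncs_mult f g = ncs_one \<and> ncs_mult g f = ncs_one)"

text \<open>
  Positions in a word are counted from 0, so partitions of \<open>{1,\<dots>,n}\<close> become partitions of
  \<open>{..<n}\<close>, and \<open>nths w B\<close> is the subword of \<open>w\<close> at the positions in the block \<open>B\<close>,
  in increasing order.
\<close>

definition cf_partition :: "'k ncseries \<Rightarrow> 'k list \<Rightarrow> nat set set \<Rightarrow> complex"
  where "cf_partition f w \<pi> = (\<Prod>B\<in>\<pi>. f (nths w B))"

definition noncrossing :: "nat set set \<Rightarrow> bool"
  where "noncrossing \<pi> \<longleftrightarrow>
    \<not> (\<exists>B\<in>\<pi>. \<exists>C\<in>\<pi>. B \<noteq> C \<and> (\<exists>a b c d. a < b \<and> b < c \<and> c < d \<and> a \<in> B \<and> c \<in> B \<and> b \<in> C \<and> d \<in> C))"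

definition NC :: "nat \<Rightarrow> nat set set set"
  where "NC n = {\<pi>. partition_on {..<n} \<pi> \<and> noncrossing \<pi>}"


section \<open>Transforms\<close>

definition moment_series :: "('k ncpoly \<Rightarrow> complex) \<Rightarrow> 'k ncseries"
  where "moment_series \<mu> w = (if w = [] then 0 else \<mu> (word_prod ncp_var w))"

definition R_transform :: "('k ncpoly \<Rightarrow> complex) \<Rightarrow> 'k ncseries"
  where "R_transform \<mu> = (THE f. f \<in> C0_series \<and>
    (\<forall>w. w \<noteq> [] \<longrightarrow> moment_series \<mu> w = (\<Sum>\<pi>\<in>NC (length w). cf_partition f w \<pi>)))"

definition eta_series :: "('k ncpoly \<Rightarrow> complex) \<Rightarrow> 'k ncseries"
  where "eta_series \<mu> =
    ncs_mult (moment_series \<mu>) (ncs_inverse (ncs_add ncs_one (moment_series \<mu>)))"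

definition bercovici_pata :: "('k ncpoly \<Rightarrow> complex) \<Rightarrow> 'k ncpoly \<Rightarrow> complex" (\<open>\<bbbB>\<close>)
  where "\<bbbB> \<mu> = inv_into D_alg R_transform (eta_series \<mu>)"


section \<open>Well-definedness of the transforms\<close>

lemma lookup_ncp_scale [simp]: "Poly_Mapping.lookup (ncp_scale c p) w = c * Poly_Mapping.lookup p w"
  by (cases "Poly_Mapping.lookup p w = 0") (simp_all add: ncp_scale_def Poly_Mapping.map.rep_eq)

lemma ncp_scale_conv_mult: "ncp_scale c p = Poly_Mapping.single 0 c * p"
  by (simp add: ncp_scale_def mult_map_scale_conv_mult)

lemma vector_space_ncp_scale: "vector_space ncp_scale"
  by standard (auto intro!: poly_mapping_eqI simp: lookup_add algebra_simps)

lemma ncp_scale_mult_left: "ncp_scale c p * q = ncp_scale c (p * q)"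
  by (simp add: ncp_scale_conv_mult mult.assoc)

lemma lookup_single_0_commute:
  "p * Poly_Mapping.single (0 :: 'k free_monoid) (c :: complex) = Poly_Mapping.single 0 c * p"
proof (rule poly_mapping_eqI)
  fix w
  have eq: "prod_fun (Poly_Mapping.lookup p) (\<lambda>k'. c when 0 = k') w = Poly_Mapping.lookup p w * c"
    for p :: "'k ncpoly"
  proof -
    have "Sum_any (\<lambda>q. (c when 0 = q) when w = l + q) = (c when w = l)" for l :: "'k free_monoid"
    proof -
      have "Sum_any (\<lambda>q. (c when 0 = q) when w = l + q) = Sum_any (\<lambda>q :: 'k free_monoid. (c when w = l) when q = 0)"
        by (intro arg_cong[where f = Sum_any] ext) (auto simp: when_def zero_free_monoid_def plus_free_monoid_def)
      then show ?thesis by simp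
    qed
    then have "prod_fun (Poly_Mapping.lookup p) (\<lambda>k'. c when 0 = k') w =
        Sum_any (\<lambda>l. Poly_Mapping.lookup p l * (c when w = l))"
      by (simp add: prod_fun_def)
    also have "\<dots> = Sum_any (\<lambda>l. Poly_Mapping.lookup p w * c when l = w)"
      by (intro arg_cong[where f = Sum_any] ext) (auto simp: when_def)
    finally show ?thesis by simp
  qed
  show "Poly_Mapping.lookup (p * Poly_Mapping.single 0 c) w =
      Poly_Mapping.lookup (Poly_Mapping.single 0 c * p) w"
    using eq[of p] lookup_ncp_scale[of c p w]
    by (simp add: times_poly_mapping.rep_eq single.rep_eq ncp_scale_conv_mult)
qed

lemma ncp_scale_mult_right: "p * ncp_scale c q = ncp_scale c (p * q)"
  by (metis lookup_single_0_commute mult.assoc ncp_scale_conv_mult)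

lemma vector_space_complex: "vector_space ((*) :: complex \<Rightarrow> _)"
  by standard (auto simp: algebra_simps)

lemma D_alg_iff_nc_prob_space: "\<mu> \<in> D_alg \<longleftrightarrow> nc_prob_space ncp_scale \<mu>"
  by (auto simp: D_alg_def nc_prob_space_def nc_prob_space_axioms_def
      ncp_scale_mult_left ncp_scale_mult_right)

lemma D_algI:
  assumes "\<And>p q. \<mu> (p + q) = \<mu> p + \<mu> q" "\<And>c p. \<mu> (ncp_scale c p) = c * \<mu> p" "\<mu> 1 = 1"
  shows "\<mu> \<in> D_alg"
  using assms by (auto simp: D_alg_def Vector_Spaces.linear_def module_hom_def
      module_hom_axioms_def module_iff_vector_space vector_space_ncp_scale vector_space_complex)

lemma D_algD:
  assumes "\<mu> \<in> D_alg"
  shows "\<mu> (p + q) = \<mu> p + \<mu> q" "\<mu> (ncp_scale c p) = c * \<mu> p" "\<mu> 1 = 1"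
proof -
  interpret nc_prob_space ncp_scale \<mu>
    using assms by (simp add: D_alg_iff_nc_prob_space)
  show "\<mu> (p + q) = \<mu> p + \<mu> q" "\<mu> (ncp_scale c p) = c * \<mu> p" "\<mu> 1 = 1"
    by (simp_all add: add scale phi_one)
qed

lemma D_alg_0: "\<mu> \<in> D_alg \<Longrightarrow> \<mu> 0 = 0"
  using D_algD(1)[of \<mu> 0 0] by simp

lemma D_alg_sum: "\<mu> \<in> D_alg \<Longrightarrow> \<mu> (\<Sum>i\<in>I. f i) = (\<Sum>i\<in>I. \<mu> (f i))"
  by (induction I rule: infinite_finite_induct) (auto simp: D_alg_0 D_algD)

lemma word_prod_Nil [simp]: "word_prod x [] = 1"
  and word_prod_Cons [simp]: "word_prod x (i # w) = x i * word_prod x w"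
  and word_prod_append: "word_prod x (v @ w) = word_prod x v * word_prod x w"
  by (simp_all add: word_prod_def)

lemma word_prod_ncp_var: "word_prod ncp_var w = Poly_Mapping.single (Word w) 1"
  by (induction w)
    (simp_all add: ncp_var_def mult_single plus_free_monoid_def flip: zero_free_monoid_def)

lemma ncp_expand:
  "p = (\<Sum>w\<in>Poly_Mapping.keys p. ncp_scale (Poly_Mapping.lookup p w) (word_prod ncp_var (letters w)))"
  by (rule poly_mapping_eqI)
    (simp add: lookup_sum word_prod_ncp_var lookup_single when_def in_keys_iff sum.delta' if_distrib cong: if_cong)

lemma D_alg_expand:
  assumes "\<mu> \<in> D_alg"
  shows "\<mu> p = (\<Sum>w\<in>Poly_Mapping.keys p. Poly_Mapping.lookup p w * \<mu> (word_prod ncp_var (letters w)))"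
  by (subst ncp_expand) (simp add: D_alg_sum assms D_algD)

lemma D_alg_eqI:
  assumes "\<mu> \<in> D_alg" "\<nu> \<in> D_alg"
    "\<And>w. w \<noteq> [] \<Longrightarrow> \<mu> (word_prod ncp_var w) = \<nu> (word_prod ncp_var w)"
  shows "\<mu> = \<nu>"
proof
  fix p
  have "\<mu> (word_prod ncp_var w) = \<nu> (word_prod ncp_var w)" for w
    using assms by (cases "w = []") (auto simp: D_algD)
  then show "\<mu> p = \<nu> p"
    by (simp add: D_alg_expand[OF assms(1), of p] D_alg_expand[OF assms(2), of p])
qed

lemma D_alg_exists: "\<exists>\<mu>\<in>D_alg. \<forall>w. w \<noteq> [] \<longrightarrow> \<mu> (word_prod ncp_var w) = m w"
proof -
  define n where "n v = (if letters v = [] then 1 else m (letters v))" for v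
  define \<mu> where "\<mu> p = (\<Sum>v\<in>Poly_Mapping.keys p. Poly_Mapping.lookup p v * n v)" for p
  have mono: "\<mu> p = (\<Sum>v\<in>S. Poly_Mapping.lookup p v * n v)"
    if "finite S" "Poly_Mapping.keys p \<subseteq> S" for p S
    unfolding \<mu>_def by (rule sum.mono_neutral_left) (use that in \<open>auto simp: in_keys_iff\<close>)
  have single: "\<mu> (word_prod ncp_var w) = n (Word w)" for w
    by (simp add: \<mu>_def word_prod_ncp_var)
  have "\<mu> \<in> D_alg"
  proof (rule D_algI)
    fix p q :: "'a ncpoly"
    let ?S = "Poly_Mapping.keys p \<union> Poly_Mapping.keys q"
    have "Poly_Mapping.keys (p + q) \<subseteq> ?S" by (rule Poly_Mapping.keys_add)
    then show "\<mu> (p + q) = \<mu> p + \<mu> q"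
      by (simp add: mono[of ?S] lookup_add sum.distrib algebra_simps)
  next
    fix c and p :: "'a ncpoly"
    have "Poly_Mapping.keys (ncp_scale c p) \<subseteq> Poly_Mapping.keys p" by (auto simp: in_keys_iff)
    then show "\<mu> (ncp_scale c p) = c * \<mu> p"
      by (simp add: mono[of "Poly_Mapping.keys p"] sum_distrib_left algebra_simps)
  next
    show "\<mu> 1 = 1" using single[of "[]"] by (simp add: n_def)
  qed
  then show ?thesis by (intro bexI[of _ \<mu>]) (auto simp: single n_def)
qed

lemma bij_betw_moment_series: "bij_betw moment_series (D_alg :: ('k ncpoly \<Rightarrow> complex) set) C0_series"
  unfolding bij_betw_def
proof
  show "inj_on moment_series (D_alg :: ('k ncpoly \<Rightarrow> complex) set)"
  proof (rule inj_onI)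
    fix \<mu> \<nu> :: "'k ncpoly \<Rightarrow> complex"
    assume *: "\<mu> \<in> D_alg" "\<nu> \<in> D_alg" "moment_series \<mu> = moment_series \<nu>"
    show "\<mu> = \<nu>"
    proof (rule D_alg_eqI[OF *(1,2)])
      fix w :: "'k list" assume "w \<noteq> []"
      then show "\<mu> (word_prod ncp_var w) = \<nu> (word_prod ncp_var w)"
        using fun_cong[OF *(3), of w] by (simp add: moment_series_def)
    qed
  qed
  show "moment_series ` D_alg = (C0_series :: 'k ncseries set)"
  proof
    show "moment_series ` D_alg \<subseteq> (C0_series :: 'k ncseries set)" by (auto simp: moment_series_def C0_series_def)
    show "(C0_series :: 'k ncseries set) \<subseteq> moment_series ` D_alg"
    proof
      fix f :: "'k ncseries" assume f: "f \<in> C0_series"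
      obtain \<mu> where \<mu>: "\<mu> \<in> D_alg" "\<And>w. w \<noteq> [] \<Longrightarrow> \<mu> (word_prod ncp_var w) = f w"
        using D_alg_exists[of f] by auto
      then have "f = moment_series \<mu>"
        using f by (auto simp: moment_series_def C0_series_def)
      with \<mu>(1) show "f \<in> moment_series ` D_alg" by blast
    qed
  qed
qed

lemma moment_series_surj:
  fixes f :: "'k ncseries"
  assumes "f \<in> C0_series"
  obtains \<mu> :: "'k ncpoly \<Rightarrow> complex" where "\<mu> \<in> D_alg" "moment_series \<mu> = f"
proof -
  have "f \<in> moment_series ` D_alg"
    using assms by (simp add: bij_betw_imp_surj_on[OF bij_betw_moment_series])
  then show thesis using that by blast
qed

lemma ncs_mult_Nil: "ncs_mult f g [] = f [] * g []"
  by (simp add: ncs_mult_def)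

lemma ncs_mult_Cons: "ncs_mult f g (a # w) = f [] * g (a # w) + ncs_mult (\<lambda>u. f (a # u)) g w"
  by (simp add: ncs_mult_def sum.atMost_Suc_shift del: sum.atMost_Suc)

lemma ncs_mult_linear:
  "ncs_mult (\<lambda>u. c * f u + g u) h w = c * ncs_mult f h w + ncs_mult g h w"
  by (simp add: ncs_mult_def algebra_simps sum.distrib sum_distrib_left)

lemma ncs_mult_assoc: "ncs_mult (ncs_mult f g) h = ncs_mult f (ncs_mult g h)"
proof
  fix w show "ncs_mult (ncs_mult f g) h w = ncs_mult f (ncs_mult g h) w"
    by (induction w arbitrary: f g)
      (simp_all add: ncs_mult_Nil ncs_mult_Cons ncs_mult_linear algebra_simps)
qed

lemma ncs_mult_one_left [simp]: "ncs_mult ncs_one f = f"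
proof
  fix w show "ncs_mult ncs_one f w = f w"
    by (cases w) (simp_all add: ncs_mult_Nil ncs_mult_Cons ncs_one_def, simp add: ncs_mult_def)
qed

lemma ncs_mult_one_right [simp]: "ncs_mult f ncs_one = f"
proof
  fix w show "ncs_mult f ncs_one w = f w"
    by (induction w arbitrary: f) (simp_all add: ncs_mult_Nil ncs_mult_Cons ncs_one_def)
qed

fun ncs_right_inverse :: "'k ncseries \<Rightarrow> 'k ncseries"
  where "ncs_right_inverse f [] = inverse (f [])"
  | "ncs_right_inverse f (a # w) =
      - inverse (f []) * (\<Sum>n\<le>length w. f (a # take n w) * ncs_right_inverse f (drop n w))"

lemma ncs_right_inverse: "f [] \<noteq> 0 \<Longrightarrow> ncs_mult f (ncs_right_inverse f) = ncs_one"
proof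
  fix w assume "f [] \<noteq> 0"
  then show "ncs_mult f (ncs_right_inverse f) w = ncs_one w"
    by (cases w) (simp_all add: ncs_mult_Nil ncs_mult_Cons ncs_one_def, simp add: ncs_mult_def)
qed

lemma ncs_inverse:
  assumes "f [] \<noteq> 0"
  shows "ncs_mult f (ncs_inverse f) = ncs_one" "ncs_mult (ncs_inverse f) f = ncs_one"
proof -
  define g where "g = ncs_right_inverse f"
  have g: "ncs_mult f g = ncs_one" using ncs_right_inverse[of f] assms by (simp add: g_def)
  have "ncs_mult g (ncs_right_inverse g) = ncs_one"
    using assms by (intro ncs_right_inverse) (simp add: g_def)
  then have "ncs_mult g f = ncs_one"
    by (metis g ncs_mult_assoc ncs_mult_one_left ncs_mult_one_right)
  with g have "\<exists>!g. ncs_mult f g = ncs_one \<and> ncs_mult g f = ncs_one"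
    by (metis ncs_mult_assoc ncs_mult_one_left ncs_mult_one_right)
  from theI'[OF this] show "ncs_mult f (ncs_inverse f) = ncs_one" "ncs_mult (ncs_inverse f) f = ncs_one"
    by (simp_all add: ncs_inverse_def)
qed

lemma ncs_mult_add_left: "ncs_mult (ncs_add f g) h = ncs_add (ncs_mult f h) (ncs_mult g h)"
  by (rule ext) (simp add: ncs_mult_def ncs_add_def algebra_simps sum.distrib)

lemma ncs_mult_add_right: "ncs_mult h (ncs_add f g) = ncs_add (ncs_mult h f) (ncs_mult h g)"
  by (rule ext) (simp add: ncs_mult_def ncs_add_def algebra_simps sum.distrib)

lemma eta_series_eq_iff:
  "eta_series \<mu> = f \<longleftrightarrow> ncs_mult f (ncs_add ncs_one (moment_series \<mu>)) = moment_series \<mu>"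
proof -
  have "ncs_add ncs_one (moment_series \<mu>) [] \<noteq> 0"
    by (simp add: ncs_add_def ncs_one_def moment_series_def)
  from ncs_inverse[of "ncs_add ncs_one (moment_series \<mu>)", OF this] show ?thesis
    unfolding eta_series_def by (metis ncs_mult_assoc ncs_mult_one_right)
qed

lemma bij_betw_eta_series: "bij_betw eta_series (D_alg :: ('k ncpoly \<Rightarrow> complex) set) C0_series"
  unfolding bij_betw_def
proof
  have eta: "ncs_mult (\<lambda>w. ncs_one w - eta_series \<mu> w) (ncs_add ncs_one (moment_series \<mu>)) = ncs_one"
    for \<mu> :: "'k ncpoly \<Rightarrow> complex"
  proof -
    let ?N = "ncs_add ncs_one (moment_series \<mu>)"
    have "ncs_add (ncs_mult (\<lambda>w. ncs_one w - eta_series \<mu> w) ?N) (ncs_mult (eta_series \<mu>) ?N) = ?N"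
    proof -
      have "ncs_add (\<lambda>w. ncs_one w - eta_series \<mu> w) (eta_series \<mu>) = ncs_one"
        by (rule ext) (simp add: ncs_add_def)
      then show ?thesis by (simp flip: ncs_mult_add_left)
    qed
    moreover have "ncs_mult (eta_series \<mu>) ?N = moment_series \<mu>"
      using eta_series_eq_iff by blast
    ultimately have eq: "ncs_add (ncs_mult (\<lambda>w. ncs_one w - eta_series \<mu> w) ?N) (moment_series \<mu>) = ?N"
      by simp
    show ?thesis
    proof
      fix w
      show "ncs_mult (\<lambda>w. ncs_one w - eta_series \<mu> w) ?N w = ncs_one w"
        using fun_cong[OF eq, of w] by (simp add: ncs_add_def)
    qed
  qed
  have eta0: "eta_series \<mu> \<in> C0_series" for \<mu> :: "'k ncpoly \<Rightarrow> complex"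
    by (simp add: eta_series_def C0_series_def ncs_mult_Nil moment_series_def)
  show "inj_on eta_series (D_alg :: ('k ncpoly \<Rightarrow> complex) set)"
  proof (rule inj_onI)
    fix \<mu> \<nu> :: "'k ncpoly \<Rightarrow> complex"
    assume D: "\<mu> \<in> D_alg" "\<nu> \<in> D_alg" and eq: "eta_series \<mu> = eta_series \<nu>"
    let ?g = "\<lambda>w. ncs_one w - eta_series \<mu> w"
    have "?g [] \<noteq> 0" using eta0[of \<mu>] by (simp add: ncs_one_def C0_series_def)
    from ncs_inverse[of ?g, OF this]
    have "ncs_add ncs_one (moment_series \<mu>) = ncs_add ncs_one (moment_series \<nu>)"
      using eta[of \<mu>] eta[of \<nu>] unfolding eq by (metis ncs_mult_assoc ncs_mult_one_left)
    then have "moment_series \<mu> = moment_series \<nu>"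
      by (auto simp: ncs_add_def fun_eq_iff)
    with D show "\<mu> = \<nu>"
      using bij_betw_moment_series by (auto simp: bij_betw_def dest: inj_onD)
  qed
  show "eta_series ` D_alg = (C0_series :: 'k ncseries set)"
  proof
    show "eta_series ` D_alg \<subseteq> (C0_series :: 'k ncseries set)" using eta0 by blast
    show "(C0_series :: 'k ncseries set) \<subseteq> eta_series ` D_alg"
    proof
      fix f :: "'k ncseries" assume f: "f \<in> C0_series"
      let ?g = "\<lambda>w. ncs_one w - f w"
      have g0: "?g [] = 1" using f by (simp add: ncs_one_def C0_series_def)
      define m where "m w = ncs_inverse ?g w - ncs_one w" for w
      have N: "ncs_add ncs_one m = ncs_inverse ?g" by (rule ext) (simp add: m_def ncs_add_def)
      have inv: "ncs_mult ?g (ncs_inverse ?g) = ncs_one"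
        using ncs_inverse[of ?g] g0 by simp
      then have "ncs_inverse ?g [] = 1"
        using g0 ncs_mult_Nil[of ?g "ncs_inverse ?g"] by (simp add: ncs_one_def)
      then have "m \<in> C0_series" by (simp add: m_def C0_series_def ncs_one_def)
      then obtain \<mu> :: "'k ncpoly \<Rightarrow> complex" where \<mu>: "\<mu> \<in> D_alg" "moment_series \<mu> = m"
        by (rule moment_series_surj)
      have "ncs_add (ncs_mult ?g (ncs_inverse ?g)) (ncs_mult f (ncs_inverse ?g)) = ncs_inverse ?g"
      proof -
        have "ncs_add ?g f = ncs_one" by (rule ext) (simp add: ncs_add_def)
        then show ?thesis by (simp flip: ncs_mult_add_left)
      qed
      then have "ncs_mult f (ncs_inverse ?g) = m"
        unfolding inv by (auto simp: fun_eq_iff m_def ncs_add_def algebra_simps)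
      then have "eta_series \<mu> = f" by (simp add: eta_series_eq_iff \<mu> N)
      with \<mu>(1) show "f \<in> eta_series ` D_alg" by blast
    qed
  qed
qed

lemma finite_NC: "finite (NC n)"
  by (rule finite_subset[of _ "Pow (Pow {..<n})"]) (auto simp: NC_def partition_on_def)

lemma NC_one_block: "n > 0 \<Longrightarrow> {{..<n}} \<in> NC n"
  by (simp add: NC_def partition_on_space noncrossing_def lessThan_empty_iff)

lemma length_nths_NC:
  assumes "\<pi> \<in> NC (length w) - {{{..<length w}}}" "B \<in> \<pi>"
  shows "length (nths w B) < length w"
proof -
  have part: "partition_on {..<length w} \<pi>" using assms by (simp add: NC_def)
  have "B \<subseteq> {..<length w}" using part assms(2) by (auto simp: partition_on_def)
  moreover have "B \<noteq> {..<length w}"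
  proof
    assume B: "B = {..<length w}"
    have "C = B" if "C \<in> \<pi>" for C
    proof (rule ccontr)
      assume "C \<noteq> B"
      then have "C \<inter> B = {}" using part that assms(2) by (auto simp: partition_on_def disjoint_def)
      moreover have "C \<subseteq> B" "C \<noteq> {}" using part that B by (auto simp: partition_on_def)
      ultimately show False by blast
    qed
    then have "\<pi> = {B}" using assms(2) by blast
    with B assms(1) show False by simp
  qed
  ultimately have "B \<subset> {..<length w}" by blast
  then have "card B < length w" using psubset_card_mono[of "{..<length w}" B] by simp
  moreover have "{i. i < length w \<and> i \<in> B} = B" using \<open>B \<subseteq> _\<close> by auto
  ultimately show ?thesis by (simp add: length_nths)
qed

function free_cumulant :: "'k ncseries \<Rightarrow> 'k ncseries"
  where "free_cumulant m w =
    m w - (\<Sum>\<pi>\<in>NC (length w) - {{{..<length w}}}. \<Prod>B\<in>\<pi>. free_cumulant m (nths w B))"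
  by auto
termination
  by (relation "measure (\<lambda>(m, w). length w)") (auto dest: length_nths_NC[rotated] intro!: length_nths_NC)

declare free_cumulant.simps [simp del]

lemma sum_NC_split:
  assumes "w \<noteq> []"
  shows "(\<Sum>\<pi>\<in>NC (length w). cf_partition f w \<pi>) =
    f w + (\<Sum>\<pi>\<in>NC (length w) - {{{..<length w}}}. \<Prod>B\<in>\<pi>. f (nths w B))"
proof -
  have "nths w {..<length w} = w" by simp
  then show ?thesis
    using assms by (subst sum.remove[OF finite_NC NC_one_block]) (simp_all add: cf_partition_def)
qed

lemma moment_cumulant_unique:
  assumes "m \<in> C0_series"
  shows "\<exists>!f. f \<in> C0_series \<and>
    (\<forall>w. w \<noteq> [] \<longrightarrow> m w = (\<Sum>\<pi>\<in>NC (length w). cf_partition f w \<pi>))"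
proof (rule ex1I)
  define f where "f w = (if w = [] then 0 else free_cumulant m w)" for w
  have nths: "nths w B \<noteq> []" if "\<pi> \<in> NC (length w)" "B \<in> \<pi>" for w :: "'a list" and \<pi> B
  proof -
    have "B \<noteq> {}" "B \<subseteq> {..<length w}" using that by (auto simp: NC_def partition_on_def)
    then have "set (nths w B) \<noteq> {}" by (auto simp: set_nths)
    then show ?thesis by auto
  qed
  show "f \<in> C0_series \<and> (\<forall>w. w \<noteq> [] \<longrightarrow> m w = (\<Sum>\<pi>\<in>NC (length w). cf_partition f w \<pi>))"
  proof (intro conjI allI impI)
    show "f \<in> C0_series" by (simp add: f_def C0_series_def)
    fix w :: "'a list" assume w: "w \<noteq> []"
    have "(\<Sum>\<pi>\<in>NC (length w) - {{{..<length w}}}. \<Prod>B\<in>\<pi>. f (nths w B)) =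
        (\<Sum>\<pi>\<in>NC (length w) - {{{..<length w}}}. \<Prod>B\<in>\<pi>. free_cumulant m (nths w B))"
      by (intro sum.cong prod.cong refl) (auto simp: f_def nths)
    then show "m w = (\<Sum>\<pi>\<in>NC (length w). cf_partition f w \<pi>)"
      using w by (simp add: sum_NC_split f_def free_cumulant.simps[of m w])
  qed
  fix g assume g: "g \<in> C0_series \<and> (\<forall>w. w \<noteq> [] \<longrightarrow> m w = (\<Sum>\<pi>\<in>NC (length w). cf_partition g w \<pi>))"
  have "g w = f w" for w
  proof (induction "length w" arbitrary: w rule: less_induct)
    case less
    show ?case
    proof (cases "w = []")
      case True
      then show ?thesis using g by (simp add: f_def C0_series_def)
    next
      case False
      have "(\<Sum>\<pi>\<in>NC (length w) - {{{..<length w}}}. \<Prod>B\<in>\<pi>. g (nths w B)) =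
          (\<Sum>\<pi>\<in>NC (length w) - {{{..<length w}}}. \<Prod>B\<in>\<pi>. free_cumulant m (nths w B))"
      proof (intro sum.cong prod.cong refl)
        fix \<pi> B assume *: "\<pi> \<in> NC (length w) - {{{..<length w}}}" "B \<in> \<pi>"
        then show "g (nths w B) = free_cumulant m (nths w B)"
          using less[OF length_nths_NC[OF *]] nths[of \<pi> w B] by (simp add: f_def)
      qed
      moreover have "m w = (\<Sum>\<pi>\<in>NC (length w). cf_partition g w \<pi>)" using g False by blast
      ultimately show ?thesis
        using False by (simp add: sum_NC_split f_def free_cumulant.simps[of m w])
    qed
  qed
  then show "g = f" by blast
qed

lemma moment_series_in_C0: "moment_series \<mu> \<in> C0_series"
  by (simp add: moment_series_def C0_series_def)

lemma R_transform_in_C0: "R_transform \<mu> \<in> C0_series"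
  and moment_R_transform: "w \<noteq> [] \<Longrightarrow>
    moment_series \<mu> w = (\<Sum>\<pi>\<in>NC (length w). cf_partition (R_transform \<mu>) w \<pi>)"
  using theI'[OF moment_cumulant_unique[OF moment_series_in_C0[of \<mu>]]]
  unfolding R_transform_def by blast+

lemma R_transform_eqI:
  assumes "f \<in> C0_series"
    "\<And>w. w \<noteq> [] \<Longrightarrow> moment_series \<mu> w = (\<Sum>\<pi>\<in>NC (length w). cf_partition f w \<pi>)"
  shows "R_transform \<mu> = f"
  unfolding R_transform_def
  using assms by (intro the1_equality[OF moment_cumulant_unique[OF moment_series_in_C0[of \<mu>]]]) auto

lemma bij_betw_R_transform: "bij_betw R_transform (D_alg :: ('k ncpoly \<Rightarrow> complex) set) C0_series"
  unfolding bij_betw_def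
proof
  show "inj_on R_transform (D_alg :: ('k ncpoly \<Rightarrow> complex) set)"
  proof (rule inj_onI)
    fix \<mu> \<nu> :: "'k ncpoly \<Rightarrow> complex"
    assume D: "\<mu> \<in> D_alg" "\<nu> \<in> D_alg" and eq: "R_transform \<mu> = R_transform \<nu>"
    have "moment_series \<mu> w = moment_series \<nu> w" for w
      using moment_R_transform[of w \<mu>] moment_R_transform[of w \<nu>] eq
      by (cases "w = []") (simp_all add: moment_series_def)
    then have "moment_series \<mu> = moment_series \<nu>" by blast
    with D show "\<mu> = \<nu>"
      using bij_betw_moment_series by (auto simp: bij_betw_def dest: inj_onD)
  qed
  show "R_transform ` D_alg = (C0_series :: 'k ncseries set)"
  proof
    show "R_transform ` D_alg \<subseteq> (C0_series :: 'k ncseries set)" using R_transform_in_C0 by blast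
    show "(C0_series :: 'k ncseries set) \<subseteq> R_transform ` D_alg"
    proof
      fix f :: "'k ncseries" assume f: "f \<in> C0_series"
      define m where "m w = (if w = [] then 0 else \<Sum>\<pi>\<in>NC (length w). cf_partition f w \<pi>)" for w
      have "m \<in> C0_series" by (simp add: m_def C0_series_def)
      then obtain \<mu> :: "'k ncpoly \<Rightarrow> complex" where \<mu>: "\<mu> \<in> D_alg" "moment_series \<mu> = m"
        by (rule moment_series_surj)
      have "R_transform \<mu> = f"
        by (rule R_transform_eqI[OF f]) (simp add: \<mu> m_def)
      with \<mu>(1) show "f \<in> R_transform ` D_alg" by blast
    qed
  qed
qed

theorem bercovici_pata:
  assumes "\<mu> \<in> D_alg"
  shows "\<bbbB> \<mu> \<in> D_alg" "R_transform (\<bbbB> \<mu>) = eta_series \<mu>"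
proof -
  have "eta_series \<mu> \<in> R_transform ` D_alg"
    using assms bij_betw_eta_series bij_betw_R_transform unfolding bij_betw_def by blast
  then show "\<bbbB> \<mu> \<in> D_alg" "R_transform (\<bbbB> \<mu>) = eta_series \<mu>"
    by (simp_all add: bercovici_pata_def inv_into_into f_inv_into_f)
qed

theorem bij_betw_bercovici_pata:
  "bij_betw (\<bbbB> :: ('k ncpoly \<Rightarrow> complex) \<Rightarrow> _) (D_alg :: ('k ncpoly \<Rightarrow> complex) set) D_alg"
proof -
  have "bij_betw (inv_into D_alg R_transform \<circ> eta_series) (D_alg :: ('k ncpoly \<Rightarrow> complex) set) D_alg"
    by (rule bij_betw_trans[OF bij_betw_eta_series bij_betw_inv_into[OF bij_betw_R_transform]])
  moreover have "(\<bbbB> :: ('k ncpoly \<Rightarrow> complex) \<Rightarrow> _) = inv_into D_alg R_transform \<circ> eta_series"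
    by (rule ext) (simp add: bercovici_pata_def)
  ultimately show ?thesis by simp
qed

section \<open>The free multiplicative convolution does not depend on the realization\<close>

definition ncp_eval :: "(complex \<Rightarrow> 'm::ring_1 \<Rightarrow> 'm) \<Rightarrow> ('k \<Rightarrow> 'm) \<Rightarrow> 'k ncpoly \<Rightarrow> 'm"
  where "ncp_eval scale x p =
    (\<Sum>w\<in>Poly_Mapping.keys p. scale (Poly_Mapping.lookup p w) (word_prod x (letters w)))"

context nc_prob_space
begin

lemma ncp_eval_superset:
  assumes "finite S" "Poly_Mapping.keys p \<subseteq> S"
  shows "ncp_eval scale x p = (\<Sum>w\<in>S. scale (Poly_Mapping.lookup p w) (word_prod x (letters w)))"
  unfolding ncp_eval_def
  by (rule sum.mono_neutral_left) (use assms in \<open>auto simp: in_keys_iff\<close>)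

lemma ncp_eval_add: "ncp_eval scale x (p + q) = ncp_eval scale x p + ncp_eval scale x q"
  using Poly_Mapping.keys_add[of p q]
  by (simp add: ncp_eval_superset[of "Poly_Mapping.keys p \<union> Poly_Mapping.keys q"]
      lookup_add vs1.scale_left_distrib sum.distrib)

lemma ncp_eval_scale: "ncp_eval scale x (ncp_scale c p) = scale c (ncp_eval scale x p)"
proof -
  have "Poly_Mapping.keys (ncp_scale c p) \<subseteq> Poly_Mapping.keys p" by (auto simp: in_keys_iff)
  then show ?thesis
    by (simp add: ncp_eval_superset[of "Poly_Mapping.keys p"] vs1.scale_sum_right)
qed

lemma ncp_eval_word [simp]: "ncp_eval scale x (word_prod ncp_var w) = word_prod x w"
  by (simp add: ncp_eval_def word_prod_ncp_var)

lemma ncp_eval_var [simp]: "ncp_eval scale x (ncp_var i) = x i"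
  using ncp_eval_word[of x "[i]"] by simp

lemma ncp_eval_1 [simp]: "ncp_eval scale x 1 = 1"
  using ncp_eval_word[of x "[]"] by simp

lemma ncp_eval_sum: "ncp_eval scale x (\<Sum>i\<in>I. f i) = (\<Sum>i\<in>I. ncp_eval scale x (f i))"
  by (induction I rule: infinite_finite_induct) (auto simp: ncp_eval_add, auto simp: ncp_eval_def)

lemma ncp_eval_mult: "ncp_eval scale x (p * q) = ncp_eval scale x p * ncp_eval scale x q"
proof -
  interpret ncp: vector_space ncp_scale by (rule vector_space_ncp_scale)
  have "p * q = (\<Sum>v\<in>Poly_Mapping.keys p. \<Sum>w\<in>Poly_Mapping.keys q.
      ncp_scale (Poly_Mapping.lookup p v) (ncp_scale (Poly_Mapping.lookup q w)
        (word_prod ncp_var (letters v @ letters w))))"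
    by (subst ncp_expand[of p], subst ncp_expand[of q])
      (simp add: sum_product ncp_scale_mult_left ncp_scale_mult_right word_prod_append mult.commute)
  then have "ncp_eval scale x (p * q) = (\<Sum>v\<in>Poly_Mapping.keys p. \<Sum>w\<in>Poly_Mapping.keys q.
      scale (Poly_Mapping.lookup p v) (scale (Poly_Mapping.lookup q w)
        (word_prod x (letters v) * word_prod x (letters w))))"
    by (simp only: ncp_eval_sum ncp_eval_scale ncp_eval_word flip: word_prod_append)
  also have "\<dots> = ncp_eval scale x p * ncp_eval scale x q"
    by (simp add: ncp_eval_def sum_product mult_scale_left mult_scale_right)
      (simp add: mult.commute)
  finally show ?thesis .
qed

lemma ncp_eval_prod_list:
  "ncp_eval scale x (prod_list ps) = prod_list (map (ncp_eval scale x) ps)"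
  by (induction ps) (simp_all add: ncp_eval_mult)

lemma ncp_eval_distribution: "(\<lambda>p. \<phi> (ncp_eval scale x p)) \<in> D_alg"
  by (rule D_algI) (simp_all add: ncp_eval_add ncp_eval_scale add scale phi_one)

lemma joint_distribution_eval:
  "has_joint_distribution \<phi> x \<mu> \<Longrightarrow> \<phi> (ncp_eval scale x p) = \<mu> p"
  using D_alg_eqI[OF ncp_eval_distribution[of x], of \<mu>]
  by (auto simp: has_joint_distribution_def fun_eq_iff)

end

lemma has_joint_distribution_unique:
  "has_joint_distribution \<phi> x \<mu> \<Longrightarrow> has_joint_distribution \<phi> x \<nu> \<Longrightarrow> \<mu> = \<nu>"
  by (rule D_alg_eqI) (auto simp: has_joint_distribution_def)

lemma unital_subalgebra_hull: "unital_subalgebra scale (unital_subalgebra scale hull S)"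
  by (rule hull_in) (auto simp: unital_subalgebra_def)

lemma free_functionals_agree:
  fixes scale :: "complex \<Rightarrow> 'm::ring_1 \<Rightarrow> 'm"
  assumes "nc_prob_space scale \<phi>" "nc_prob_space scale \<phi>'"
    and free: "freely_independent scale \<phi> S T" "freely_independent scale \<phi>' S T"
    and A: "A = (\<lambda>r. unital_subalgebra scale hull (if r then S else T))"
    and agree: "\<And>r a. a \<in> A r \<Longrightarrow> \<phi> a = \<phi>' a"
  shows "\<forall>(r, a)\<in>set as. a \<in> A r \<Longrightarrow> \<phi> (prod_list (map snd as)) = \<phi>' (prod_list (map snd as))"
proof (induction "length as" arbitrary: as rule: less_induct)
  interpret P: nc_prob_space scale \<phi> by fact
  interpret P': nc_prob_space scale \<phi>' by fact
  have sub: "unital_subalgebra scale (A r)" for r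
    by (simp add: A unital_subalgebra_hull)
  case less
  show ?case
  proof (cases "\<forall>j. Suc j < length as \<longrightarrow> fst (as ! j) \<noteq> fst (as ! Suc j)")
    case False
    then obtain j where j: "Suc j < length as" "fst (as ! j) = fst (as ! Suc j)" by blast
    obtain r a where a: "as ! j = (r, a)" by (cases "as ! j")
    with j obtain b where b: "as ! Suc j = (r, b)" by (cases "as ! Suc j") auto
    have split: "as = take j as @ (r, a) # (r, b) # drop (Suc (Suc j)) as"
      using j(1) a b by (metis Cons_nth_drop_Suc Suc_lessD id_take_nth_drop)
    let ?bs = "take j as @ (r, a * b) # drop (Suc (Suc j)) as"
    have prod: "prod_list (map snd as) = prod_list (map snd ?bs)"
      by (subst split) (simp add: mult.assoc)
    have "(r, a) \<in> set as" "(r, b) \<in> set as" using j(1) a b by (metis Suc_lessD nth_mem)+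
    then have "a * b \<in> A r" using less.prems sub[of r] unfolding unital_subalgebra_def by blast
    then have "\<forall>(r, a)\<in>set ?bs. a \<in> A r"
      using less.prems by (auto dest: in_set_takeD in_set_dropD)
    moreover have "length ?bs < length as" using j(1) by simp
    ultimately show ?thesis unfolding prod using less.hyps by blast
  next
    case True
    have "\<phi> (prod_list (map snd (us @ vs))) = \<phi>' (prod_list (map snd (us @ vs)))"
      if "length us + length vs = length as" "map fst (us @ vs) = map fst as"
        "\<forall>(r, a)\<in>set us. a \<in> A r \<and> \<phi> a = 0" "\<forall>(r, a)\<in>set vs. a \<in> A r" for us vs
      using that
    proof (induction vs arbitrary: us)
      case Nil
      show ?case
      proof (cases "us = []")
        case True
        then show ?thesis by (simp add: P.phi_one P'.phi_one)
      next
        case False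
        have alt: "Suc j < length us \<longrightarrow> fst (us ! j) \<noteq> fst (us ! Suc j)" for j
          using True Nil.prems(1,2) by (metis Suc_lessD add.right_neutral append_Nil2 list.size(3) nth_map)
        have z: "\<forall>(r, a)\<in>set us. a \<in> unital_subalgebra scale hull (if r then S else T) \<and> \<phi> a = 0"
          using Nil.prems(3) by (simp add: A)
        then have z': "\<forall>(r, a)\<in>set us. a \<in> unital_subalgebra scale hull (if r then S else T) \<and> \<phi>' a = 0"
          using agree unfolding A by fastforce
        have "\<phi> (prod_list (map snd us)) = 0"
          using free(1) False alt z unfolding freely_independent_def by blast
        moreover have "\<phi>' (prod_list (map snd us)) = 0"
          using free(2) False alt z' unfolding freely_independent_def by blast
        ultimately show ?thesis by simp
      qed
    next
      case (Cons v vs)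
      obtain r a where v: "v = (r, a)" by (cases v)
      define c where "c = scale (- \<phi> a) 1"
      have a: "a \<in> A r" using Cons.prems(4) v by simp
      have one: "1 \<in> A r" and "c \<in> A r"
        using sub[of r] unfolding unital_subalgebra_def c_def by blast+
      then have "a + c \<in> A r"
        using a sub[of r] unfolding unital_subalgebra_def by auto
      moreover have "\<phi> (a + c) = 0" by (simp only: c_def P.add P.scale P.phi_one) simp
      ultimately have 1: "\<phi> (prod_list (map snd ((us @ [(r, a + c)]) @ vs))) =
          \<phi>' (prod_list (map snd ((us @ [(r, a + c)]) @ vs)))"
        by (intro Cons.IH) (use Cons.prems v in auto)
      have "\<forall>(r, a)\<in>set (us @ vs). a \<in> A r" using Cons.prems(3,4) by auto
      moreover have "length (us @ vs) < length as" using Cons.prems(1) by simp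
      ultimately have 2: "\<phi> (prod_list (map snd (us @ vs))) = \<phi>' (prod_list (map snd (us @ vs)))"
        using less.hyps by blast
      have "prod_list (map snd (us @ v # vs)) =
          prod_list (map snd ((us @ [(r, a + c)]) @ vs)) + scale (\<phi> a) (prod_list (map snd (us @ vs)))"
        by (simp add: v c_def algebra_simps P.mult_scale_left P.mult_scale_right)
      then show ?case
        by (simp only: P.add P'.add P.scale P'.scale 1 2)
    qed
    from this[of "[]" as] less.prems show ?thesis by simp
  qed
qed

lemma free_realization_unique:
  fixes \<phi> \<phi>' :: "('k + 'k) ncpoly \<Rightarrow> complex"
  assumes "free_realization ncp_scale \<phi> (\<lambda>i. ncp_var (Inl i)) (\<lambda>i. ncp_var (Inr i)) \<mu> \<nu>"
    and "free_realization ncp_scale \<phi>' (\<lambda>i. ncp_var (Inl i)) (\<lambda>i. ncp_var (Inr i)) \<mu> \<nu>"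
  shows "\<phi> = \<phi>'"
proof -
  let ?X = "\<lambda>i. ncp_var (Inl i) :: ('k + 'k) ncpoly" and ?Y = "\<lambda>i. ncp_var (Inr i) :: ('k + 'k) ncpoly"
  define A where "A r = unital_subalgebra ncp_scale hull (if r then range ?X else range ?Y)" for r
  interpret P: nc_prob_space ncp_scale \<phi> using assms(1) by (simp add: free_realization_def)
  interpret P': nc_prob_space ncp_scale \<phi>' using assms(2) by (simp add: free_realization_def)
  have hull: "unital_subalgebra ncp_scale hull (range z) \<subseteq> range (ncp_eval ncp_scale z)"
    for z :: "'k \<Rightarrow> ('k + 'k) ncpoly"
  proof (rule hull_minimal)
    show "range z \<subseteq> range (ncp_eval ncp_scale z)"
    proof (rule image_subsetI)
      fix i show "z i \<in> range (ncp_eval ncp_scale z)"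
        using rangeI[of "ncp_eval ncp_scale z" "ncp_var i"] by simp
    qed
    show "unital_subalgebra ncp_scale (range (ncp_eval ncp_scale z))"
      unfolding unital_subalgebra_def
    proof (intro conjI ballI allI)
      show "1 \<in> range (ncp_eval ncp_scale z)"
        using rangeI[of "ncp_eval ncp_scale z" 1] by simp
    next
      fix a b assume "a \<in> range (ncp_eval ncp_scale z)" "b \<in> range (ncp_eval ncp_scale z)"
      then obtain p q where pq: "a = ncp_eval ncp_scale z p" "b = ncp_eval ncp_scale z q" by blast
      show "a + b \<in> range (ncp_eval ncp_scale z)"
        unfolding pq P.ncp_eval_add[symmetric] by (rule rangeI)
      show "a * b \<in> range (ncp_eval ncp_scale z)"
        unfolding pq P.ncp_eval_mult[symmetric] by (rule rangeI)
    next
      fix c a assume "a \<in> range (ncp_eval ncp_scale z)"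
      then obtain p where p: "a = ncp_eval ncp_scale z p" by blast
      show "ncp_scale c a \<in> range (ncp_eval ncp_scale z)"
        unfolding p P.ncp_eval_scale[symmetric] by (rule rangeI)
    qed
  qed
  have agree: "\<phi> a = \<phi>' a" if a: "a \<in> A r" for a r
  proof -
    obtain z :: "'k \<Rightarrow> ('k + 'k) ncpoly" and \<rho>
      where z: "A r = unital_subalgebra ncp_scale hull (range z)"
      and \<rho>: "has_joint_distribution \<phi> z \<rho>" "has_joint_distribution \<phi>' z \<rho>"
    proof (cases r)
      case True
      then show ?thesis
        by (intro that[of ?X \<mu>]) (use assms in \<open>simp_all add: A_def free_realization_def\<close>)
    next
      case False
      then show ?thesis
        by (intro that[of ?Y \<nu>]) (use assms in \<open>simp_all add: A_def free_realization_def\<close>)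
    qed
    have "a \<in> range (ncp_eval ncp_scale z)" by (rule subsetD[OF hull a[unfolded z]])
    then obtain p where "a = ncp_eval ncp_scale z p" by blast
    then show ?thesis
      by (simp add: P.joint_distribution_eval[OF \<rho>(1)] P'.joint_distribution_eval[OF \<rho>(2)])
  qed
  show ?thesis
  proof (rule D_alg_eqI)
    show "\<phi> \<in> D_alg" "\<phi>' \<in> D_alg"
      by (simp_all add: D_alg_iff_nc_prob_space P.nc_prob_space_axioms P'.nc_prob_space_axioms)
    fix w :: "('k + 'k) list"
    let ?as = "map (\<lambda>i. (isl i, ncp_var i)) w"
    have "ncp_var i \<in> A (isl i)" for i
      unfolding A_def by (cases i) (auto intro!: hull_inc)
    then have mem: "\<forall>(r, a)\<in>set ?as. a \<in> A r" by auto
    have "\<phi> (prod_list (map snd ?as)) = \<phi>' (prod_list (map snd ?as))"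
    proof (rule free_functionals_agree[OF P.nc_prob_space_axioms P'.nc_prob_space_axioms])
      show "freely_independent ncp_scale \<phi> (range ?X) (range ?Y)"
        "freely_independent ncp_scale \<phi>' (range ?X) (range ?Y)"
        using assms by (simp_all add: free_realization_def)
      show "A = (\<lambda>r. unital_subalgebra ncp_scale hull (if r then range ?X else range ?Y))"
        by (rule ext) (simp add: A_def)
      show "\<phi> a = \<phi>' a" if "a \<in> A r" for r a using that by (rule agree)
      show "\<forall>(r, a)\<in>set ?as. a \<in> A r" by (rule mem)
    qed
    then show "\<phi> (word_prod ncp_var w) = \<phi>' (word_prod ncp_var w)"
      by (simp add: word_prod_def comp_def)
  qed
qed

lemma free_realization_pullback:
  fixes x y :: "'k \<Rightarrow> 'm::ring_1"
  assumes "free_realization scale \<phi> x y \<mu> \<nu>"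
  defines "\<psi> \<equiv> \<lambda>p :: ('k + 'k) ncpoly. \<phi> (ncp_eval scale (case_sum x y) p)"
  shows "free_realization ncp_scale \<psi> (\<lambda>i. ncp_var (Inl i)) (\<lambda>i. ncp_var (Inr i)) \<mu> \<nu>"
proof -
  let ?X = "\<lambda>i. ncp_var (Inl i) :: ('k + 'k) ncpoly" and ?Y = "\<lambda>i. ncp_var (Inr i) :: ('k + 'k) ncpoly"
  let ?ev = "ncp_eval scale (case_sum x y)"
  interpret nc_prob_space scale \<phi> using assms(1) by (simp add: free_realization_def)
  have word: "?ev (word_prod z w) = word_prod (\<lambda>i. ?ev (z i)) w" for z :: "'k \<Rightarrow> _" and w
    by (simp add: word_prod_def ncp_eval_prod_list comp_def)
  have hull: "?ev a \<in> unital_subalgebra scale hull (range (\<lambda>i. ?ev (z i)))"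
    if "a \<in> unital_subalgebra ncp_scale hull (range z)" for a and z :: "'k \<Rightarrow> ('k + 'k) ncpoly"
  proof -
    let ?B = "{a. ?ev a \<in> unital_subalgebra scale hull (range (\<lambda>i. ?ev (z i)))}"
    have "unital_subalgebra ncp_scale ?B"
      using unital_subalgebra_hull[of scale "range (\<lambda>i. ?ev (z i))"]
      by (auto simp: unital_subalgebra_def ncp_eval_add ncp_eval_mult ncp_eval_scale)
    moreover have "range z \<subseteq> ?B" by (auto intro!: hull_inc)
    ultimately show ?thesis using that hull_minimal[of "range z" ?B] by blast
  qed
  have "freely_independent ncp_scale \<psi> (range ?X) (range ?Y)"
    unfolding freely_independent_def
  proof (intro allI impI)
    fix as :: "(bool \<times> ('k + 'k) ncpoly) list"
    assume as: "as \<noteq> []"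
      "\<forall>(r, a)\<in>set as. a \<in> unital_subalgebra ncp_scale hull (if r then range ?X else range ?Y) \<and> \<psi> a = 0"
      "\<forall>j. Suc j < length as \<longrightarrow> fst (as ! j) \<noteq> fst (as ! Suc j)"
    let ?bs = "map (\<lambda>(r, a). (r, ?ev a)) as"
    have "\<forall>(r, a)\<in>set ?bs. a \<in> unital_subalgebra scale hull (if r then range x else range y) \<and> \<phi> a = 0"
      using as(2) hull[of _ ?X] hull[of _ ?Y] by (fastforce simp: \<psi>_def split: if_splits)
    moreover have "fst (?bs ! j) = fst (as ! j)" if "j < length as" for j
      using that by (simp add: case_prod_unfold)
    then have "\<forall>j. Suc j < length ?bs \<longrightarrow> fst (?bs ! j) \<noteq> fst (?bs ! Suc j)"
      using as(3) by (metis Suc_lessD length_map)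
    moreover have "?bs \<noteq> []" using as(1) by simp
    ultimately have "\<phi> (prod_list (map snd ?bs)) = 0"
      using assms(1) unfolding free_realization_def freely_independent_def by blast
    moreover have "map snd ?bs = map ?ev (map snd as)" by (simp add: case_prod_unfold)
    ultimately show "\<psi> (prod_list (map snd as)) = 0"
      by (simp only: \<psi>_def ncp_eval_prod_list)
  qed
  then show ?thesis
    using assms(1) ncp_eval_distribution[of "case_sum x y"]
    by (auto simp: free_realization_def has_joint_distribution_def \<psi>_def word
        simp flip: D_alg_iff_nc_prob_space)
qed

theorem boxtimes_eqI:
  assumes "free_realization scale \<phi> x y \<mu> \<nu>" "has_joint_distribution \<phi> (\<lambda>i. x i * y i) \<rho>"
  shows "\<mu> \<boxtimes> \<nu> = \<rho>"
  unfolding boxtimes_def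
proof (rule the_equality)
  interpret nc_prob_space scale \<phi> using assms(1) by (simp add: free_realization_def)
  let ?\<psi> = "\<lambda>p. \<phi> (ncp_eval scale (case_sum x y) p)"
  have real: "free_realization ncp_scale ?\<psi> (\<lambda>i. ncp_var (Inl i)) (\<lambda>i. ncp_var (Inr i)) \<mu> \<nu>"
    by (rule free_realization_pullback[OF assms(1)])
  have joint: "has_joint_distribution ?\<psi> (\<lambda>i. ncp_var (Inl i) * ncp_var (Inr i)) \<rho>"
    using assms(2)
    by (simp add: has_joint_distribution_def word_prod_def ncp_eval_prod_list ncp_eval_mult comp_def)
  from real joint show "\<exists>\<phi>. free_realization ncp_scale \<phi> (\<lambda>i. ncp_var (Inl i)) (\<lambda>i. ncp_var (Inr i)) \<mu> \<nu> \<and>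
      has_joint_distribution \<phi> (\<lambda>i. ncp_var (Inl i) * ncp_var (Inr i)) \<rho>"
    by (intro exI[of _ ?\<psi>] conjI)
  fix \<rho>'
  assume "\<exists>\<phi>. free_realization ncp_scale \<phi> (\<lambda>i. ncp_var (Inl i)) (\<lambda>i. ncp_var (Inr i)) \<mu> \<nu> \<and>
      has_joint_distribution \<phi> (\<lambda>i. ncp_var (Inl i) * ncp_var (Inr i)) \<rho>'"
  then obtain \<phi>' where
    real': "free_realization ncp_scale \<phi>' (\<lambda>i. ncp_var (Inl i)) (\<lambda>i. ncp_var (Inr i)) \<mu> \<nu>"
    and joint': "has_joint_distribution \<phi>' (\<lambda>i. ncp_var (Inl i) * ncp_var (Inr i)) \<rho>'"
    by blast
  have "\<phi>' = ?\<psi>" by (rule free_realization_unique[OF real' real])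
  with joint' show "\<rho>' = \<rho>" using has_joint_distribution_unique[OF _ joint] by simp
qed

end

theory Submission
  imports Defs
begin

text \<open>
  Write \<open>F(z \<cdot> N)\<close> for the substitution of \<open>z\<^sub>i N\<close> for \<open>z\<^sub>i\<close>. Two functional equations carry the proof.

  (1) Let \<open>x\<^sub>i\<close>, \<open>y\<^sub>i\<close> be free with eta-series \<open>f\<close>, \<open>g\<close>, and let \<open>A\<close>, \<open>A'\<close> solve
  \<open>A\<^sub>j = z\<^sub>j (\<partial>\<^sub>j g)(A')\<close>, \<open>A'\<^sub>j = (f \<partial>\<^sub>j)(A) z\<^sub>j\<close>, where \<open>\<partial>\<^sub>j\<close> removes a first respectively last letter.
  Then the eta-series of \<open>x\<^sub>i y\<^sub>i\<close> is \<open>h = f(A) = g(A')\<close>: with \<open>H = (1 - h)\<^sup>-\<^sup>1\<close>,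
  \<open>p = (1 - \<Sum> A\<^sub>j x\<^sub>j)\<^sup>-\<^sup>1\<close> and \<open>q = (1 - \<Sum> A'\<^sub>j y\<^sub>j)\<^sup>-\<^sup>1\<close> one has
  \<open>(1 - \<Sum> z\<^sub>j x\<^sub>j y\<^sub>j) q = p\<^sup>-\<^sup>1 (H - \<Sum> u\<^sub>j t\<^sub>j)\<close> for centred series \<open>u\<^sub>j\<close> in the \<open>x\<close>
  and \<open>t\<^sub>j\<close> in the \<open>y\<close>, so by freeness \<open>\<phi>\<close> maps the inverse of \<open>1 - \<Sum> z\<^sub>j x\<^sub>j y\<^sub>j\<close> to \<open>H\<close>.

  (2) The series \<open>N = 1 + M\<close> of the moments of the image under the bijection of a distribution with
  eta-series \<open>h\<close> satisfies \<open>N = 1 + h(z \<cdot> N)\<close>.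

  If \<open>A\<close>, \<open>A'\<close> solve the equations of (1) for \<open>f\<close>, \<open>g\<close>, then by (2) \<open>A\<^sub>j(z \<cdot> N) N\<^sup>-\<^sup>1\<close>,
  \<open>A'\<^sub>j(z \<cdot> N) N\<^sup>-\<^sup>1\<close> solve them for the eta-series of the images, and the resulting
  eta-series of the product is \<open>1 - N\<^sup>-\<^sup>1\<close>, which is that of the image of the product.
\<close>

section \<open>Non-commutative formal power series over a ring\<close>

text \<open>A separate type allows a ring structure, with coefficients in any ring. They will lie in
  the algebra of the probability space; the indeterminates commute with the coefficients.\<close>

typedef ('k, 'a) ser = "UNIV :: ('k list \<Rightarrow> 'a) set"
  morphisms coef Ser by simp

lemma coef_Ser [simp]: "coef (Ser f) = f"
  by (simp add: Ser_inverse)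

lemma ser_eqI: "(\<And>w. coef F w = coef G w) \<Longrightarrow> F = G"
  by (simp add: coef_inject[symmetric] fun_eq_iff)

instantiation ser :: (type, ring_1) ring_1
begin
definition "0 = Ser (\<lambda>w. 0)"
definition "1 = Ser (\<lambda>w. if w = [] then 1 else 0)"
definition "F + G = Ser (\<lambda>w. coef F w + coef G w)"
definition "F - G = Ser (\<lambda>w. coef F w - coef G w)"
definition "- F = Ser (\<lambda>w. - coef F w)"
definition "F * G = Ser (\<lambda>w. \<Sum>n\<le>length w. coef F (take n w) * coef G (drop n w))"

lemma coef_0 [simp]: "coef 0 w = 0"
  and coef_1: "coef 1 w = (if w = [] then 1 else 0)"
  and coef_add [simp]: "coef (F + G) w = coef F w + coef G w"
  and coef_diff [simp]: "coef (F - G) w = coef F w - coef G w"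
  and coef_uminus [simp]: "coef (- F) w = - coef F w"
  and coef_mult: "coef (F * G) w = (\<Sum>n\<le>length w. coef F (take n w) * coef G (drop n w))"
  by (simp_all add: zero_ser_def one_ser_def plus_ser_def minus_ser_def uminus_ser_def times_ser_def)

lemma coef_1_Nil [simp]: "coef 1 [] = 1"
  and coef_1_Cons [simp]: "coef 1 (i # w) = 0"
  by (simp_all add: coef_1)

lemma coef_mult_Nil [simp]: "coef (F * G) [] = coef F [] * coef G []"
  by (simp add: coef_mult)

lemma coef_mult_Cons:
  "coef (F * G) (i # w) = coef F [] * coef G (i # w) + coef (Ser (\<lambda>u. coef F (i # u)) * G) w"
  by (simp add: coef_mult sum.atMost_Suc_shift del: sum.atMost_Suc)

instance
proof
  fix F G H :: "('a, 'b) ser"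
  show "F * G * H = F * (G * H)"
  proof (rule ser_eqI)
    \<comment> \<open>Stripping the first letter of \<open>F * G\<close> leaves a sum of two terms,
      so the induction on the word uses linearity in the left factor.\<close>
    have add: "Ser (\<lambda>u. c * coef F u + coef G u) * H = Ser (\<lambda>u. c * coef (F * H) u + coef (G * H) u)"
      for c and F G H :: "('a, 'b) ser"
      by (rule ser_eqI) (simp add: coef_mult algebra_simps sum.distrib sum_distrib_left)
    fix w show "coef (F * G * H) w = coef (F * (G * H)) w"
    proof (induction w arbitrary: F)
      case (Cons i w)
      have "Ser (\<lambda>u. coef (F * G) (i # u)) =
          Ser (\<lambda>u. coef F [] * coef (Ser (\<lambda>u. coef G (i # u))) u + coef (Ser (\<lambda>u. coef F (i # u)) * G) u)"
        by (simp add: coef_mult_Cons)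
      then show ?case
        by (simp add: coef_mult_Cons add[of _ "Ser (\<lambda>u. coef G (i # u))", simplified coef_Ser] Cons.IH algebra_simps)
    qed (simp add: mult.assoc)
  qed
  show "1 * F = F"
  proof (rule ser_eqI)
    fix w show "coef (1 * F) w = coef F w"
      by (cases w) (simp_all add: coef_mult_Cons, simp add: coef_mult)
  qed
  show "F * 1 = F"
  proof (rule ser_eqI)
    fix w show "coef (F * 1) w = coef F w"
      by (induction w arbitrary: F) (simp_all add: coef_mult_Cons)
  qed
  show "(F + G) * H = F * H + G * H" "F * (G + H) = F * G + F * H"
    by (auto intro!: ser_eqI simp: coef_mult algebra_simps sum.distrib)
  show "(0 :: ('a, 'b) ser) \<noteq> 1" by (metis coef_0 coef_1_Nil zero_neq_one)
qed (auto intro!: ser_eqI)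

end

lemma coef_sum [simp]: "coef (\<Sum>i\<in>I. F i) w = (\<Sum>i\<in>I. coef (F i) w)"
  by (induction I rule: infinite_finite_induct) auto

section \<open>Constants, letters, and removal of a first or last letter\<close>

definition cst :: "'a \<Rightarrow> ('k, 'a::ring_1) ser"
  where "cst c = Ser (\<lambda>w. if w = [] then c else 0)"

definition var :: "'k \<Rightarrow> ('k, 'a::ring_1) ser"
  where "var i = Ser (\<lambda>w. if w = [i] then 1 else 0)"

definition ld :: "'k \<Rightarrow> ('k, 'a) ser \<Rightarrow> ('k, 'a) ser"
  where "ld i F = Ser (\<lambda>w. coef F (i # w))"

definition rd :: "'k \<Rightarrow> ('k, 'a) ser \<Rightarrow> ('k, 'a) ser"
  where "rd i F = Ser (\<lambda>w. coef F (w @ [i]))"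

lemma coef_cst_Nil [simp]: "coef (cst c) [] = c"
  and coef_cst_Cons [simp]: "coef (cst c) (i # w) = 0"
  and coef_var_Nil [simp]: "coef (var i) [] = 0"
  and coef_ld [simp]: "coef (ld i F) w = coef F (i # w)"
  and coef_rd [simp]: "coef (rd i F) w = coef F (w @ [i])"
  by (simp_all add: cst_def var_def ld_def rd_def)

lemma cst_0 [simp]: "cst 0 = 0" and cst_1 [simp]: "cst 1 = 1"
  by (auto intro!: ser_eqI simp: cst_def coef_1)

text \<open>The first letter of a word of the product comes from \<open>F\<close>, unless
  \<open>F\<close> contributes the empty word; then only its constant term enters and the letter
  comes from \<open>G\<close>.\<close>

lemma ld_mult: "ld i (F * G) = cst (coef F []) * ld i G + ld i F * G"
proof (rule ser_eqI)
  fix w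
  have "coef (cst c * K) w = c * coef K w" for c and K :: "('a, 'b) ser"
  proof (cases w)
    case (Cons j u)
    have "Ser (\<lambda>v. coef (cst c) (j # v)) = (0 :: ('a, 'b) ser)" by (rule ser_eqI) simp
    then show ?thesis using Cons by (simp add: coef_mult_Cons)
  qed simp
  then show "coef (ld i (F * G)) w = coef (cst (coef F []) * ld i G + ld i F * G) w"
    by (simp add: coef_mult_Cons ld_def)
qed

lemma ld_add [simp]: "ld i (F + G) = ld i F + ld i G"
  and ld_1 [simp]: "ld i 1 = (0 :: ('a, 'b::ring_1) ser)"
  and ld_0 [simp]: "ld i 0 = (0 :: ('a, 'b) ser)"
  and ld_cst [simp]: "ld i (cst c) = (0 :: ('a, 'b) ser)"
  and ld_var: "ld i (var j) = (if i = j then 1 else 0 :: ('a, 'b) ser)"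
  by (auto intro!: ser_eqI simp: var_def coef_1)

lemma ld_sum [simp]: "ld i (\<Sum>j\<in>J. F j) = (\<Sum>j\<in>J. ld i (F j))"
  by (induction J rule: infinite_finite_induct) auto

lemma
  fixes F :: "('a, 'b::ring_1) ser"
  shows coef_cst_mult [simp]: "coef (cst c * F) w = c * coef F w"
  and coef_mult_cst [simp]: "coef (F * cst c) w = coef F w * c"
proof -
  have "coef (Ser (\<lambda>u. 0) * G) v = 0" for v and G :: "('a, 'b) ser"
    by (simp add: coef_mult)
  then show *: "coef (cst c * F) w = c * coef F w" for c w and F :: "('a, 'b) ser"
    by (cases w) (simp_all add: coef_mult_Cons)
  show "coef (F * cst c) w = coef F w * c"
    by (induction w arbitrary: F) (simp_all add: ld_mult * flip: coef_ld)
qed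

lemma cst_mult_cst: "cst a * cst b = (cst (a * b) :: ('k, 'a::ring_1) ser)"
  by (rule ser_eqI) (simp, simp add: cst_def)

lemma ser_eqI_ld:
  fixes F G :: "('k, 'a) ser"
  assumes "coef F [] = coef G []" "\<And>i. ld i F = ld i G" shows "F = G"
proof (rule ser_eqI)
  fix w show "coef F w = coef G w" using assms by (cases w) (auto simp flip: coef_ld)
qed

lemma coef_var_mult_Cons [simp]: "coef (var i * F) (j # w) = (if i = j then coef F w else 0)"
  by (simp add: ld_mult ld_var flip: coef_ld)

lemma coef_mult_var_snoc [simp]: "coef (F * var i) (w @ [j]) = (if i = j then coef F w else 0)"
proof (induction w arbitrary: F)
  case Nil
  then show ?case by (simp add: ld_mult ld_var flip: coef_ld)
next
  case (Cons k w)
  have "coef (cst (coef F []) * ld k (var i)) (w @ [j]) = 0" by (simp add: ld_var coef_1)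
  with Cons show ?case by (simp add: ld_mult flip: coef_ld)
qed

lemma var_commute: "cst c * var i = var i * cst (c :: 'a::ring_1)"
  by (rule ser_eqI) (auto simp: var_def)

lemma left_decomposition:
  fixes F :: "('k::finite, 'a::ring_1) ser"
  shows "F = cst (coef F []) + (\<Sum>i\<in>UNIV. var i * ld i F)"
  by (rule ser_eqI_ld) (simp_all add: ld_mult ld_var if_distrib[of "\<lambda>x. x * _"] cong: if_cong)

lemma left_decomposition_unique: "ld i (\<Sum>j\<in>(UNIV :: 'k::finite set). var j * F j) = F i"
  by (simp add: ld_mult ld_var if_distrib[of "\<lambda>x. x * _"] sum.delta cong: if_cong)

lemma right_decomposition:
  fixes F :: "('k::finite, 'a::ring_1) ser"
  shows "F = cst (coef F []) + (\<Sum>i\<in>UNIV. rd i F * var i)"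
proof (rule ser_eqI)
  fix w show "coef F w = coef (cst (coef F []) + (\<Sum>i\<in>UNIV. rd i F * var i)) w"
    by (cases w rule: rev_cases) (simp_all add: cst_def)
qed

lemma right_decomposition_unique: "rd i (\<Sum>j\<in>(UNIV :: 'k::finite set). F j * var j) = F i"
  by (rule ser_eqI) simp

text \<open>Without a constant term \<open>G\<close> contributes a nonempty word, so the last letter
  always comes from \<open>G\<close>.\<close>

lemma rd_mult:
  fixes F G :: "('k::finite, 'a::ring_1) ser"
  assumes "coef G [] = 0"
  shows "rd i (F * G) = F * rd i G"
proof -
  have "F * G = (\<Sum>i\<in>UNIV. (F * rd i G) * var i)"
    by (subst right_decomposition[of G]) (simp add: assms sum_distrib_left mult.assoc)
  then show ?thesis by (simp add: right_decomposition_unique)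
qed

section \<open>Fixed points\<close>

text \<open>Congruence modulo words of length at least \<open>n\<close>. It replaces convergence of
  coefficients: series that agree to every order are equal.\<close>

definition agree :: "nat \<Rightarrow> ('k, 'a) ser \<Rightarrow> ('k, 'a) ser \<Rightarrow> bool"
  where "agree n F G \<longleftrightarrow> (\<forall>w. length w < n \<longrightarrow> coef F w = coef G w)"

lemma agree_refl [simp]: "agree n F F"
  and agree_0 [simp]: "agree 0 F G"
  and agree_sym: "agree n F G \<Longrightarrow> agree n G F"
  and agree_trans: "agree n F G \<Longrightarrow> agree n G H \<Longrightarrow> agree n F H"
  and agree_mono: "agree n F G \<Longrightarrow> m \<le> n \<Longrightarrow> agree m F G"
  and agree_1: "agree (Suc 0) F G \<longleftrightarrow> coef F [] = coef G []"
  by (auto simp: agree_def)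

lemma agree_eqI: "(\<And>n. agree n F G) \<Longrightarrow> F = G"
  by (rule ser_eqI) (auto simp: agree_def)

lemma agree_Suc_iff: "agree (Suc n) F G \<longleftrightarrow> coef F [] = coef G [] \<and> (\<forall>i. agree n (ld i F) (ld i G))"
proof (intro iffI conjI allI)
  assume *: "coef F [] = coef G [] \<and> (\<forall>i. agree n (ld i F) (ld i G))"
  show "agree (Suc n) F G"
    unfolding agree_def
  proof (intro allI impI)
    fix w :: "'a list" assume "length w < Suc n"
    then show "coef F w = coef G w" using * by (cases w) (auto simp: agree_def)
  qed
qed (auto simp: agree_def)

lemma agree_add: "agree n F F' \<Longrightarrow> agree n G G' \<Longrightarrow> agree n (F + G) (F' + G')"
  by (simp add: agree_def)

lemma agree_sum: "(\<And>i. i \<in> I \<Longrightarrow> agree n (F i) (G i)) \<Longrightarrow> agree n (\<Sum>i\<in>I. F i) (\<Sum>i\<in>I. G i)"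
  by (simp add: agree_def)

lemma agree_mult: "agree n F F' \<Longrightarrow> agree n G G' \<Longrightarrow> agree n (F * G) (F' * G')"
  by (simp add: agree_def coef_mult)

text \<open>A factor without constant term uses up at least one letter, so \<open>G\<close> enters
  only through words one letter shorter. Gains of this kind drive the contraction arguments
  below.\<close>

lemma agree_mult_shift:
  assumes "agree (Suc n) F F'" "coef F [] = 0" "agree n G G'"
  shows "agree (Suc n) (F * G) (F' * G')"
proof -
  have "coef F' [] = 0" using assms by (simp add: agree_def)
  moreover have "agree n (ld i F * G) (ld i F' * G')" for i
    using assms by (intro agree_mult) (auto simp: agree_Suc_iff)
  ultimately show ?thesis using assms(2) by (simp add: agree_Suc_iff ld_mult)
qed

lemma agree_mult_shift_right:
  fixes F F' :: "('k, 'a::ring_1) ser"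
  assumes "agree n F F'" shows "agree (Suc n) (F * var i) (F' * var i)"
  unfolding agree_def
proof (intro allI impI)
  fix w :: "'k list" assume "length w < Suc n"
  then show "coef (F * var i) w = coef (F' * var i) w"
    using assms by (cases w rule: rev_cases) (auto simp: agree_def)
qed

text \<open>Banach's fixed point principle for families of series: a map that gains one order of
  agreement has exactly one fixed point with the constant terms \<open>c\<close>. Prescribing the
  constant terms matters where the members are substituted into other series.\<close>

locale series_contraction =
  fixes T :: "('i \<Rightarrow> ('k, 'a::ring_1) ser) \<Rightarrow> 'i \<Rightarrow> ('k, 'a) ser" and c :: "'i \<Rightarrow> 'a"
  assumes const: "\<And>X i. (\<And>i. coef (X i) [] = c i) \<Longrightarrow> coef (T X i) [] = c i"
    and contr: "\<And>n X Y i. (\<And>i. coef (X i) [] = c i) \<Longrightarrow> (\<And>i. coef (Y i) [] = c i) \<Longrightarrow>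
      (\<And>i. agree n (X i) (Y i)) \<Longrightarrow> agree (Suc n) (T X i) (T Y i)"
begin

lemma fixpoint_unique:
  assumes "T X = X" "T Y = Y" "\<And>i. coef (X i) [] = c i" "\<And>i. coef (Y i) [] = c i"
  shows "X = Y"
proof -
  have "agree n (X i) (Y i)" for n i
    by (induction n arbitrary: i) (use contr[OF assms(3,4)] assms(1,2) in auto)
  then show ?thesis by (intro ext agree_eqI)
qed

lemma fixpoint_exists: obtains X where "T X = X" "\<And>i. coef (X i) [] = c i"
proof -
  define Y where "Y n = (T ^^ n) (\<lambda>i. cst (c i))" for n
  have Y0: "coef (Y n i) [] = c i" for n i
    by (induction n arbitrary: i) (use const in \<open>auto simp: Y_def\<close>)
  have step: "agree n (Y n i) (Y (n + m) i)" for n m i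
  proof (induction n arbitrary: i)
    case (Suc n)
    then show ?case using contr[OF Y0[of n] Y0[of "n + m"]] by (simp add: Y_def)
  qed simp
  \<comment> \<open>The coefficient at \<open>w\<close> is stable from the iterate with index
    \<open>Suc (length w)\<close> on, so it can be read off there.\<close>
  define X where "X i = Ser (\<lambda>w. coef (Y (Suc (length w)) i) w)" for i
  have XY: "agree n (X i) (Y n i)" for n i
    unfolding agree_def
  proof (intro allI impI)
    fix w :: "'k list" assume "length w < n"
    then show "coef (X i) w = coef (Y n i) w"
      using step[of "Suc (length w)" i "n - Suc (length w)"] by (simp add: X_def agree_def)
  qed
  have X0: "coef (X i) [] = c i" for i using Y0 by (simp add: X_def)
  have "T X i = X i" for i
  proof (rule agree_eqI)
    fix n
    have "agree (Suc n) (T X i) (Y (Suc n) i)"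
      using contr[OF X0 Y0 XY] by (simp add: Y_def)
    then have "agree (Suc n) (T X i) (X i)" using XY agree_sym agree_trans by blast
    then show "agree n (T X i) (X i)" by (rule agree_mono) simp
  qed
  then show thesis using that X0 by blast
qed

end

text \<open>The geometric series, inverse to \<open>1 - F\<close> when \<open>F\<close> has no
  constant term; powers beyond \<open>length w\<close> then have no coefficient at
  \<open>w\<close>.\<close>

definition star :: "('k, 'a::ring_1) ser \<Rightarrow> ('k, 'a) ser"
  where "star F = Ser (\<lambda>w. \<Sum>n\<le>length w. coef (F ^ n) w)"

lemma coef_power_eq_0:
  assumes "coef F [] = 0" "length w < n"
  shows "coef (F ^ n) w = 0"
proof -
  have "agree n (F ^ n) 0" 
    by (induction n) (use agree_mult_shift[of _ F F _ 0] assms(1) in auto)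
  then show ?thesis using assms(2) by (simp add: agree_def)
qed

lemma star_agree:
  fixes F :: "('k, 'a::ring_1) ser"
  assumes "coef F [] = 0" shows "agree n (star F) (\<Sum>m<n. F ^ m)"
  unfolding agree_def
proof (intro allI impI)
  fix w :: "'k list" assume "length w < n"
  then have "(\<Sum>m\<le>length w. coef (F ^ m) w) = (\<Sum>m<n. coef (F ^ m) w)"
    by (intro sum.mono_neutral_left) (auto intro: coef_power_eq_0[OF assms])
  then show "coef (star F) w = coef (\<Sum>m<n. F ^ m) w" by (simp add: star_def)
qed

lemma
  fixes F :: "('k, 'a::ring_1) ser"
  assumes "coef F [] = 0"
  shows star_left: "(1 - F) * star F = 1" and star_right: "star F * (1 - F) = 1"
proof -
  have pow: "agree n (1 - F ^ n) 1" for n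
    by (auto simp: agree_def coef_power_eq_0[OF assms])
  \<comment> \<open>The telescoping of a finite geometric sum; modulo words of length at least
    \<open>n\<close> the remainder \<open>F ^ n\<close> vanishes.\<close>
  have geom: "(1 - F) * (\<Sum>m<n. F ^ m) = 1 - F ^ n" "(\<Sum>m<n. F ^ m) * (1 - F) = 1 - F ^ n" for n
    by (induction n)
      (simp_all add: distrib_left distrib_right,
        simp_all add: left_diff_distrib right_diff_distrib power_commutes)
  have "agree n ((1 - F) * star F) 1" for n
    using agree_trans[OF agree_mult[OF agree_refl star_agree[OF assms]], of n "1 - F" 1] pow[of n]
    by (simp add: geom)
  then show "(1 - F) * star F = 1" by (rule agree_eqI)
  have "agree n (star F * (1 - F)) 1" for n
    using agree_trans[OF agree_mult[OF star_agree[OF assms] agree_refl], of n "1 - F" 1] pow[of n]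
    by (simp add: geom)
  then show "star F * (1 - F) = 1" by (rule agree_eqI)
qed

section \<open>Substitution\<close>

locale complex_algebra = vector_space scale
  for scale :: "complex \<Rightarrow> 'm::ring_1 \<Rightarrow> 'm" +
  assumes mult_scale_left: "scale c a * b = scale c (a * b)"
    and mult_scale_right: "a * scale c b = scale c (a * b)"
begin

text \<open>Embedded scalar series commute with every constant of the algebra, though in general not
  with each other.\<close>

definition emb :: "('k, complex) ser \<Rightarrow> ('k, 'm) ser"
  where "emb s = Ser (\<lambda>w. scale (coef s w) 1)"

lemma coef_emb [simp]: "coef (emb s) w = scale (coef s w) 1"
  by (simp add: emb_def)

lemma emb_0 [simp]: "emb 0 = 0" and emb_1 [simp]: "emb 1 = 1"
  and emb_var [simp]: "emb (var i) = var i"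
  and emb_add: "emb (s + t) = emb s + emb t" and emb_diff: "emb (s - t) = emb s - emb t"
  by (auto intro!: ser_eqI simp: coef_1 var_def scale_left_distrib scale_left_diff_distrib)

lemma emb_mult: "emb (s * t) = emb s * emb t"
  by (rule ser_eqI) (simp add: coef_mult scale_sum_left mult_scale_left)

lemma emb_sum: "emb (\<Sum>i\<in>I. s i) = (\<Sum>i\<in>I. emb (s i))"
  by (induction I rule: infinite_finite_induct) (auto simp: emb_add)

lemma emb_cst_commute: "cst m * emb s = emb s * cst m"
  by (rule ser_eqI) (simp add: mult_scale_left mult_scale_right)

lemma agree_emb: "agree n s t \<Longrightarrow> agree n (emb s) (emb t)"
  by (simp add: agree_def)

text \<open>Substitution of \<open>a i\<close> for the letter \<open>i\<close>, keeping the
  coefficients of \<open>F\<close>. Stripping first letters has no base case, so the map is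
  specified as the unique solution of the recursion; the \<open>a i\<close> are to have no constant
  term.\<close>

definition subst :: "('k \<Rightarrow> ('j, complex) ser) \<Rightarrow> ('k::finite, 'm) ser \<Rightarrow> ('j, 'm) ser"
  where "subst a = (THE \<Phi>. \<forall>F. \<Phi> F = cst (coef F []) + (\<Sum>i\<in>UNIV. emb (a i) * \<Phi> (ld i F)))"

context
  fixes a :: "'k::finite \<Rightarrow> ('j, complex) ser"
  assumes a0: "\<And>i. coef (a i) [] = 0"
begin

lemma subst_ex1:
  "\<exists>!\<Phi>. \<forall>F :: ('k, 'm) ser. \<Phi> F = cst (coef F []) + (\<Sum>i\<in>UNIV. emb (a i) * \<Phi> (ld i F))"
proof -
  define T :: "(('k, 'm) ser \<Rightarrow> ('j, 'm) ser) \<Rightarrow> ('k, 'm) ser \<Rightarrow> ('j, 'm) ser" where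
    "T \<Phi> F = cst (coef F []) + (\<Sum>i\<in>UNIV. emb (a i) * \<Phi> (ld i F))" for \<Phi> F
  \<comment> \<open>The family is indexed by the series \<open>F\<close> themselves: the unknown is
    the whole map \<Phi>.\<close>
  interpret series_contraction T "\<lambda>F. coef F []"
    by standard (auto simp: T_def a0 intro!: agree_add agree_sum agree_mult_shift)
  have T: "(\<forall>F. \<Phi> F = cst (coef F []) + (\<Sum>i\<in>UNIV. emb (a i) * \<Phi> (ld i F))) \<longleftrightarrow> T \<Phi> = \<Phi>" for \<Phi>
    unfolding fun_eq_iff T_def by (intro iff_allI) (rule eq_commute)
  have fix0: "coef (Y F) [] = coef F []" if "T Y = Y" for Y F
    by (subst that[symmetric]) (simp add: T_def a0)
  obtain X where X: "T X = X" by (rule fixpoint_exists)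
  have "\<exists>!Y. T Y = Y"
  proof (rule ex1I[of _ X])
    show "T X = X" by (rule X)
    show "Y = X" if "T Y = Y" for Y
      by (rule fixpoint_unique[OF that X fix0[OF that] fix0[OF X]])
  qed
  then show ?thesis unfolding T .
qed

lemma subst_rec: "subst a F = cst (coef F []) + (\<Sum>i\<in>UNIV. emb (a i) * subst a (ld i F))"
  using theI'[OF subst_ex1] unfolding subst_def[symmetric] by blast

lemma coef_subst_Nil [simp]: "coef (subst a F) [] = coef F []"
  by (subst subst_rec) (simp add: a0)

text \<open>For identities of substitution by induction on the order: an expression that obeys the
  same recursion as \<open>subst a\<close> agrees with it to every order.\<close>

lemma agree_subst_rec:
  assumes "\<And>i. agree n (subst a (ld i F)) (G i)"
  shows "agree (Suc n) (subst a F) (cst (coef F []) + (\<Sum>i\<in>UNIV. emb (a i) * G i))"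
  by (subst subst_rec) (auto simp: a0 intro!: agree_add agree_sum agree_mult_shift assms)

lemma subst_cst [simp]: "subst a (cst m) = cst m"
proof (rule agree_eqI)
  have "agree n (subst a 0) 0" for n
    by (induction n) (use agree_subst_rec[of _ 0 "\<lambda>_. 0"] in simp_all)
  then have "subst a 0 = 0" by (rule agree_eqI)
  then show "agree n (subst a (cst m)) (cst m)" for n by (subst subst_rec) simp
qed

lemma subst_0 [simp]: "subst a 0 = 0" and subst_1 [simp]: "subst a 1 = 1"
  using subst_cst[of 0] subst_cst[of 1] by simp_all

lemma subst_var [simp]: "subst a (var i) = emb (a i)"
proof -
  have "emb (a j) * subst a (ld j (var i)) = (if j = i then emb (a j) else 0)" for j
    by (simp add: ld_var)
  then show ?thesis by (subst subst_rec) simp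
qed

lemma subst_add: "subst a (F + G) = subst a F + subst a G"
proof (rule agree_eqI)
  fix n show "agree n (subst a (F + G)) (subst a F + subst a G)"
  proof (induction n arbitrary: F G)
    case (Suc n)
    have "cst (coef (F + G) []) + (\<Sum>i\<in>UNIV. emb (a i) * (subst a (ld i F) + subst a (ld i G))) =
        subst a F + subst a G"
      by (subst (3 4) subst_rec)
        (simp add: distrib_left sum.distrib, rule ser_eqI, simp add: cst_def)
    then show ?case using agree_subst_rec[of n "F + G" "\<lambda>i. subst a (ld i F) + subst a (ld i G)"] Suc by simp
  qed simp
qed

lemma subst_sum: "subst a (\<Sum>i\<in>I. F i) = (\<Sum>i\<in>I. subst a (F i))"
  by (induction I rule: infinite_finite_induct) (auto simp: subst_add)

lemma subst_diff: "subst a (F - G) = subst a F - subst a G"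
  using subst_add[of "F - G" G] by (simp add: algebra_simps)

lemma subst_mult: "subst a (F * G) = subst a F * subst a G"
proof (rule agree_eqI)
  \<comment> \<open>Left multiplication by a constant comes first, as \<open>ld_mult\<close>
    produces such a term; constants move past \<open>emb (a i)\<close>.\<close>
  have cst: "subst a (cst m * G) = cst m * subst a G" for m G
  proof (rule agree_eqI)
    fix n show "agree n (subst a (cst m * G)) (cst m * subst a G)"
    proof (induction n arbitrary: G)
      case (Suc n)
      have "cst (m * coef G []) + (\<Sum>i\<in>UNIV. emb (a i) * (cst m * subst a (ld i G))) = cst m * subst a G"
        by (subst (2) subst_rec)
          (simp add: distrib_left sum_distrib_left cst_mult_cst emb_cst_commute[symmetric] flip: mult.assoc)
      then show ?case
        using agree_subst_rec[of n "cst m * G" "\<lambda>i. cst m * subst a (ld i G)"] Suc by (simp add: ld_mult)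
    qed simp
  qed
  fix n show "agree n (subst a (F * G)) (subst a F * subst a G)"
  proof (induction n arbitrary: F G)
    case (Suc n)
    let ?H = "\<lambda>i. cst (coef F []) * subst a (ld i G) + subst a (ld i F) * subst a G"
    have "agree n (subst a (ld i (F * G))) (?H i)" for i
      by (simp add: ld_mult subst_add cst agree_add Suc)
    note agree_subst_rec[of n "F * G", OF this]
    moreover have "cst (coef (F * G) []) + (\<Sum>i\<in>UNIV. emb (a i) * ?H i) = subst a F * subst a G"
    proof -
      have "subst a F * subst a G = cst (coef F []) * subst a G +
          (\<Sum>i\<in>UNIV. emb (a i) * (subst a (ld i F) * subst a G))"
        by (subst subst_rec) (simp add: distrib_right sum_distrib_right mult.assoc)
      also have "cst (coef F []) * subst a G = cst (coef (F * G) []) +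
          (\<Sum>i\<in>UNIV. emb (a i) * (cst (coef F []) * subst a (ld i G)))"
        by (subst subst_rec)
          (simp add: distrib_left sum_distrib_left cst_mult_cst emb_cst_commute[symmetric] flip: mult.assoc)
      finally show ?thesis by (simp add: distrib_left sum.distrib add.assoc)
    qed
    ultimately show ?case by simp
  qed simp
qed


end

text \<open>Continuity in the substituted series. With it the system of
  \<open>subordination_exists\<close> is seen to be a contraction.\<close>

lemma agree_subst:
  fixes a b :: "'k::finite \<Rightarrow> ('j, complex) ser"
  assumes "\<And>i. agree n (a i) (b i)" "\<And>i. coef (a i) [] = 0" "\<And>i. coef (b i) [] = 0"
  shows "agree n (subst a F) (subst b F)"
proof -
  have "agree m (subst a F) (subst b F)" if "m \<le> n" for m
    using that
  proof (induction m arbitrary: F)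
    case (Suc m)
    then have "agree (Suc m) (emb (a i) * subst a (ld i F)) (emb (b i) * subst b (ld i F))" for i
      by (intro agree_mult_shift agree_emb agree_mono[OF assms(1)]) (auto simp: assms)
    then show ?case
      by (subst subst_rec[OF assms(2)], subst subst_rec[OF assms(3)]) (intro agree_add agree_sum agree_refl)
  qed simp
  then show ?thesis by simp
qed

end

text \<open>The complex numbers as an algebra over themselves: here \<open>emb\<close> is the
  identity, so \<open>C.subst\<close> is composition of scalar series.\<close>

interpretation C: complex_algebra "(*)"
  by standard (auto simp: algebra_simps)

lemma C_emb [simp]: "C.emb s = s"
  by (rule ser_eqI) simp

lemma subst_subst:
  fixes a :: "'k::finite \<Rightarrow> ('j::finite, complex) ser" and b :: "'j \<Rightarrow> ('l, complex) ser"
  assumes "\<And>i. coef (a i) [] = 0" "\<And>j. coef (b j) [] = 0"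
  shows "C.subst b (C.subst a F) = C.subst (\<lambda>i. C.subst b (a i)) F"
proof (rule agree_eqI)
  have 0: "coef (C.subst b (a i)) [] = 0" for i by (simp add: assms)
  fix n show "agree n (C.subst b (C.subst a F)) (C.subst (\<lambda>i. C.subst b (a i)) F)"
  proof (induction n arbitrary: F)
    case (Suc n)
    have "C.subst b (C.subst a F) =
        cst (coef F []) + (\<Sum>i\<in>UNIV. C.subst b (a i) * C.subst b (C.subst a (ld i F)))"
      by (subst C.subst_rec[OF assms(1)])
        (simp add: C.subst_add C.subst_sum C.subst_mult C.subst_cst assms(2))
    moreover have "C.subst (\<lambda>i. C.subst b (a i)) F =
        cst (coef F []) + (\<Sum>i\<in>UNIV. C.subst b (a i) * C.subst (\<lambda>i. C.subst b (a i)) (ld i F))"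
      by (subst C.subst_rec[OF 0]) simp
    ultimately show ?case
      using Suc by (auto simp: assms intro!: agree_add agree_sum agree_mult_shift)
  qed simp
qed

sublocale nc_prob_space \<subseteq> complex_algebra scale
  by standard (auto simp: mult_scale_left mult_scale_right)

section \<open>Applying a functional to the coefficients of a series\<close>

definition mapc :: "('a \<Rightarrow> 'b) \<Rightarrow> ('k, 'a) ser \<Rightarrow> ('k, 'b) ser"
  where "mapc \<phi> F = Ser (\<lambda>w. \<phi> (coef F w))"

lemma coef_mapc [simp]: "coef (mapc \<phi> F) w = \<phi> (coef F w)"
  by (simp add: mapc_def)

context nc_prob_space
begin

lemma mapc_add: "mapc \<phi> (F + G) = mapc \<phi> F + mapc \<phi> G"
  and mapc_diff: "mapc \<phi> (F - G) = mapc \<phi> F - mapc \<phi> G"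
  and mapc_emb [simp]: "mapc \<phi> (emb s) = s"
  and mapc_cst [simp]: "mapc \<phi> (cst m) = cst (\<phi> m)"
  by (auto intro!: ser_eqI simp: add diff scale phi_one cst_def)

lemma mapc_sum: "mapc \<phi> (\<Sum>i\<in>I. F i) = (\<Sum>i\<in>I. mapc \<phi> (F i))"
  by (rule ser_eqI) (simp add: sum)

text \<open>The coefficients of \<open>emb s\<close> are scalars, so coefficientwise \<phi> is
  linear over scalar series on both sides, like a conditional expectation.\<close>

lemma mapc_emb_mult: "mapc \<phi> (emb s * F) = s * mapc \<phi> F"
  and mapc_mult_emb: "mapc \<phi> (F * emb s) = mapc \<phi> F * s"
  by (auto intro!: ser_eqI simp: coef_mult sum mult_scale_left mult_scale_right scale mult.commute)

lemma ld_mapc: "ld i (mapc \<phi> F) = mapc \<phi> (ld i F)" and rd_mapc: "rd i (mapc \<phi> F) = mapc \<phi> (rd i F)"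
  by (auto intro!: ser_eqI)

text \<open>Both sides obey the same recursion, because the factors \<open>emb (a i)\<close> come
  out of \<phi>.\<close>

lemma mapc_subst:
  assumes "\<And>i. coef (a i) [] = 0"
  shows "mapc \<phi> (subst a F) = C.subst a (mapc \<phi> F)"
proof (rule agree_eqI)
  fix n show "agree n (mapc \<phi> (subst a F)) (C.subst a (mapc \<phi> F))"
  proof (induction n arbitrary: F)
    case (Suc n)
    have "mapc \<phi> (subst a F) = cst (coef (mapc \<phi> F) []) + (\<Sum>i\<in>UNIV. a i * mapc \<phi> (subst a (ld i F)))"
      by (subst subst_rec[OF assms]) (simp add: mapc_add mapc_sum mapc_emb_mult)
    moreover have "C.subst a (mapc \<phi> F) =
        cst (coef (mapc \<phi> F) []) + (\<Sum>i\<in>UNIV. a i * C.subst a (mapc \<phi> (ld i F)))"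
      by (subst C.subst_rec[OF assms]) (simp add: ld_mapc)
    ultimately show ?case
      using Suc by (auto simp: assms intro!: agree_add agree_sum agree_mult_shift)
  qed simp
qed

end

section \<open>Moment series and eta-series\<close>

definition mom :: "('k ncpoly \<Rightarrow> complex) \<Rightarrow> ('k, complex) ser"
  where "mom \<mu> = Ser (moment_series \<mu>)"

definition eta :: "('k ncpoly \<Rightarrow> complex) \<Rightarrow> ('k, complex) ser"
  where "eta \<mu> = Ser (eta_series \<mu>)"

lemma coef_mom_Nil [simp]: "coef (mom \<mu>) [] = 0"
  by (simp add: mom_def moment_series_def)

lemma coef_eta_Nil [simp]: "coef (eta \<mu>) [] = 0"
  by (simp add: eta_def eta_series_def ncs_mult_Nil moment_series_def)

lemma Ser_ncs_mult: "Ser (ncs_mult f g) = Ser f * Ser g"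
  by (rule ser_eqI) (simp add: ncs_mult_def coef_mult)

lemma Ser_one_plus_moment_series: "Ser (ncs_add ncs_one (moment_series \<mu>)) = 1 + mom \<mu>"
  by (rule ser_eqI) (simp add: ncs_add_def ncs_one_def mom_def coef_1)

lemma eta_mult_moment: "eta \<mu> * (1 + mom \<mu>) = mom \<mu>"
proof -
  have "ncs_mult (eta_series \<mu>) (ncs_add ncs_one (moment_series \<mu>)) = moment_series \<mu>"
    using eta_series_eq_iff by blast
  then have "Ser (eta_series \<mu>) * Ser (ncs_add ncs_one (moment_series \<mu>)) = Ser (moment_series \<mu>)"
    by (simp flip: Ser_ncs_mult)
  then show ?thesis unfolding Ser_one_plus_moment_series by (simp add: eta_def mom_def)
qed

lemma left_inverse_eq_star:
  assumes "coef F [] = 0" "(1 - F) * G = 1" shows "G = star F"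
  by (metis assms mult.assoc mult_1_left mult_1_right star_right)

lemma right_inverse_eq_star:
  assumes "coef F [] = 0" "G * (1 - F) = 1" shows "G = star F"
  by (metis assms mult.assoc mult_1_left mult_1_right star_left)

lemma star_rec: assumes "coef F [] = 0" shows "star F = 1 + F * star F"
  using star_left[OF assms] by (simp add: left_diff_distrib algebra_simps)

lemma star_rec_right: assumes "coef F [] = 0" shows "star F = 1 + star F * F"
  using star_right[OF assms] by (simp add: right_diff_distrib algebra_simps)

text \<open>The relation \<eta>(1 + M) = M reads (1 - \<eta>)(1 + M) = 1.\<close>

lemma one_plus_mom: "1 + mom \<mu> = star (eta \<mu>)"
  using eta_mult_moment[of \<mu>]
  by (intro left_inverse_eq_star) (simp_all add: left_diff_distrib)

lemma eta_eqI:
  assumes "coef h [] = 0" "1 + mom \<mu> = star h" shows "eta \<mu> = h"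
proof -
  have "(1 - h) * star h = (1 - eta \<mu>) * star h"
    using star_left[of h] star_left[of "eta \<mu>"] assms one_plus_mom[of \<mu>] by simp
  then have "(1 - h) * (star h * (1 - h)) = (1 - eta \<mu>) * (star h * (1 - h))"
    by (simp flip: mult.assoc)
  then show ?thesis using assms by (simp add: star_right)
qed

lemma subst_star:
  assumes "\<And>i. coef (a i) [] = 0" "coef f [] = 0"
  shows "C.subst a (star f) = star (C.subst a f)"
proof (rule left_inverse_eq_star)
  have "C.subst a ((1 - f) * star f) = 1" using assms by (simp only: star_left C.subst_1)
  then show "(1 - C.subst a f) * C.subst a (star f) = 1"
    by (simp add: C.subst_mult C.subst_diff assms(1) C.subst_1)
qed (use assms in simp)

lemma rd_star:
  fixes f :: "('k::finite, 'a::ring_1) ser"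
  assumes "coef f [] = 0" shows "rd j (star f) = star f * rd j f"
proof -
  have "rd j (star f) = rd j (1 + star f * f)" by (subst star_rec_right[OF assms]) (rule refl)
  also have "\<dots> = rd j (star f * f)" by (rule ser_eqI) (simp add: coef_1)
  finally show ?thesis by (simp add: rd_mult assms)
qed

lemma ld_star:
  assumes "coef f [] = 0" shows "ld j (star f) = ld j f * star f"
  by (subst star_rec[OF assms]) (simp add: ld_mult assms)

text \<open>The generating series of all words in the \<open>x i\<close>. For finitely many
  indeterminates it is the resolvent (1 - \<Sum> x_i z_i)^(-1), by
  \<open>gen_eq_star\<close>.\<close>

definition gen :: "('k \<Rightarrow> 'm::ring_1) \<Rightarrow> ('k, 'm) ser"
  where "gen x = Ser (word_prod x)"

lemma coef_gen [simp]: "coef (gen x) w = word_prod x w"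
  by (simp add: gen_def)

lemma ld_gen: "ld i (gen x) = cst (x i) * gen x" and rd_gen: "rd i (gen x) = gen x * cst (x i)"
  by (auto intro!: ser_eqI simp: word_prod_append)

lemma gen_eq_star: "gen x = star (\<Sum>i\<in>UNIV. cst (x i) * var i)"
  for x :: "'k::finite \<Rightarrow> 'm::ring_1"
proof (rule right_inverse_eq_star)
  have "gen x = 1 + gen x * (\<Sum>i\<in>UNIV. cst (x i) * var i)"
    by (subst right_decomposition) (simp add: rd_gen sum_distrib_left mult.assoc)
  then have "gen x - gen x * (\<Sum>i\<in>UNIV. cst (x i) * var i) = 1"
    by (metis add_diff_cancel_right')
  then show "gen x * (1 - (\<Sum>i\<in>UNIV. cst (x i) * var i)) = 1"
    by (simp only: right_diff_distrib mult_1_right)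
qed simp

lemma (in nc_prob_space) mapc_gen:
  assumes "has_joint_distribution \<phi> x \<mu>" shows "mapc \<phi> (gen x) = star (eta \<mu>)"
proof -
  have "mapc \<phi> (gen x) = 1 + mom \<mu>"
    using assms by (intro ser_eqI)
      (auto simp: mom_def moment_series_def has_joint_distribution_def coef_1 phi_one)
  then show ?thesis by (simp add: one_plus_mom)
qed

section \<open>Alternating centred products\<close>

locale free_pair = nc_prob_space scale \<phi>
  for scale :: "complex \<Rightarrow> 'm::ring_1 \<Rightarrow> 'm" and \<phi> :: "'m \<Rightarrow> complex" +
  fixes S T :: "'m set"
  assumes free: "freely_independent scale \<phi> S T"
begin

definition alg :: "bool \<Rightarrow> 'm set"
  where "alg r = unital_subalgebra scale hull (if r then S else T)"

definition centred :: "bool \<Rightarrow> 'm set"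
  where "centred r = {a \<in> alg r. \<phi> a = 0}"

definition alternating :: "(bool \<times> 'm) list \<Rightarrow> bool"
  where "alternating as \<longleftrightarrow> (\<forall>(r, a)\<in>set as. a \<in> centred r) \<and>
    (\<forall>j. Suc j < length as \<longrightarrow> fst (as ! j) \<noteq> fst (as ! Suc j))"

text \<open>It contains the nonempty alternating products of centred elements that begin with a
  factor of type \<open>r\<close>. Described by annihilation, it is closed under linear combinations
  at once, without normal forms.\<close>

definition null_after :: "bool \<Rightarrow> 'm set"
  where "null_after r = {b. \<forall>as. alternating as \<and> (as \<noteq> [] \<longrightarrow> fst (last as) \<noteq> r) \<longrightarrow>
    \<phi> (prod_list (map snd as) * b) = 0}"

lemma unital_subalgebra_alg: "unital_subalgebra scale (alg r)"
  by (simp add: alg_def unital_subalgebra_hull)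

lemma alternating_snoc:
  assumes "alternating as" "as \<noteq> [] \<longrightarrow> fst (last as) \<noteq> r" "a \<in> centred r"
  shows "alternating (as @ [(r, a)])"
proof -
  have "fst ((as @ [(r, a)]) ! j) \<noteq> fst ((as @ [(r, a)]) ! Suc j)" if "Suc j < length (as @ [(r, a)])" for j
  proof (cases "Suc j < length as")
    case True
    then show ?thesis using assms(1) by (simp add: alternating_def nth_append)
  next
    case False
    then have "j = length as - 1" "as \<noteq> []" "Suc j = length as" using that by auto
    then show ?thesis using assms(2) by (simp add: nth_append last_conv_nth)
  qed
  then show ?thesis using assms(1,3) by (simp add: alternating_def)
qed

text \<open>The factor \<open>a\<close> is moved to the end of the alternating list, which then has
  last type \<open>r\<close>, as \<open>null_after (\<not> r)\<close> demands.\<close>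

lemma null_after_mult:
  assumes "a \<in> centred r" "b \<in> null_after (\<not> r)" shows "a * b \<in> null_after r"
  unfolding null_after_def
proof (intro CollectI allI impI)
  fix as assume "alternating as \<and> (as \<noteq> [] \<longrightarrow> fst (last as) \<noteq> r)"
  then have "alternating (as @ [(r, a)])" using assms(1) by (intro alternating_snoc) auto
  then have "\<phi> (prod_list (map snd (as @ [(r, a)])) * b) = 0"
    using assms(2) unfolding null_after_def by (auto simp del: map_append)
  then show "\<phi> (prod_list (map snd as) * (a * b)) = 0" by (simp add: mult.assoc)
qed

lemma centred_null_after:
  assumes "a \<in> centred r" shows "a \<in> null_after r"
  unfolding null_after_def
proof (intro CollectI allI impI)
  fix as assume "alternating as \<and> (as \<noteq> [] \<longrightarrow> fst (last as) \<noteq> r)"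
  then have "alternating (as @ [(r, a)])" using assms by (intro alternating_snoc) auto
  then have "\<phi> (prod_list (map snd (as @ [(r, a)]))) = 0"
    by (intro free[unfolded freely_independent_def, rule_format])
      (auto simp: alternating_def centred_def alg_def)
  then show "\<phi> (prod_list (map snd as) * a) = 0" by simp
qed

lemma null_after_phi: assumes "b \<in> null_after r" shows "\<phi> b = 0"
proof -
  have "\<phi> (prod_list (map snd []) * b) = 0"
    using assms unfolding null_after_def mem_Collect_eq
    by (rule allE[of _ "[]"]) (simp add: alternating_def)
  then show ?thesis by simp
qed

lemma null_after_0: "0 \<in> null_after r"
  and null_after_add: "a \<in> null_after r \<Longrightarrow> b \<in> null_after r \<Longrightarrow> a + b \<in> null_after r"
  and null_after_scale: "a \<in> null_after r \<Longrightarrow> scale c a \<in> null_after r"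
  by (auto simp: null_after_def distrib_left add mult_scale_right scale)

lemma null_after_sum: "(\<And>i. i \<in> I \<Longrightarrow> f i \<in> null_after r) \<Longrightarrow> (\<Sum>i\<in>I. f i) \<in> null_after r"
  by (induction I rule: infinite_finite_induct) (auto intro: null_after_0 null_after_add)

section \<open>Series with coefficients in a prescribed set\<close>

definition ser_over :: "'m set \<Rightarrow> ('k, 'm) ser set"
  where "ser_over B = {F. \<forall>w. coef F w \<in> B}"

lemma ser_over_null_after_mult:
  "F \<in> ser_over (centred r) \<Longrightarrow> G \<in> ser_over (null_after (\<not> r)) \<Longrightarrow> F * G \<in> ser_over (null_after r)"
  by (auto simp: ser_over_def coef_mult intro!: null_after_sum null_after_mult)

lemma ser_over_centred: "F \<in> ser_over (centred r) \<Longrightarrow> F \<in> ser_over (null_after r)"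
  by (auto simp: ser_over_def intro: centred_null_after)

lemma ser_over_null_after_emb: "F \<in> ser_over (null_after r) \<Longrightarrow> emb s * F \<in> ser_over (null_after r)"
  by (auto simp: ser_over_def coef_mult mult_scale_left intro!: null_after_sum null_after_scale)

lemma ser_over_null_after_add:
  "F \<in> ser_over (null_after r) \<Longrightarrow> G \<in> ser_over (null_after r) \<Longrightarrow> F + G \<in> ser_over (null_after r)"
  by (auto simp: ser_over_def intro!: null_after_add)

lemma ser_over_null_after_sum:
  "(\<And>i. i \<in> I \<Longrightarrow> F i \<in> ser_over (null_after r)) \<Longrightarrow> (\<Sum>i\<in>I. F i) \<in> ser_over (null_after r)"
  by (auto simp: ser_over_def intro!: null_after_sum)

lemma mapc_null_after: "F \<in> ser_over (null_after r) \<Longrightarrow> mapc \<phi> F = 0"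
  by (rule ser_eqI) (auto simp: ser_over_def intro: null_after_phi)

lemma alg_sum: "(\<And>i. i \<in> I \<Longrightarrow> f i \<in> alg r) \<Longrightarrow> (\<Sum>i\<in>I. f i) \<in> alg r"
proof (induction I rule: infinite_finite_induct)
  have "scale 0 1 \<in> alg r" using unital_subalgebra_alg[of r] unfolding unital_subalgebra_def by blast
  then show "sum f {} \<in> alg r" "infinite A \<Longrightarrow> sum f A \<in> alg r" for A by simp_all
qed (use unital_subalgebra_alg[of r] in \<open>auto simp: unital_subalgebra_def\<close>)

lemma
  shows ser_over_alg_mult: "F \<in> ser_over (alg r) \<Longrightarrow> G \<in> ser_over (alg r) \<Longrightarrow> F * G \<in> ser_over (alg r)"
    and ser_over_alg_diff: "F \<in> ser_over (alg r) \<Longrightarrow> G \<in> ser_over (alg r) \<Longrightarrow> F - G \<in> ser_over (alg r)"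
    and ser_over_alg_emb: "emb s \<in> ser_over (alg r)"
    and ser_over_alg_cst: "a \<in> alg r \<Longrightarrow> cst a \<in> ser_over (alg r)"
    and ser_over_alg_gen: "(\<And>i. z i \<in> alg r) \<Longrightarrow> gen z \<in> ser_over (alg r)"
proof -
  have sub: "1 \<in> alg r" "\<And>a b. a \<in> alg r \<Longrightarrow> b \<in> alg r \<Longrightarrow> a + b \<in> alg r"
    "\<And>a b. a \<in> alg r \<Longrightarrow> b \<in> alg r \<Longrightarrow> a * b \<in> alg r" "\<And>c a. a \<in> alg r \<Longrightarrow> scale c a \<in> alg r"
    using unital_subalgebra_alg[of r] unfolding unital_subalgebra_def by blast+
  have diff: "a - b \<in> alg r" if "a \<in> alg r" "b \<in> alg r" for a b
    using sub(2)[OF that(1) sub(4)[OF that(2), of "-1"]] by simp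
  show "F \<in> ser_over (alg r) \<Longrightarrow> G \<in> ser_over (alg r) \<Longrightarrow> F * G \<in> ser_over (alg r)"
    by (auto simp: ser_over_def coef_mult intro!: alg_sum sub)
  show "F \<in> ser_over (alg r) \<Longrightarrow> G \<in> ser_over (alg r) \<Longrightarrow> F - G \<in> ser_over (alg r)"
    by (auto simp: ser_over_def intro!: diff)
  show "emb s \<in> ser_over (alg r)" by (auto simp: ser_over_def intro!: sub)
  show "a \<in> alg r \<Longrightarrow> cst a \<in> ser_over (alg r)"
    using sub(4)[OF sub(1), of 0] by (auto simp: ser_over_def cst_def)
  assume z: "\<And>i. z i \<in> alg r"
  have "word_prod z w \<in> alg r" for w by (induction w) (use z sub in auto)
  then show "gen z \<in> ser_over (alg r)" by (auto simp: ser_over_def)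
qed

lemma ld_emb: "ld i (emb s) = emb (ld i s)" by (rule ser_eqI) simp

text \<open>Each coefficient of \<open>subst a F\<close> is a finite scalar combination of
  coefficients of \<open>F\<close>; the recursion shows this by induction on the length of the
  word.\<close>

lemma ser_over_alg_subst:
  assumes a: "\<And>i. coef (a i) [] = 0" and F: "F \<in> ser_over (alg r)"
  shows "subst a F \<in> ser_over (alg r)"
proof -
  have sc: "\<And>c a. a \<in> alg r \<Longrightarrow> scale c a \<in> alg r"
    using unital_subalgebra_alg[of r] unfolding unital_subalgebra_def by blast
  have "\<forall>w. length w < n \<longrightarrow> coef (subst a F) w \<in> alg r" if "F \<in> ser_over (alg r)" for n F
    using that
  proof (induction n arbitrary: F)
    case (Suc n)
    have IH: "length w < n \<Longrightarrow> coef (subst a (ld i F)) w \<in> alg r" for i w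
      using Suc.IH[of "ld i F"] Suc.prems by (auto simp: ser_over_def)
    show ?case
    proof (intro allI impI)
      fix w :: "'b list" assume w: "length w < Suc n"
      show "coef (subst a F) w \<in> alg r"
      proof (cases w)
        case Nil
        then show ?thesis using Suc.prems a by (auto simp: ser_over_def)
      next
        case (Cons j u)
        have "coef (subst a F) w = coef (ld j (\<Sum>i\<in>UNIV. emb (a i) * subst a (ld i F))) u"
          by (subst subst_rec[OF a]) (simp add: Cons)
        also have "\<dots> = (\<Sum>i\<in>UNIV. coef (emb (ld j (a i)) * subst a (ld i F)) u)"
          by (simp add: ld_mult a ld_emb del: coef_ld)
        also have "\<dots> \<in> alg r"
          using w Cons by (auto simp: coef_mult mult_scale_left intro!: alg_sum sc IH)
        finally show ?thesis .
      qed
    qed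
  qed simp
  with F show ?thesis by (auto simp: ser_over_def)
qed

lemma ser_over_centredI: "F \<in> ser_over (alg r) \<Longrightarrow> mapc \<phi> F = 0 \<Longrightarrow> F \<in> ser_over (centred r)"
  by (auto simp: ser_over_def centred_def) (metis coef_0 coef_mapc)

text \<open>At a given word only finitely many powers of \<open>W\<close> contribute, and each power
  preserves series over \<open>null_after r\<close>.\<close>

lemma star_null_after:
  assumes W: "coef W [] = 0" "\<And>G. G \<in> ser_over (null_after r) \<Longrightarrow> W * G \<in> ser_over (null_after r)"
    and R: "R \<in> ser_over (null_after r)"
  shows "star W * R \<in> ser_over (null_after r)"
proof -
  have pow: "W ^ m * R \<in> ser_over (null_after r)" for m
    by (induction m) (auto simp: R mult.assoc W(2))
  have "coef (star W * R) w \<in> null_after r" for w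
  proof -
    let ?n = "Suc (length w)"
    have "agree ?n (star W * R) ((\<Sum>m<?n. W ^ m) * R)"
      by (intro agree_mult star_agree W(1) agree_refl)
    then have "coef (star W * R) w = coef ((\<Sum>m<?n. W ^ m) * R) w" by (simp add: agree_def)
    then have "coef (star W * R) w = coef (\<Sum>m<?n. W ^ m * R) w" by (simp only: sum_distrib_right)
    moreover have "(\<Sum>m<?n. W ^ m * R) \<in> ser_over (null_after r)"
      by (rule ser_over_null_after_sum) (rule pow)
    ultimately show ?thesis by (simp add: ser_over_def)
  qed
  then show ?thesis by (simp add: ser_over_def)
qed

end

section \<open>The eta-series of the product of two free families\<close>

theorem (in nc_prob_space) eta_product:
  fixes x y :: "'k::finite \<Rightarrow> 'm"
  assumes free: "freely_independent scale \<phi> (range x) (range y)"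
    and dist: "has_joint_distribution \<phi> x \<mu>" "has_joint_distribution \<phi> y \<nu>"
      "has_joint_distribution \<phi> (\<lambda>i. x i * y i) \<rho>"
    and A: "\<And>j. A j = var j * C.subst A' (ld j (eta \<nu>))"
    and A': "\<And>j. A' j = C.subst A (rd j (eta \<mu>)) * var j"
  shows "eta \<rho> = C.subst A (eta \<mu>)" "C.subst A' (eta \<nu>) = C.subst A (eta \<mu>)"
proof -
  interpret free_pair scale \<phi> "range x" "range y" by standard (rule free)
  define f where "f = eta \<mu>"
  define g where "g = eta \<nu>"
  define h where "h = C.subst A f"
  define H where "H = star h"
  define c where "c j = C.subst A' (ld j g)" for j
  define d where "d j = C.subst A (rd j f)" for j
  have A_eq: "A j = var j * c j" and A'_eq: "A' j = d j * var j" for j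
    by (subst A A', simp add: c_def d_def f_def g_def)+
  have A0: "coef (A j) [] = 0" and A'0: "coef (A' j) [] = 0" for j
    by (simp_all add: A_eq A'_eq)
  have f0: "coef f [] = 0" and g0: "coef g [] = 0" by (simp_all add: f_def g_def)
  have h0: "coef h [] = 0" by (simp add: h_def A0 f0)
  \<comment> \<open>Splitting off last letters of \<open>f\<close> and first letters of
    \<open>g\<close> turns both substituted series into \<Sum> d_j z_j c_j.\<close>
  have h_A: "h = (\<Sum>j\<in>UNIV. d j * A j)"
    unfolding h_def d_def
    by (subst right_decomposition[of f]) (simp add: f0 C.subst_sum C.subst_mult C.subst_var A0)
  have h_A': "C.subst A' g = (\<Sum>j\<in>UNIV. A' j * c j)"
    unfolding c_def
    by (subst left_decomposition[of g]) (simp add: g0 C.subst_sum C.subst_mult C.subst_var A'0)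
  have h_g: "C.subst A' g = h" unfolding h_A h_A' by (simp add: A_eq A'_eq mult.assoc)
  then show "C.subst A' (eta \<nu>) = C.subst A (eta \<mu>)" by (simp add: h_def f_def g_def)
  have H: "(1 - h) * H = 1" "H * (1 - h) = 1" by (simp_all add: H_def star_left star_right h0)

  \<comment> \<open>The resolvents of the x and of the y, evaluated at \<open>A\<close> and
    \<open>A'\<close>. Since f(A) = g(A') = h, both have mean \<open>H\<close>.\<close>
  define p where "p = subst A (gen x)"
  define q where "q = subst A' (gen y)"
  define P where "P = (\<Sum>j\<in>UNIV. emb (A j) * cst (x j))"
  define Q where "Q = (\<Sum>j\<in>UNIV. emb (A' j) * cst (y j))"
  have subst_gen: "subst a (gen z) = star (\<Sum>j\<in>UNIV. emb (a j) * cst (z j))"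
    if a: "\<And>j. coef (a j) [] = 0" for a :: "'k \<Rightarrow> ('k, complex) ser" and z :: "'k \<Rightarrow> 'm"
  proof (rule left_inverse_eq_star)
    let ?Z = "\<Sum>i\<in>UNIV. cst (z i) * var i"
    have "subst a ((1 - ?Z) * gen z) = 1"
      unfolding gen_eq_star by (subst star_left) (simp_all add: a)
    then show "(1 - (\<Sum>j\<in>UNIV. emb (a j) * cst (z j))) * subst a (gen z) = 1"
      by (simp add: subst_mult subst_diff subst_sum emb_cst_commute a)
  qed (simp add: a)
  have P: "(1 - P) * p = 1" "p * (1 - P) = 1"
    unfolding p_def P_def subst_gen[OF A0] by (rule star_left star_right, simp add: A0)+
  have Q: "(1 - Q) * q = 1" "q * (1 - Q) = 1"
    unfolding q_def Q_def subst_gen[OF A'0] by (rule star_left star_right, simp add: A'0)+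
  have phi_p: "mapc \<phi> p = H"
    by (simp add: p_def mapc_subst[OF A0] mapc_gen[OF dist(1)] subst_star[OF A0] f0 H_def h_def flip: f_def)
  have phi_q: "mapc \<phi> q = H"
    by (simp add: q_def mapc_subst[OF A'0] mapc_gen[OF dist(2)] subst_star[OF A'0] g0 H_def h_g flip: g_def)
  \<comment> \<open>Right multiplication of \<open>gen x\<close> by \<open>x j\<close> is removal of
    a last letter, so \<open>rd_star\<close> gives the mean; \<open>phi_yq\<close> mirrors this with
    first letters.\<close>
  have phi_px: "mapc \<phi> (p * cst (x j)) = H * d j" for j
  proof -
    have "p * cst (x j) = subst A (rd j (gen x))" by (simp add: p_def rd_gen subst_mult A0)
    then show ?thesis
      by (simp add: mapc_subst[OF A0] mapc_gen[OF dist(1)] rd_star f0 C.subst_mult A0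
          subst_star H_def h_def d_def flip: f_def rd_mapc)
  qed
  have phi_yq: "mapc \<phi> (cst (y j) * q) = c j * H" for j
  proof -
    have "cst (y j) * q = subst A' (ld j (gen y))" by (simp add: q_def ld_gen subst_mult A'0)
    then show ?thesis
      by (simp add: mapc_subst[OF A'0] mapc_gen[OF dist(2)] ld_star g0 C.subst_mult A'0
          subst_star H_def h_g c_def flip: g_def ld_mapc)
  qed

  \<comment> \<open>\<open>u j\<close> is p (x_j z_j - A'_j); its mean H d_j z_j - H A'_j vanishes
    by the equation for \<open>A'\<close>. \<open>t j\<close> is y_j q minus its mean.\<close>
  define u where "u j = p * cst (x j) * var j - p * emb (A' j)" for j
  define t where "t j = cst (y j) * q - emb (c j * H)" for j
  define U where "U = (\<Sum>j\<in>UNIV. u j * t j)"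
  \<comment> \<open>Normalised so that H - U = H (1 - W).\<close>
  define W where "W = emb (1 - h) * U"
  have x_alg: "x j \<in> alg True" and y_alg: "y j \<in> alg False" for j
    by (auto simp: alg_def intro!: hull_inc)
  have p_alg: "p \<in> ser_over (alg True)" and q_alg: "q \<in> ser_over (alg False)"
    unfolding p_def q_def by (intro ser_over_alg_subst A0 A'0 ser_over_alg_gen x_alg y_alg)+
  have u: "u j \<in> ser_over (centred True)" for j
  proof (rule ser_over_centredI)
    have "var j = (emb (var j) :: ('k, 'm) ser)" by simp
    then show "u j \<in> ser_over (alg True)"
      unfolding u_def by (metis ser_over_alg_mult ser_over_alg_diff ser_over_alg_emb ser_over_alg_cst x_alg p_alg)
    show "mapc \<phi> (u j) = 0"
      using mapc_mult_emb[of "p * cst (x j)" "var j"]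
      by (simp add: u_def mapc_diff mapc_mult_emb phi_px phi_p A'_eq mult.assoc)
  qed
  have t: "t j \<in> ser_over (centred False)" for j
  proof (rule ser_over_centredI)
    show "t j \<in> ser_over (alg False)"
      unfolding t_def by (intro ser_over_alg_mult ser_over_alg_diff ser_over_alg_emb ser_over_alg_cst y_alg q_alg)
    show "mapc \<phi> (t j) = 0" by (simp add: t_def mapc_diff phi_yq)
  qed
  have p_centred: "p - emb H \<in> ser_over (centred True)" and q_centred: "q - emb H \<in> ser_over (centred False)"
    by (auto intro!: ser_over_centredI ser_over_alg_diff p_alg q_alg ser_over_alg_emb simp: mapc_diff phi_p phi_q)

  define Z :: "('k, 'm) ser" where "Z = (\<Sum>j\<in>UNIV. cst (x j * y j) * var j)"
  \<comment> \<open>(1 - P) U is the sum over j of (x_j z_j - A'_j)(y_j q - c_j H). Up to sign its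
    four products add up to Z q, Q q, P H and h H, the third because A_j = z_j c_j.\<close>
  have factor: "(1 - Z) * q = (1 - P) * (emb H - U)"
  proof -
    have u': "(1 - P) * u j = cst (x j) * var j - emb (A' j)" for j
      by (simp add: u_def right_diff_distrib mult.assoc[symmetric] P)
    have "(1 - P) * U = (\<Sum>j\<in>UNIV. (cst (x j) * var j - emb (A' j)) * t j)"
      unfolding U_def sum_distrib_left by (simp add: mult.assoc[symmetric] u')
    also have "\<dots> = (\<Sum>j\<in>UNIV. cst (x j * y j) * var j * q) - (\<Sum>j\<in>UNIV. emb (A' j) * cst (y j) * q)
        - (\<Sum>j\<in>UNIV. emb (A j) * cst (x j) * emb H) + (\<Sum>j\<in>UNIV. emb (A' j * c j * H))"
    proof -
      have 1: "cst (x j) * var j * (cst (y j) * q) = cst (x j * y j) * var j * q" for j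
        by (metis cst_mult_cst mult.assoc var_commute)
      have 2: "cst (x j) * var j * emb (c j * H) = emb (A j) * cst (x j) * emb H" for j
        unfolding A_eq by (metis emb_cst_commute emb_mult emb_var mult.assoc)
      have "(cst (x j) * var j - emb (A' j)) * t j = cst (x j * y j) * var j * q - emb (A' j) * cst (y j) * q
          - emb (A j) * cst (x j) * emb H + emb (A' j * c j * H)" for j
        unfolding t_def right_diff_distrib left_diff_distrib 1 2
        by (simp add: emb_mult mult.assoc)
      then show ?thesis by (simp add: sum.distrib sum_subtractf)
    qed
    also have "\<dots> = Z * q - Q * q - P * emb H + emb (h * H)"
      unfolding Z_def Q_def P_def h_g[symmetric] h_A' by (simp add: sum_distrib_right emb_sum)
    also have "Q * q = q - 1" using Q(1) by (simp add: left_diff_distrib algebra_simps)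
    also have "h * H = H - 1" using H(1) by (simp add: left_diff_distrib algebra_simps)
    finally have "(1 - P) * U = Z * q - (q - 1) - P * emb H + emb (H - 1)" .
    then show ?thesis by (simp add: right_diff_distrib left_diff_distrib emb_diff)
  qed
  have U0: "coef U [] = 0" by (simp add: U_def u_def A'0)
  have W0: "coef W [] = 0" by (simp add: W_def U0)
  have Z0: "coef Z [] = 0" by (simp add: Z_def)
  \<comment> \<open>Chosen so that (1 - h) p = (1 - W) + R, whose first part cancels
    \<open>star W\<close>. Up to scalar series, every term of \<open>R\<close> begins with a centred
    series in the x.\<close>
  define R where "R = emb (1 - h) * (p - emb H) + W"
  have HH: "emb H * emb (1 - h) = 1" "emb (1 - h) * emb H = 1"
    by (simp_all add: H flip: emb_mult)
  have HW: "emb H - U = emb H * (1 - W)"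
    by (simp add: W_def right_diff_distrib HH flip: mult.assoc)
  have star_Z: "star Z = q * star W * emb (1 - h) * p"
  proof -
    have "(1 - Z) * (q * star W * emb (1 - h) * p) = (1 - P) * (emb H * ((1 - W) * star W) * emb (1 - h)) * p"
      using factor unfolding HW by (simp flip: mult.assoc)
    also have "\<dots> = 1" by (simp add: star_left W0 HH P)
    finally have "(1 - Z) * (q * star W * emb (1 - h) * p) = 1" .
    then show ?thesis by (rule left_inverse_eq_star[OF Z0, symmetric])
  qed
  have star_W: "star W * (emb (1 - h) * p) = 1 + star W * R"
  proof -
    have "emb (1 - h) * p = (1 - W) + R" by (simp add: R_def right_diff_distrib HH)
    then show ?thesis by (simp only: distrib_left star_right[OF W0])
  qed
  have UG: "U * G \<in> ser_over (null_after True)" if "G \<in> ser_over (null_after True)" for G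
    unfolding U_def sum_distrib_right mult.assoc
    by (rule ser_over_null_after_sum, rule ser_over_null_after_mult[OF u])
      (use ser_over_null_after_mult[OF t, of G] that in simp)
  have U: "U \<in> ser_over (null_after True)"
    unfolding U_def by (intro ser_over_null_after_sum ser_over_null_after_mult u) (simp add: ser_over_centred t)
  have "R \<in> ser_over (null_after True)"
    unfolding R_def W_def
    by (intro ser_over_null_after_add ser_over_null_after_emb ser_over_centred p_centred U)
  then have D: "star W * R \<in> ser_over (null_after True)"
    by (intro star_null_after W0) (simp_all add: W_def mult.assoc ser_over_null_after_emb UG)
  \<comment> \<open>Every term except the first \<open>emb H\<close> has mean zero:
    \<open>q - emb H\<close> is centred in the y, and \<open>star W * R\<close> behaves like
    alternating products that begin in the x.\<close>
  have "star Z = emb H + (q - emb H) + (q - emb H) * (star W * R) + emb H * (star W * R)"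
    unfolding star_Z mult.assoc star_W by (simp add: algebra_simps)
  moreover have "(q - emb H) * (star W * R) \<in> ser_over (null_after False)"
    by (rule ser_over_null_after_mult[OF q_centred]) (simp add: D)
  ultimately have "mapc \<phi> (star Z) = H"
    by (simp add: mapc_add mapc_emb_mult mapc_null_after[OF D] mapc_null_after mapc_diff phi_q)
  moreover have "mapc \<phi> (star Z) = 1 + mom \<rho>"
    using mapc_gen[OF dist(3)] by (simp add: one_plus_mom Z_def gen_eq_star)
  ultimately have "1 + mom \<rho> = star h" by (simp add: H_def)
  then show "eta \<rho> = C.subst A (eta \<mu>)"
    using eta_eqI[OF h0] by (simp add: h_def f_def)
qed

section \<open>Non-crossing partitions of intervals\<close>

text \<open>Both endpoints are free, because cutting a partition leaves intervals that do not start
  at 0.\<close>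

definition NC_ivl :: "nat \<Rightarrow> nat \<Rightarrow> nat set set set"
  where "NC_ivl a b = {\<pi>. partition_on {a..<b} \<pi> \<and> noncrossing \<pi>}"

definition NC_sum :: "(nat set \<Rightarrow> complex) \<Rightarrow> nat \<Rightarrow> nat \<Rightarrow> complex"
  where "NC_sum F a b = (\<Sum>\<pi>\<in>NC_ivl a b. \<Prod>B\<in>\<pi>. F B)"

text \<open>The block of the first point \<open>a\<close> has a weight \<open>G\<close> of its own,
  in which points already removed from that block can be remembered.\<close>

definition NC_sum_head :: "(nat set \<Rightarrow> complex) \<Rightarrow> (nat set \<Rightarrow> complex) \<Rightarrow> nat \<Rightarrow> nat \<Rightarrow> complex"
  where "NC_sum_head G F a b = (\<Sum>\<pi>\<in>NC_ivl a b. \<Prod>B\<in>\<pi>. if a \<in> B then G B else F B)"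

lemma NC_ivl_0: "NC_ivl 0 n = NC n"
  by (simp add: NC_ivl_def NC_def atLeast0LessThan)

lemma finite_NC_ivl [simp]: "finite (NC_ivl a b)"
  by (rule finite_subset[of _ "Pow (Pow {a..<b})"]) (auto simp: NC_ivl_def partition_on_def)

lemma NC_ivlD:
  assumes "\<pi> \<in> NC_ivl a b"
  shows "finite \<pi>" "B \<in> \<pi> \<Longrightarrow> B \<subseteq> {a..<b}" "B \<in> \<pi> \<Longrightarrow> B \<noteq> {}"
    "B \<in> \<pi> \<Longrightarrow> C \<in> \<pi> \<Longrightarrow> x \<in> B \<Longrightarrow> x \<in> C \<Longrightarrow> B = C"
    "a \<le> x \<Longrightarrow> x < b \<Longrightarrow> \<exists>B\<in>\<pi>. x \<in> B"
proof -
  have \<pi>: "\<Union>\<pi> = {a..<b}" "disjoint \<pi>" "{} \<notin> \<pi>"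
    using assms by (auto simp: NC_ivl_def partition_on_def)
  show "finite \<pi>" using \<pi>(1) by (metis finite_UnionD finite_atLeastLessThan)
  show "B \<subseteq> {a..<b}" if "B \<in> \<pi>" using that \<pi>(1) by blast
  show "B \<noteq> {}" if "B \<in> \<pi>" using that \<pi>(3) by blast
  show "B = C" if "B \<in> \<pi>" "C \<in> \<pi>" "x \<in> B" "x \<in> C"
    using \<pi>(2) that unfolding disjoint_def by blast
  show "\<exists>B\<in>\<pi>. x \<in> B" if "a \<le> x" "x < b"
  proof -
    have "x \<in> \<Union>\<pi>" unfolding \<pi>(1) using that by simp
    then show ?thesis by blast
  qed
qed

lemma NC_ivl_crossing:
  assumes "\<pi> \<in> NC_ivl a b" "B \<in> \<pi>" "C \<in> \<pi>" "i < j" "j < k" "k < l" "i \<in> B" "k \<in> B" "j \<in> C" "l \<in> C"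
  shows "B = C"
proof (rule ccontr)
  assume "B \<noteq> C"
  moreover have "noncrossing \<pi>" using assms(1) by (simp add: NC_ivl_def)
  ultimately show False unfolding noncrossing_def using assms(2-) by metis
qed

lemma NC_ivlI:
  assumes "\<And>B. B \<in> \<pi> \<Longrightarrow> B \<subseteq> {a..<b}" "\<And>B. B \<in> \<pi> \<Longrightarrow> B \<noteq> {}"
    and "\<And>B C x. B \<in> \<pi> \<Longrightarrow> C \<in> \<pi> \<Longrightarrow> x \<in> B \<Longrightarrow> x \<in> C \<Longrightarrow> B = C"
    and "\<And>x. a \<le> x \<Longrightarrow> x < b \<Longrightarrow> \<exists>B\<in>\<pi>. x \<in> B"
    and "\<And>B C i j k l. B \<in> \<pi> \<Longrightarrow> C \<in> \<pi> \<Longrightarrow> i < j \<Longrightarrow> j < k \<Longrightarrow> k < l \<Longrightarrow>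
      i \<in> B \<Longrightarrow> k \<in> B \<Longrightarrow> j \<in> C \<Longrightarrow> l \<in> C \<Longrightarrow> B = C"
  shows "\<pi> \<in> NC_ivl a b"
proof -
  have "\<Union>\<pi> = {a..<b}"
  proof
    show "\<Union>\<pi> \<subseteq> {a..<b}" using assms(1) by blast
    show "{a..<b} \<subseteq> \<Union>\<pi>"
    proof
      fix x assume "x \<in> {a..<b}"
      then have "\<exists>B\<in>\<pi>. x \<in> B" by (intro assms(4)) auto
      then show "x \<in> \<Union>\<pi>" by blast
    qed
  qed
  moreover have "disjoint \<pi>"
    unfolding disjoint_def using assms(3) by blast
  moreover have "noncrossing \<pi>"
    unfolding noncrossing_def
  proof (intro notI, elim bexE conjE exE)
    fix B C i j k l
    assume "B \<in> \<pi>" "C \<in> \<pi>" "i < j" "j < k" "k < l" "i \<in> B" "k \<in> B" "j \<in> C" "l \<in> C"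
    then have "B = C" by (rule assms(5))
    moreover assume "B \<noteq> C"
    ultimately show False by simp
  qed
  ultimately show ?thesis
    using assms(2) by (auto simp: NC_ivl_def partition_on_def)
qed

section \<open>Splitting by the block of the first point\<close>

context
  fixes a b :: nat
  assumes ab: "a < b"
begin

definition NC_single :: "nat set set set"
  where "NC_single = {\<pi> \<in> NC_ivl a b. {a} \<in> \<pi>}"

text \<open>\<open>s\<close> is the point that follows \<open>a\<close> in its block; together with
  \<open>NC_single\<close> these classes exhaust \<open>NC_ivl a b\<close>.\<close>

definition NC_next :: "nat \<Rightarrow> nat set set set"
  where "NC_next s = {\<pi> \<in> NC_ivl a b. \<exists>B\<in>\<pi>. a \<in> B \<and> s \<in> B \<and> B \<inter> {a<..<s} = {}}"

lemma NC_ivl_split: "NC_ivl a b = NC_single \<union> (\<Union>s\<in>{a<..<b}. NC_next s)"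
proof
  show "NC_ivl a b \<subseteq> NC_single \<union> (\<Union>s\<in>{a<..<b}. NC_next s)"
  proof
    fix \<pi> assume \<pi>: "\<pi> \<in> NC_ivl a b"
    obtain B where B: "B \<in> \<pi>" "a \<in> B" using NC_ivlD(5)[OF \<pi>, of a] ab by auto
    have sub: "B \<subseteq> {a..<b}" using NC_ivlD(2)[OF \<pi> B(1)] .
    show "\<pi> \<in> NC_single \<union> (\<Union>s\<in>{a<..<b}. NC_next s)"
    proof (cases "B = {a}")
      case True
      then show ?thesis using \<pi> B by (simp add: NC_single_def)
    next
      case False
      define s where "s = Min (B - {a})"
      have fin: "finite (B - {a})" using sub finite_subset by blast
      have "B - {a} \<noteq> {}" using B False by blast
      then have s: "s \<in> B - {a}" unfolding s_def by (rule Min_in[OF fin])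
      have "s \<le> x" if "x \<in> B - {a}" for x unfolding s_def by (rule Min_le[OF fin that])
      then have "B \<inter> {a<..<s} = {}" by fastforce
      moreover have "s \<in> {a<..<b}" using s sub by (auto simp: subset_iff less_le)
      ultimately show ?thesis using \<pi> B s by (auto simp: NC_next_def)
    qed
  qed
qed (auto simp: NC_single_def NC_next_def)

lemma NC_split_disjoint:
  assumes "s \<in> {a<..<b}" "t \<in> {a<..<b}"
  shows "NC_single \<inter> NC_next s = {}" "s \<noteq> t \<Longrightarrow> NC_next s \<inter> NC_next t = {}"
proof -
  show "NC_single \<inter> NC_next s = {}"
  proof (rule ccontr)
    assume "NC_single \<inter> NC_next s \<noteq> {}"
    then obtain \<pi> B where \<pi>: "\<pi> \<in> NC_ivl a b" "{a} \<in> \<pi>" "B \<in> \<pi>" "a \<in> B" "s \<in> B"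
      by (auto simp: NC_single_def NC_next_def)
    then have "B = {a}" using NC_ivlD(4)[of \<pi> a b B "{a}" a] by simp
    then show False using \<pi> assms by simp
  qed
  show "NC_next s \<inter> NC_next t = {}" if "s \<noteq> t"
  proof (rule ccontr)
    assume "NC_next s \<inter> NC_next t \<noteq> {}"
    then obtain \<pi> B C where \<pi>: "\<pi> \<in> NC_ivl a b" "B \<in> \<pi>" "a \<in> B" "s \<in> B" "B \<inter> {a<..<s} = {}"
      "C \<in> \<pi>" "a \<in> C" "t \<in> C" "C \<inter> {a<..<t} = {}"
      by (auto simp: NC_next_def)
    then have "B = C" using NC_ivlD(4)[of \<pi> a b B C a] by simp
    moreover have "s < t \<or> t < s" using that by auto
    ultimately show False using \<pi> assms by auto
  qed
qed

lemma NC_sum_single: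
  "(\<Sum>\<pi>\<in>NC_single. \<Prod>B\<in>\<pi>. if a \<in> B then G B else F B) = G {a} * NC_sum F (Suc a) b"
proof -
  have rem: "\<pi> - {{a}} \<in> NC_ivl (Suc a) b" if "\<pi> \<in> NC_single" for \<pi>
  proof -
    have \<pi>: "\<pi> \<in> NC_ivl a b" "{a} \<in> \<pi>" using that by (auto simp: NC_single_def)
    note D = NC_ivlD[OF \<pi>(1)]
    have a: "a \<notin> B" if "B \<in> \<pi> - {{a}}" for B
      using D(4)[OF \<pi>(2), of B a] that by auto
    show ?thesis
    proof (rule NC_ivlI)
      show "B \<subseteq> {Suc a..<b}" if "B \<in> \<pi> - {{a}}" for B
        using D(2)[of B] a[OF that] that by (auto simp: Suc_le_eq less_le)
      show "\<exists>B\<in>\<pi> - {{a}}. x \<in> B" if "Suc a \<le> x" "x < b" for x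
        using D(5)[of x] that by auto
      show "B \<noteq> {}" if "B \<in> \<pi> - {{a}}" for B
        using D(3)[of B] that by simp
      show "B = C" if "B \<in> \<pi> - {{a}}" "C \<in> \<pi> - {{a}}" "x \<in> B" "x \<in> C" for B C x
        using D(4)[of B C x] that by simp
      show "B = C" if "B \<in> \<pi> - {{a}}" "C \<in> \<pi> - {{a}}" "i < j" "j < k" "k < l"
        "i \<in> B" "k \<in> B" "j \<in> C" "l \<in> C" for B C i j k l
        using NC_ivl_crossing[OF \<pi>(1), of B C i j k l] that by simp
    qed
  qed
  have ins: "insert {a} \<pi> \<in> NC_single" "a \<notin> \<Union>\<pi>" if \<pi>: "\<pi> \<in> NC_ivl (Suc a) b" for \<pi>
  proof -
    note D = NC_ivlD[OF \<pi>]
    show a: "a \<notin> \<Union>\<pi>" using D(2) by fastforce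
    have "insert {a} \<pi> \<in> NC_ivl a b"
    proof (rule NC_ivlI)
      show "B \<subseteq> {a..<b}" if "B \<in> insert {a} \<pi>" for B
        using D(2)[of B] that ab by (fastforce simp: subset_eq)
      show "\<exists>B\<in>insert {a} \<pi>. x \<in> B" if "a \<le> x" "x < b" for x
        using D(5)[of x] that by (cases "x = a") auto
      show "B \<noteq> {}" if "B \<in> insert {a} \<pi>" for B
        using D(3)[of B] that by auto
      show "B = C" if "B \<in> insert {a} \<pi>" "C \<in> insert {a} \<pi>" "x \<in> B" "x \<in> C" for B C x
        using D(4)[of B C x] a that by auto
      show "B = C" if "B \<in> insert {a} \<pi>" "C \<in> insert {a} \<pi>" "i < j" "j < k" "k < l"
        "i \<in> B" "k \<in> B" "j \<in> C" "l \<in> C" for B C i j k l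
        using NC_ivl_crossing[OF \<pi>, of B C i j k l] that by auto
    qed
    then show "insert {a} \<pi> \<in> NC_single" by (simp add: NC_single_def)
  qed
  have "(\<Sum>\<pi>\<in>NC_single. \<Prod>B\<in>\<pi>. if a \<in> B then G B else F B) =
      (\<Sum>\<pi>\<in>NC_ivl (Suc a) b. G {a} * (\<Prod>B\<in>\<pi>. F B))"
  proof (rule sum.reindex_bij_witness[symmetric, of _ "\<lambda>\<pi>. \<pi> - {{a}}" "insert {a}"])
    fix \<pi> assume \<pi>: "\<pi> \<in> NC_ivl (Suc a) b"
    have "(\<Prod>B\<in>\<pi>. if a \<in> B then G B else F B) = (\<Prod>B\<in>\<pi>. F B)"
      by (rule prod.cong) (use ins(2)[OF \<pi>] in auto)
    moreover have "{a} \<notin> \<pi>" using ins(2)[OF \<pi>] by blast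
    ultimately show "(\<Prod>B\<in>insert {a} \<pi>. if a \<in> B then G B else F B) = G {a} * (\<Prod>B\<in>\<pi>. F B)"
      by (simp add: NC_ivlD(1)[OF \<pi>])
    show "insert {a} \<pi> - {{a}} = \<pi>" using \<open>{a} \<notin> \<pi>\<close> by simp
  qed (use rem ins in \<open>auto simp: NC_single_def\<close>)
  then show ?thesis by (simp add: NC_sum_def sum_distrib_left)
qed

text \<open>Nothing crosses the arc from \<open>a\<close> to \<open>s\<close>, so the partition
  splits into one of the points strictly between and one of \<open>{s..<b}\<close>. In the latter
  the block of \<open>a\<close> has lost \<open>a\<close> and is the block of the first point
  \<open>s\<close>; the weight \<open>G (insert a B)\<close> restores \<open>a\<close>.\<close>

lemma NC_sum_next:
  assumes s: "s \<in> {a<..<b}"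
  shows "(\<Sum>\<pi>\<in>NC_next s. \<Prod>B\<in>\<pi>. if a \<in> B then G B else F B) =
    NC_sum F (Suc a) s * NC_sum_head (\<lambda>B. G (insert a B)) F s b"
proof -
  \<comment> \<open>\<open>att\<close> puts \<open>a\<close> back into the block of
    \<open>s\<close>; \<open>inner\<close> and \<open>outer\<close> are the two halves. The facts
    \<open>cut\<close> and \<open>glue\<close> make cutting and gluing inverse to each
    other.\<close>
  define att where "att C = (if s \<in> C then insert a C else C)" for C
  define inner where "inner \<pi> = {C \<in> \<pi>. C \<subseteq> {a<..<s}}" for \<pi>
  define outer where "outer \<pi> = (\<lambda>C. C - {a}) ` {C \<in> \<pi>. \<not> C \<subseteq> {a<..<s}}" for \<pi>
  have cut: "inner \<pi> \<in> NC_ivl (Suc a) s" "outer \<pi> \<in> NC_ivl s b" "inner \<pi> \<union> att ` outer \<pi> = \<pi>"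
    if nx: "\<pi> \<in> NC_next s" for \<pi>
  proof -
    obtain B where \<pi>: "\<pi> \<in> NC_ivl a b" and B: "B \<in> \<pi>" "a \<in> B" "s \<in> B" "B \<inter> {a<..<s} = {}"
      using nx by (auto simp: NC_next_def)
    note D = NC_ivlD[OF \<pi>]
    \<comment> \<open>A block with points d beyond \<open>s\<close> and j between \<open>a\<close>
      and \<open>s\<close> would cross \<open>B\<close> at a < j < s < d.\<close>
    have far: "C \<subseteq> {s<..<b}" if C: "C \<in> \<pi>" "C \<noteq> B" "\<not> C \<subseteq> {a<..<s}" for C
    proof -
      have "a \<notin> C" "s \<notin> C" using D(4)[OF B(1) C(1)] B C by auto
      obtain d where d: "d \<in> C" "d \<notin> {a<..<s}" using C(3) by blast
      have "d \<noteq> a" "d \<noteq> s" using d(1) \<open>a \<notin> C\<close> \<open>s \<notin> C\<close> by auto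
      then have "s < d" using d subsetD[OF D(2)[OF C(1)] d(1)] by simp
      have "s < j" if j: "j \<in> C" for j
      proof (rule ccontr)
        assume "\<not> s < j"
        then have "a < j" "j < s"
          using j subsetD[OF D(2)[OF C(1)] j] \<open>a \<notin> C\<close> \<open>s \<notin> C\<close>
          by (metis atLeastLessThan_iff le_neq_implies_less, metis linorder_neqE_nat)
        then show False
          using NC_ivl_crossing[OF \<pi> B(1) C(1), of a j s d] B j d(1) \<open>s < d\<close> C(2) by simp
      qed
      then show ?thesis using D(2)[OF C(1)] by auto
    qed
    have B_sub: "B - {a} \<subseteq> {s..<b}" using B D(2)[OF B(1)] by (auto simp: disjoint_iff not_less[symmetric] subset_iff)
    have outer_eq: "outer \<pi> = insert (B - {a}) {C \<in> \<pi>. C \<subseteq> {s<..<b}}"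
    proof -
      have "{C \<in> \<pi>. \<not> C \<subseteq> {a<..<s}} = insert B {C \<in> \<pi>. C \<subseteq> {s<..<b}}"
      proof (intro set_eqI iffI)
        fix C assume "C \<in> {C \<in> \<pi>. \<not> C \<subseteq> {a<..<s}}"
        then show "C \<in> insert B {C \<in> \<pi>. C \<subseteq> {s<..<b}}" using far[of C] by blast
      next
        fix C assume "C \<in> insert B {C \<in> \<pi>. C \<subseteq> {s<..<b}}"
        then consider "C = B" | "C \<in> \<pi>" "C \<subseteq> {s<..<b}" by blast
        then show "C \<in> {C \<in> \<pi>. \<not> C \<subseteq> {a<..<s}}"
        proof cases
          case 1
          then show ?thesis using B(1,2) by auto
        next
          case 2
          then obtain x where "x \<in> C" using D(3)[of C] by blast
          with 2 show ?thesis by fastforce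
        qed
      qed
      moreover have "(\<lambda>C. C - {a}) ` {C \<in> \<pi>. C \<subseteq> {s<..<b}} = {C \<in> \<pi>. C \<subseteq> {s<..<b}}"
      proof -
        have "C - {a} = C" if "C \<subseteq> {s<..<b}" for C using that s by auto
        then have "(\<lambda>C. C - {a}) ` {C \<in> \<pi>. C \<subseteq> {s<..<b}} = id ` {C \<in> \<pi>. C \<subseteq> {s<..<b}}"
          by (intro image_cong) simp_all
        then show ?thesis by simp
      qed
      ultimately show ?thesis by (simp add: outer_def)
    qed
    show "inner \<pi> \<in> NC_ivl (Suc a) s"
    proof (rule NC_ivlI)
      show "\<exists>B\<in>inner \<pi>. x \<in> B" if x: "Suc a \<le> x" "x < s" for x
      proof -
        obtain C where C: "C \<in> \<pi>" "x \<in> C" using D(5)[of x] x s by auto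
        have "C \<noteq> B" using C B x by auto
        then have "C \<subseteq> {a<..<s}" using far[OF C(1)] subsetD[of C "{s<..<b}" x] C(2) x by fastforce
        then show ?thesis using C by (auto simp: inner_def)
      qed
      show "C \<subseteq> {Suc a..<s}" if "C \<in> inner \<pi>" for C
        using that by (auto simp: inner_def Suc_le_eq subset_iff)
      show "C \<noteq> {}" if "C \<in> inner \<pi>" for C
        using D(3)[of C] that by (simp add: inner_def)
      show "C = E" if "C \<in> inner \<pi>" "E \<in> inner \<pi>" "x \<in> C" "x \<in> E" for C E x
        using D(4)[of C E x] that by (simp add: inner_def)
      show "C = E" if "C \<in> inner \<pi>" "E \<in> inner \<pi>" "i < j" "j < k" "k < l"
        "i \<in> C" "k \<in> C" "j \<in> E" "l \<in> E" for C E i j k l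
        using NC_ivl_crossing[OF \<pi>, of C E i j k l] that by (simp add: inner_def)
    qed
    have lift: "\<exists>C'\<in>\<pi>. C \<subseteq> C' \<and> C = C' - {a}" if "C \<in> outer \<pi>" for C
      using that by (auto simp: outer_def)
    show "outer \<pi> \<in> NC_ivl s b"
    proof (rule NC_ivlI)
      show "C \<subseteq> {s..<b}" "C \<noteq> {}" if C: "C \<in> outer \<pi>" for C
      proof -
        consider "C = B - {a}" | "C \<in> \<pi>" "C \<subseteq> {s<..<b}" using C unfolding outer_eq by blast
        then have "C \<subseteq> {s..<b} \<and> C \<noteq> {}"
        proof cases
          case 1
          then show ?thesis using B_sub B(3) s by auto
        next
          case 2
          then show ?thesis using D(3)[of C] by fastforce
        qed
        then show "C \<subseteq> {s..<b}" "C \<noteq> {}" by simp_all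
      qed
      show "\<exists>C\<in>outer \<pi>. x \<in> C" if x: "s \<le> x" "x < b" for x
      proof -
        obtain C where C: "C \<in> \<pi>" "x \<in> C" using D(5)[of x] x s by auto
        then have "\<not> C \<subseteq> {a<..<s}" using x by auto
        then show ?thesis using C x s by (auto simp: outer_def)
      qed
      show "C = E" if CE: "C \<in> outer \<pi>" "E \<in> outer \<pi>" "x \<in> C" "x \<in> E" for C E x
      proof -
        obtain C' E' where "C' \<in> \<pi>" "E' \<in> \<pi>" "C \<subseteq> C'" "E \<subseteq> E'" "C = C' - {a}" "E = E' - {a}"
          using lift[OF CE(1)] lift[OF CE(2)] by blast
        then show ?thesis using D(4)[of C' E' x] CE(3,4) by auto
      qed
      show "C = E" if CE: "C \<in> outer \<pi>" "E \<in> outer \<pi>" "i < j" "j < k" "k < l" "i \<in> C" "k \<in> C" "j \<in> E" "l \<in> E"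
        for C E i j k l
      proof -
        obtain C' E' where "C' \<in> \<pi>" "E' \<in> \<pi>" "C \<subseteq> C'" "E \<subseteq> E'" "C = C' - {a}" "E = E' - {a}"
          using lift[OF CE(1)] lift[OF CE(2)] by blast
        then show ?thesis using NC_ivl_crossing[OF \<pi>, of C' E' i j k l] CE(3-) by auto
      qed
    qed
    have "att (C - {a}) = C" if C: "C \<in> \<pi>" "\<not> C \<subseteq> {a<..<s}" for C
    proof (cases "C = B")
      case True
      then show ?thesis using B s by (auto simp: att_def)
    next
      case False
      then show ?thesis using far[OF C(1) _ C(2)] s by (force simp: att_def)
    qed
    then have "att ` outer \<pi> = {C \<in> \<pi>. \<not> C \<subseteq> {a<..<s}}"
      by (force simp: outer_def image_iff)
    then show "inner \<pi> \<union> att ` outer \<pi> = \<pi>" by (auto simp: inner_def)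
  qed
  have glue: "\<pi>1 \<union> att ` \<pi>2 \<in> NC_next s" "inner (\<pi>1 \<union> att ` \<pi>2) = \<pi>1" "outer (\<pi>1 \<union> att ` \<pi>2) = \<pi>2"
    "(\<Prod>B\<in>\<pi>1 \<union> att ` \<pi>2. if a \<in> B then G B else F B) =
      (\<Prod>B\<in>\<pi>1. F B) * (\<Prod>B\<in>\<pi>2. if s \<in> B then G (insert a B) else F B)"
    if \<pi>1: "\<pi>1 \<in> NC_ivl (Suc a) s" and \<pi>2: "\<pi>2 \<in> NC_ivl s b" for \<pi>1 \<pi>2
  proof -
    note D1 = NC_ivlD[OF \<pi>1] and D2 = NC_ivlD[OF \<pi>2]
    obtain E where E: "E \<in> \<pi>2" "s \<in> E" using D2(5)[of s] s by auto
    have in1: "C \<subseteq> {a<..<s}" if "C \<in> \<pi>1" for C using D1(2)[OF that] by auto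
    have in1_a: "a \<notin> C" if "C \<in> \<pi>1" for C using in1[OF that] by auto
    have in2: "C \<subseteq> {s..<b}" "a \<notin> C" if "C \<in> \<pi>2" for C
    proof -
      show "C \<subseteq> {s..<b}" by (rule D2(2)[OF that])
      then show "a \<notin> C" using s by fastforce
    qed
    have att: "att C = (if C = E then insert a E else C)" if "C \<in> \<pi>2" for C
    proof (cases "s \<in> C")
      case True
      then have "E = C" by (rule D2(4)[OF E(1) that E(2)])
      then show ?thesis using True by (simp add: att_def)
    next
      case False
      then have "C \<noteq> E" using E(2) by blast
      then show ?thesis using False by (simp add: att_def)
    qed
    have att_minus: "att C - {a} = C" if "C \<in> \<pi>2" for C using in2[OF that] by (auto simp: att_def)
    then have inj: "inj_on att \<pi>2" by (metis inj_onI)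
    have nsub: "\<not> att C \<subseteq> {a<..<s}" if C: "C \<in> \<pi>2" for C
    proof -
      obtain x where "x \<in> C" using D2(3)[OF C] by blast
      then have "x \<in> att C" "s \<le> x" using in2[OF C] by (auto simp: att_def)
      then show ?thesis by fastforce
    qed
    show "inner (\<pi>1 \<union> att ` \<pi>2) = \<pi>1" using in1 nsub by (auto simp: inner_def)
    have "{C \<in> \<pi>1 \<union> att ` \<pi>2. \<not> C \<subseteq> {a<..<s}} = att ` \<pi>2" using in1 nsub by auto
    then show "outer (\<pi>1 \<union> att ` \<pi>2) = \<pi>2" by (simp add: outer_def image_image att_minus)
    have disj: "\<pi>1 \<inter> att ` \<pi>2 = {}" using in1 nsub by blast
    have "(\<Prod>B\<in>att ` \<pi>2. if a \<in> B then G B else F B) = (\<Prod>B\<in>\<pi>2. if s \<in> B then G (insert a B) else F B)"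
      by (subst prod.reindex[OF inj], rule prod.cong) (auto simp: att_def dest: in2)
    moreover have "(\<Prod>B\<in>\<pi>1. if a \<in> B then G B else F B) = (\<Prod>B\<in>\<pi>1. F B)"
      by (rule prod.cong) (use in1_a in auto)
    ultimately show "(\<Prod>B\<in>\<pi>1 \<union> att ` \<pi>2. if a \<in> B then G B else F B) =
        (\<Prod>B\<in>\<pi>1. F B) * (\<Prod>B\<in>\<pi>2. if s \<in> B then G (insert a B) else F B)"
      by (simp add: prod.union_disjoint D1(1) D2(1) disj)
    have split: "C \<in> \<pi>1 \<and> C \<subseteq> {a<..<s} \<or>
        (\<exists>C'\<in>\<pi>2. C = att C' \<and> C' \<subseteq> C \<and> C \<subseteq> insert a C' \<and> C' \<subseteq> {s..<b})"
      if C: "C \<in> \<pi>1 \<union> att ` \<pi>2" for C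
    proof (cases "C \<in> \<pi>1")
      case True
      then show ?thesis using in1 by blast
    next
      case False
      then obtain C' where "C' \<in> \<pi>2" "C = att C'" using C by blast
      moreover have "C' \<subseteq> att C'" "att C' \<subseteq> insert a C'" by (auto simp: att_def)
      ultimately show ?thesis using in2(1)[of C'] by blast
    qed
    have "\<pi>1 \<union> att ` \<pi>2 \<in> NC_ivl a b"
    proof (rule NC_ivlI)
      show "C \<subseteq> {a..<b}" if "C \<in> \<pi>1 \<union> att ` \<pi>2" for C
        using split[OF that]
      proof (elim disjE conjE bexE)
        assume "C \<subseteq> {a<..<s}"
        then show ?thesis by (rule order_trans) (use s in auto)
      next
        fix D assume "C \<subseteq> insert a D" "D \<subseteq> {s..<b}"
        then have "C \<subseteq> insert a {s..<b}" by blast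
        then show ?thesis by (rule order_trans) (use s in auto)
      qed
      show "C \<noteq> {}" if "C \<in> \<pi>1 \<union> att ` \<pi>2" for C
        using split[OF that] D1(3)[of C] D2(3) by blast
      show "\<exists>C\<in>\<pi>1 \<union> att ` \<pi>2. x \<in> C" if x: "a \<le> x" "x < b" for x
      proof -
        consider "x = a" | "Suc a \<le> x" "x < s" | "s \<le> x" using x by linarith
        then show ?thesis
        proof cases
          case 1
          then show ?thesis using E by (auto simp: att_def)
        next
          case 2
          then show ?thesis using D1(5)[of x] by blast
        next
          case 3
          then obtain C where "C \<in> \<pi>2" "x \<in> C" using D2(5)[of x] x by blast
          then show ?thesis by (auto simp: att_def)
        qed
      qed
      show "C = C'" if C: "C \<in> \<pi>1 \<union> att ` \<pi>2" "C' \<in> \<pi>1 \<union> att ` \<pi>2" and x: "x \<in> C" "x \<in> C'" for C C' x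
      proof (cases "x = a")
        case True
        \<comment> \<open>Only the block of \<open>s\<close> receives \<open>a\<close>.\<close>
        have "K = insert a E" if K: "K \<in> \<pi>1 \<union> att ` \<pi>2" "a \<in> K" for K
        proof -
          obtain K' where K': "K' \<in> \<pi>2" "K = att K'" using K in1_a by blast
          then show ?thesis using K(2) in2(2)[OF K'(1)] att[OF K'(1)] by (simp split: if_splits)
        qed
        then show ?thesis using C x True by metis
      next
        case False
        then show ?thesis
          using split[OF C(1)]
        proof (elim disjE conjE bexE)
          assume C1: "C \<in> \<pi>1" "C \<subseteq> {a<..<s}"
          show ?thesis
            using split[OF C(2)]
          proof (elim disjE conjE bexE)
            assume "C' \<in> \<pi>1" then show ?thesis using D1(4)[of C C' x] C1 x by simp
          next
            fix D assume "C' \<subseteq> insert a D" "D \<subseteq> {s..<b}"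
            then show ?thesis
              using subsetD[OF C1(2) x(1)] subsetD[of C' "insert a D" x] subsetD[of D "{s..<b}" x] x(2) False
              by auto
          qed
        next
          fix D assume D: "D \<in> \<pi>2" "C = att D" "C \<subseteq> insert a D" "D \<subseteq> {s..<b}"
          show ?thesis
            using split[OF C(2)]
          proof (elim disjE conjE bexE)
            assume "C' \<subseteq> {a<..<s}"
            then show ?thesis
              using subsetD[of C' _ x] subsetD[OF D(3) x(1)] subsetD[OF D(4), of x] x(2) False by fastforce
          next
            fix D' assume D': "D' \<in> \<pi>2" "C' = att D'" "C' \<subseteq> insert a D'"
            have "x \<in> D" "x \<in> D'" using D(3) D'(3) x False by auto
            then have "D = D'" using D2(4) D(1) D'(1) by simp
            then show ?thesis using D D' by simp
          qed
        qed
      qed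
      show "C = C'" if C: "C \<in> \<pi>1 \<union> att ` \<pi>2" "C' \<in> \<pi>1 \<union> att ` \<pi>2"
        and ord: "i < j" "j < k" "k < l" and mem: "i \<in> C" "k \<in> C" "j \<in> C'" "l \<in> C'" for C C' i j k l
        using split[OF C(1)]
      proof (elim disjE conjE bexE)
        assume C1: "C \<in> \<pi>1" "C \<subseteq> {a<..<s}"
        show "C = C'"
          using split[OF C(2)]
        proof (elim disjE conjE bexE)
          assume "C' \<in> \<pi>1"
          then show ?thesis using NC_ivl_crossing[OF \<pi>1 C1(1), of C' i j k l] ord mem by simp
        next
          fix D assume "D \<in> \<pi>2" "C' = att D" "D \<subseteq> C'" "C' \<subseteq> insert a D" "D \<subseteq> {s..<b}"
          moreover have "a < i" "k < s" using subsetD[OF C1(2) mem(1)] subsetD[OF C1(2) mem(2)] by simp_all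
          ultimately have False using subsetD[of C' "insert a D" j] subsetD[of D "{s..<b}" j] ord mem(3) by auto
          then show ?thesis ..
        qed
      next
        fix D assume D: "D \<in> \<pi>2" "C = att D" "D \<subseteq> C" "C \<subseteq> insert a D" "D \<subseteq> {s..<b}"
        have D_mem: "x = a \<or> x \<in> D \<and> s \<le> x" if "x \<in> C" for x
          using subsetD[OF D(4) that] subsetD[OF D(5), of x] by auto
        have "a < s" using s by simp
        then have "a \<le> i" using D_mem[OF mem(1)] by linarith
        show "C = C'"
          using split[OF C(2)]
        proof (elim disjE conjE bexE)
          assume "C' \<in> \<pi>1" "C' \<subseteq> {a<..<s}"
          then have "l < s" using subsetD[of C' _ l] mem(4) by fastforce
          moreover have "s \<le> k" using D_mem[OF mem(2)] \<open>a \<le> i\<close> ord by linarith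
          ultimately show ?thesis using ord by simp
        next
          fix D' assume D': "D' \<in> \<pi>2" "C' = att D'" "D' \<subseteq> C'" "C' \<subseteq> insert a D'" "D' \<subseteq> {s..<b}"
          have jl: "j \<in> D'" "l \<in> D'" and k: "k \<in> D"
            using subsetD[OF D'(4) mem(3)] subsetD[OF D'(4) mem(4)] D_mem[OF mem(2)] \<open>a \<le> i\<close> ord
            by auto
          \<comment> \<open>If i = a, then \<open>s\<close> lies in \<open>D\<close> and takes the
            place of \<open>a\<close> in the crossing; when s = j the two blocks already share a
            point.\<close>
          have "D = D'"
          proof (cases "i = a")
            case True
            then have "s \<in> D" using mem(1) D(2) in2(2)[OF D(1)] by (auto simp: att_def split: if_splits)
            moreover have "s \<le> j" using subsetD[OF D'(5) jl(1)] by simp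
            ultimately show ?thesis
              using NC_ivl_crossing[OF \<pi>2 D(1) D'(1), of s j k l] D2(4)[OF D(1) D'(1), of s] jl k ord
              by (cases "s = j") auto
          next
            case False
            then have "i \<in> D" using mem(1) D(4) by blast
            then show ?thesis using NC_ivl_crossing[OF \<pi>2 D(1) D'(1), of i j k l] jl k ord by simp
          qed
          then show ?thesis using D D' by simp
        qed
      qed
    qed
    moreover have "insert a E \<in> \<pi>1 \<union> att ` \<pi>2" using E by (auto simp: att_def intro!: rev_image_eqI)
    moreover have "insert a E \<inter> {a<..<s} = {}" using in2(1)[OF E(1)] by fastforce
    moreover have "a \<in> insert a E" "s \<in> insert a E" using E(2) by simp_all
    ultimately show "\<pi>1 \<union> att ` \<pi>2 \<in> NC_next s"
      unfolding NC_next_def by (intro CollectI conjI bexI[of _ "insert a E"])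
  qed
  have "(\<Sum>\<pi>\<in>NC_next s. \<Prod>B\<in>\<pi>. if a \<in> B then G B else F B) =
      (\<Sum>(\<pi>1, \<pi>2)\<in>NC_ivl (Suc a) s \<times> NC_ivl s b.
        (\<Prod>B\<in>\<pi>1. F B) * (\<Prod>B\<in>\<pi>2. if s \<in> B then G (insert a B) else F B))"
  proof (rule sum.reindex_bij_witness[where i = "\<lambda>(\<pi>1, \<pi>2). \<pi>1 \<union> att ` \<pi>2" and
        j = "\<lambda>\<pi>. (inner \<pi>, outer \<pi>)" and S = "NC_next s" and T = "NC_ivl (Suc a) s \<times> NC_ivl s b" and
        g = "\<lambda>\<pi>. \<Prod>B\<in>\<pi>. if a \<in> B then G B else F B" and
        h = "\<lambda>(\<pi>1, \<pi>2). (\<Prod>B\<in>\<pi>1. F B) * (\<Prod>B\<in>\<pi>2. if s \<in> B then G (insert a B) else F B)"])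
    fix \<pi> assume \<pi>: "\<pi> \<in> NC_next s"
    show "(case (inner \<pi>, outer \<pi>) of (\<pi>1, \<pi>2) \<Rightarrow> \<pi>1 \<union> att ` \<pi>2) = \<pi>"
      using cut(3)[OF \<pi>] by simp
    show "(inner \<pi>, outer \<pi>) \<in> NC_ivl (Suc a) s \<times> NC_ivl s b"
      using cut(1,2)[OF \<pi>] by simp
    show "(case (inner \<pi>, outer \<pi>) of (\<pi>1, \<pi>2) \<Rightarrow>
        (\<Prod>B\<in>\<pi>1. F B) * (\<Prod>B\<in>\<pi>2. if s \<in> B then G (insert a B) else F B)) =
        (\<Prod>B\<in>\<pi>. if a \<in> B then G B else F B)"
      using glue(4)[OF cut(1,2)[OF \<pi>]] unfolding cut(3)[OF \<pi>] prod.case by (rule sym)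
  next
    fix z assume "z \<in> NC_ivl (Suc a) s \<times> NC_ivl s b"
    then obtain \<pi>1 \<pi>2 where z: "z = (\<pi>1, \<pi>2)" and 1: "\<pi>1 \<in> NC_ivl (Suc a) s" and 2: "\<pi>2 \<in> NC_ivl s b"
      by blast
    note g = glue[OF 1 2]
    show "(inner (case z of (\<pi>1, \<pi>2) \<Rightarrow> \<pi>1 \<union> att ` \<pi>2), outer (case z of (\<pi>1, \<pi>2) \<Rightarrow> \<pi>1 \<union> att ` \<pi>2)) = z"
      by (simp add: z g(2,3))
    show "(case z of (\<pi>1, \<pi>2) \<Rightarrow> \<pi>1 \<union> att ` \<pi>2) \<in> NC_next s"
      using g(1) by (simp add: z)
  qed
  then show ?thesis
    by (simp add: NC_sum_def NC_sum_head_def sum_product sum.cartesian_product)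
qed

lemma NC_sum_head_rec:
  "NC_sum_head G F a b = G {a} * NC_sum F (Suc a) b +
    (\<Sum>s\<in>{a<..<b}. NC_sum F (Suc a) s * NC_sum_head (\<lambda>B. G (insert a B)) F s b)"
proof -
  have fin: "finite NC_single" "finite (NC_next s)" for s
    by (simp_all add: NC_single_def NC_next_def)
  have disj: "NC_single \<inter> (\<Union>s\<in>{a<..<b}. NC_next s) = {}"
    unfolding Int_UN_distrib by (simp add: NC_split_disjoint(1))
  have "NC_sum_head G F a b = (\<Sum>\<pi>\<in>NC_single. \<Prod>B\<in>\<pi>. if a \<in> B then G B else F B) +
      (\<Sum>\<pi>\<in>(\<Union>s\<in>{a<..<b}. NC_next s). \<Prod>B\<in>\<pi>. if a \<in> B then G B else F B)"
    unfolding NC_sum_head_def NC_ivl_split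
    by (rule sum.union_disjoint) (simp_all add: fin disj)
  also have "(\<Sum>\<pi>\<in>(\<Union>s\<in>{a<..<b}. NC_next s). \<Prod>B\<in>\<pi>. if a \<in> B then G B else F B) =
      (\<Sum>s\<in>{a<..<b}. \<Sum>\<pi>\<in>NC_next s. \<Prod>B\<in>\<pi>. if a \<in> B then G B else F B)"
    by (rule sum.UNION_disjoint) (simp_all add: fin NC_split_disjoint(2))
  finally show ?thesis by (simp add: NC_sum_single NC_sum_next)
qed

end

section \<open>The functional equation for moments and free cumulants\<close>

lemma nths_insert_less:
  assumes "a < length w" "\<And>x. x \<in> B \<Longrightarrow> a < x"
  shows "nths w (insert a B) = w ! a # nths w B"
proof -
  have w: "w = take a w @ w ! a # drop (Suc a) w" using assms(1) by (rule id_take_nth_drop)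
  have len: "length (take a w) = a" using assms(1) by simp
  have empty: "nths (take a w) C = []" if "C \<inter> {..<a} = {}" for C
  proof -
    have "set (nths (take a w) C) = {}" using that len by (auto simp: set_nths simp del: length_take)
    then show ?thesis by simp
  qed
  have 1: "nths (take a w) (insert a B) = []" "nths (take a w) B = []"
    by (rule empty, use assms(2) in fastforce)+
  have "a \<notin> B" using assms(2) by blast
  then show ?thesis
    by (subst (1 3) w) (simp add: nths_append len 1 nths_Cons del: length_take)
qed

text \<open>Collecting the terms by the block of the first letter turns the moment-cumulant formula
  into a functional equation.\<close>

lemma moment_cumulant_functional_equation:
  fixes f C :: "('k::finite, complex) ser"
  assumes f: "coef f [] = 0" and C0: "coef C [] = 1"
    and C: "\<And>v. v \<noteq> [] \<Longrightarrow> coef C v = (\<Sum>\<pi>\<in>NC (length v). cf_partition (coef f) v \<pi>)"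
  shows "C = 1 + C.subst (\<lambda>i. var i * C) f"
proof -
  define E where "E = C.subst (\<lambda>i. var i * C)"
  define F where "F g w B = coef g (nths w B)" for g :: "('k, complex) ser" and w B
  have E_Nil: "coef (E g) [] = coef g []" for g by (simp add: E_def)
  \<comment> \<open>Stripping a first letter from \<open>E g\<close> yields the convolution that
    \<open>NC_sum_head_rec\<close> yields at the first point.\<close>
  have E_Cons: "coef (E g) (i # w) = coef (C * E (ld i g)) w" for g i w
  proof -
    have "E g = cst (coef g []) + (\<Sum>i\<in>UNIV. var i * (C * E (ld i g)))"
      unfolding E_def by (subst C.subst_rec) (simp_all add: mult.assoc)
    then have "ld i (E g) = C * E (ld i g)"
      using left_decomposition_unique[of i "\<lambda>i. C * E (ld i g)"] by simp
    then show ?thesis by (metis coef_ld)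
  qed
  have head: "NC_sum_head (F f w) (F f w) a b = NC_sum (F f w) a b" for w a b
    by (simp add: NC_sum_head_def NC_sum_def)
  have C_sum: "coef C v = NC_sum (F f v) 0 (length v)" if "v \<noteq> []" for v
    using C[OF that] by (simp add: NC_sum_def NC_ivl_0 cf_partition_def F_def)
  have weight: "NC_sum_head G F' a b = NC_sum_head G' F' a b"
    if "\<And>B. B \<subseteq> {a..<b} \<Longrightarrow> G B = G' B" for G G' F' a b
    unfolding NC_sum_head_def
    by (intro sum.cong prod.cong refl) (use that NC_ivlD(2) in auto)
  \<comment> \<open>The claim is general in \<open>g\<close>, which stands for \<open>f\<close> with
    the letters of the head block read so far stripped off. Induction on b - a covers intervals at
    all positions of all words.\<close>
  have "b \<le> length w \<longrightarrow> b - a = n \<longrightarrow>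
      (a \<le> b \<longrightarrow> NC_sum (F f w) a b = coef C (drop a (take b w))) \<and>
      (a < b \<longrightarrow> (\<forall>g. NC_sum_head (F g w) (F f w) a b = coef (E g) (drop a (take b w))))" for n w a b
  proof (induction n arbitrary: w a b rule: less_induct)
    case (less n)
    have head_eq: "NC_sum_head (F g w) (F f w) a b = coef (E g) (drop a (take b w))"
      if ab: "a < b" "b \<le> length w" "b - a = n" for g w a b
    proof -
      define u where "u = drop (Suc a) (take b w)"
      have len: "length u = b - Suc a" using ab by (simp add: u_def)
      have v: "drop a (take b w) = w ! a # u"
        using ab Cons_nth_drop_Suc[of a "take b w"] by (simp add: u_def)
      have part: "NC_sum (F f w) (Suc a) s = coef C (take (s - Suc a) u)" if "Suc a \<le> s" "s \<le> b" for s
      proof -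
        have "NC_sum (F f w) (Suc a) s = coef C (drop (Suc a) (take s w))"
          using less.IH[of "s - Suc a" s w "Suc a"] that ab by simp
        also have "drop (Suc a) (take s w) = take (s - Suc a) u"
          using that by (simp add: u_def take_drop min_def)
        finally show ?thesis .
      qed
      have rest: "NC_sum_head (\<lambda>B. F g w (insert a B)) (F f w) s b = coef (E (ld (w ! a) g)) (drop (s - Suc a) u)"
        if s: "s \<in> {a<..<b}" for s
      proof -
        have "NC_sum_head (\<lambda>B. F g w (insert a B)) (F f w) s b = NC_sum_head (F (ld (w ! a) g) w) (F f w) s b"
        proof (rule weight)
          fix B assume "B \<subseteq> {s..<b}"
          then have "nths w (insert a B) = w ! a # nths w B"
            using s ab by (intro nths_insert_less) auto
          then show "F g w (insert a B) = F (ld (w ! a) g) w B" by (simp add: F_def)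
        qed
        also have "\<dots> = coef (E (ld (w ! a) g)) (drop s (take b w))"
          using less.IH[of "b - s" b w s] s ab by auto
        also have "drop s (take b w) = drop (s - Suc a) u" using s by (simp add: u_def)
        finally show ?thesis .
      qed
      have "NC_sum_head (F g w) (F f w) a b = F g w {a} * NC_sum (F f w) (Suc a) b +
          (\<Sum>s\<in>{a<..<b}. NC_sum (F f w) (Suc a) s * NC_sum_head (\<lambda>B. F g w (insert a B)) (F f w) s b)"
        by (rule NC_sum_head_rec[OF ab(1)])
      also have "F g w {a} = coef g [w ! a]"
        using nths_insert_less[of a w "{}"] ab by (simp add: F_def)
      also have "NC_sum (F f w) (Suc a) b = coef C u" using part[of b] ab len by simp
      also have "(\<Sum>s\<in>{a<..<b}. NC_sum (F f w) (Suc a) s * NC_sum_head (\<lambda>B. F g w (insert a B)) (F f w) s b) =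
          (\<Sum>s\<in>{a<..<b}. coef C (take (s - Suc a) u) * coef (E (ld (w ! a) g)) (drop (s - Suc a) u))"
        by (intro sum.cong refl) (simp add: part rest)
      also have "\<dots> = (\<Sum>m<length u. coef C (take m u) * coef (E (ld (w ! a) g)) (drop m u))"
        by (rule sum.reindex_bij_witness[of _ "\<lambda>m. m + Suc a" "\<lambda>s. s - Suc a"]) (use len in auto)
      \<comment> \<open>The singleton block supplies the term m = length u of the product, where the
        second factor is at its constant term.\<close>
      also have "coef g [w ! a] * coef C u + \<dots> = coef (C * E (ld (w ! a) g)) u"
        by (simp add: coef_mult lessThan_Suc_atMost[symmetric] E_Nil mult.commute)
      finally show ?thesis by (simp add: v E_Cons)
    qed
    have "NC_sum (F f w) a b = coef C (drop a (take b w))" if ab: "a \<le> b" "b \<le> length w" "b - a = n"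
    proof (cases "a = b")
      case True
      have "NC_ivl b b = {{}}" by (auto simp: NC_ivl_def partition_on_def noncrossing_def)
      then show ?thesis using True by (simp add: NC_sum_def C0)
    next
      case False
      define v where "v = drop a (take b w)"
      have v: "length v = n" "n > 0" using ab False by (auto simp: v_def)
      \<comment> \<open>\<open>head_eq\<close> is used twice, for \<open>v\<close> from position 0
        and for \<open>w\<close> on \<open>{a..<b}\<close>. Hence the sum over an interval depends
        only on the subword, with no translation of partitions.\<close>
      from v have "coef C v = NC_sum_head (F f v) (F f v) 0 n" using v C_sum[of v] by (auto simp: head)
      also have "\<dots> = coef (E f) v" using head_eq[of 0 n v f] v by simp
      also have "\<dots> = NC_sum (F f w) a b" using head_eq[of a b w f] ab False by (simp add: v_def head)
      finally show ?thesis by (simp add: v_def)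
    qed
    then show ?case using head_eq by auto
  qed
  note main = this
  show ?thesis
  proof (rule ser_eqI)
    fix v
    show "coef C v = coef (1 + C.subst (\<lambda>i. var i * C) f) v"
    proof (cases v)
      case Nil
      then show ?thesis by (simp add: C0 f)
    next
      case Cons
      then have "coef C v = coef (E f) v"
        using main[of "length v" v 0 "length v"] by (simp add: C_sum flip: head)
      then show ?thesis using Cons by (simp add: E_def)
    qed
  qed
qed

section \<open>Existence of free realizations\<close>

definition monochrome :: "('a + 'b) list \<Rightarrow> bool"
  where "monochrome u \<longleftrightarrow> u \<noteq> [] \<and> (\<forall>i\<in>set u. isl i = isl (hd u))"

text \<open>The maximal runs of letters of the same kind, \<open>Inl\<close> or
  \<open>Inr\<close>.\<close>

fun runs :: "('a + 'b) list \<Rightarrow> ('a + 'b) list list"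
  where "runs [] = []"
  | "runs (i # w) = (case runs w of [] \<Rightarrow> [[i]]
      | u # us \<Rightarrow> if isl i = isl (hd u) then (i # u) # us else [i] # u # us)"

lemma concat_runs [simp]: "concat (runs w) = w"
  by (induction w) (auto split: list.splits)

lemma Nil_notin_runs: "[] \<notin> set (runs w)"
  by (induction w) (auto split: list.splits)

lemma runs_append:
  assumes "monochrome u" "runs w = us" "us \<noteq> [] \<longrightarrow> isl (hd (hd us)) \<noteq> isl (hd u)"
  shows "runs (u @ w) = u # us"
  using assms
proof (induction u)
  case (Cons i u)
  show ?case
  proof (cases u)
    case Nil
    then show ?thesis using Cons.prems by (auto split: list.splits)
  next
    case (Cons j v)
    then have "monochrome u" "isl (hd u) = isl i" using Cons.prems(1) by (auto simp: monochrome_def)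
    then show ?thesis using Cons.IH Cons.prems Cons by (auto simp: monochrome_def)
  qed
qed (simp add: monochrome_def)

lemma runs_concat:
  assumes "\<forall>u\<in>set us. monochrome u" "successively (\<lambda>u v. isl (hd u) \<noteq> isl (hd v)) us"
  shows "runs (concat us) = us"
  using assms
proof (induction us)
  case (Cons u us)
  then have "runs (concat us) = us" by (cases us) auto
  then have "runs (u @ concat us) = u # us"
    by (rule runs_append[rotated]) (use Cons.prems in \<open>cases us; auto\<close>)+
  then show ?case by simp
qed simp

definition shorter :: "nat \<Rightarrow> 'k ncpoly \<Rightarrow> bool"
  where "shorter n p \<longleftrightarrow> (\<forall>v\<in>Poly_Mapping.keys p. length (letters v) < n)"

lemma shorter_add: "shorter n p \<Longrightarrow> shorter n q \<Longrightarrow> shorter n (p + q)"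
  using Poly_Mapping.keys_add[of p q] by (auto simp: shorter_def)

lemma shorter_diff: "shorter n p \<Longrightarrow> shorter n q \<Longrightarrow> shorter n (p - q)"
  using keys_diff[of p q] by (auto simp: shorter_def)

lemma shorter_scale: "shorter n p \<Longrightarrow> shorter n (ncp_scale c p)"
  by (auto simp: shorter_def in_keys_iff)

lemma shorter_mono: "shorter n p \<Longrightarrow> n \<le> m \<Longrightarrow> shorter m p"
  by (auto simp: shorter_def)

lemma shorter_word: "shorter n (word_prod ncp_var w) \<longleftrightarrow> length w < n"
  by (simp add: shorter_def word_prod_ncp_var)

lemma shorter_word_mult: "shorter n p \<Longrightarrow> shorter (length w + n) (word_prod ncp_var w * p)"
  using keys_mult[of "word_prod ncp_var w" p]
  by (fastforce simp: shorter_def word_prod_ncp_var plus_free_monoid_def)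

section \<open>Construction of the free functional\<close>

context
  fixes \<mu> \<nu> :: "'k ncpoly \<Rightarrow> complex"
  assumes \<mu>: "\<mu> \<in> D_alg" and \<nu>: "\<nu> \<in> D_alg"
begin

definition run_moment :: "('k + 'k) list \<Rightarrow> complex"
  where "run_moment u = (if isl (hd u) then \<mu> (word_prod ncp_var (map projl u))
    else \<nu> (word_prod ncp_var (map projr u)))"

definition centred_run :: "('k + 'k) list \<Rightarrow> ('k + 'k) ncpoly"
  where "centred_run u = word_prod ncp_var u - ncp_scale (run_moment u) 1"

text \<open>Each run enters minus its prescribed moment. Freeness forces a functional with these
  moments to vanish on the product for nonempty \<open>w\<close>, and the construction imposes
  exactly this.\<close>

definition centred_word :: "('k + 'k) list \<Rightarrow> ('k + 'k) ncpoly"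
  where "centred_word w = prod_list (map centred_run (runs w))"

text \<open>When the product is expanded, replacing a run by its scalar moment loses letters, since
  runs are nonempty.\<close>

lemma centred_word_leading: "shorter (length w) (centred_word w - word_prod ncp_var w)"
proof -
  have "shorter (length (concat us)) (prod_list (map centred_run us) - word_prod ncp_var (concat us))"
    if "[] \<notin> set us" for us
    using that
  proof (induction us)
    case (Cons u us)
    let ?W = "word_prod ncp_var (concat us)" and ?U = "word_prod ncp_var u" and ?n = "length (concat us)"
    let ?L = "prod_list (map centred_run us) - ?W"
    have L: "shorter ?n ?L" using Cons by simp
    have len: "?n < length u + ?n" using Cons.prems by (cases u) auto
    have "prod_list (map centred_run (u # us)) - word_prod ncp_var (concat (u # us)) =
        ?U * ?L - ncp_scale (run_moment u) (?W + ?L)"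
      by (simp add: centred_run_def word_prod_append algebra_simps ncp_scale_mult_left)
    moreover have "shorter (length u + ?n) (?U * ?L)" by (rule shorter_word_mult[OF L])
    moreover have "shorter (length u + ?n) (ncp_scale (run_moment u) (?W + ?L))"
      using len by (intro shorter_scale shorter_add shorter_mono[OF L]) (simp_all add: shorter_word)
    ultimately show ?case using shorter_diff by (metis concat.simps(2) length_append)
  qed (simp add: shorter_def)
  from this[OF Nil_notin_runs, of w] show ?thesis by (simp add: centred_word_def)
qed

text \<open>The centred words are triangular in the words, so a functional is determined by killing all
  but the empty one.\<close>

function free_moment :: "('k + 'k) list \<Rightarrow> complex"
  where "free_moment w = (if w = [] then 1 else
    - (\<Sum>v\<in>{v \<in> Poly_Mapping.keys (centred_word w - word_prod ncp_var w). length (letters v) < length w}.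
      Poly_Mapping.lookup (centred_word w - word_prod ncp_var w) v * free_moment (letters v)))"
  by auto
termination by (relation "measure length") auto

declare free_moment.simps [simp del]

lemma free_functional_exists:
  obtains \<phi> :: "('k + 'k) ncpoly \<Rightarrow> complex"
  where "\<phi> \<in> D_alg" "\<And>w. w \<noteq> [] \<Longrightarrow> \<phi> (centred_word w) = 0"
proof -
  obtain \<phi> :: "('k + 'k) ncpoly \<Rightarrow> complex" where \<phi>: "\<phi> \<in> D_alg"
    and word: "\<And>w. w \<noteq> [] \<Longrightarrow> \<phi> (word_prod ncp_var w) = free_moment w"
    using D_alg_exists[of free_moment] by blast
  have word': "\<phi> (word_prod ncp_var w) = free_moment w" for w
    using word[of w] D_algD(3)[OF \<phi>] by (cases "w = []") (simp_all add: free_moment.simps[of "[]"])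
  have "\<phi> (centred_word w) = 0" if "w \<noteq> []" for w
  proof -
    let ?L = "centred_word w - word_prod ncp_var w"
    \<comment> \<open>The sum in \<open>free_moment\<close> ranges over shorter words so that the
      recursion terminates; by \<open>centred_word_leading\<close> this range covers all words of
      \<open>?L\<close>.\<close>
    have keys: "{v \<in> Poly_Mapping.keys ?L. length (letters v) < length w} = Poly_Mapping.keys ?L"
      using centred_word_leading[of w] by (auto simp: shorter_def)
    have "\<phi> ?L = (\<Sum>v\<in>Poly_Mapping.keys ?L. Poly_Mapping.lookup ?L v * free_moment (letters v))"
      by (subst D_alg_expand[OF \<phi>]) (simp add: word')
    also have "\<dots> = - free_moment w"
      using that by (subst free_moment.simps[of w]) (simp only: keys if_False minus_minus)
    finally have "\<phi> (word_prod ncp_var w + ?L) = 0"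
      by (subst D_algD(1)[OF \<phi>]) (simp add: word')
    then show ?thesis by simp
  qed
  with \<phi> that show thesis by blast
qed

lemma hull_subset_ncp_eval:
  fixes z :: "'k \<Rightarrow> ('k + 'k) ncpoly"
  shows "unital_subalgebra ncp_scale hull (range z) \<subseteq> range (ncp_eval ncp_scale z)"
proof (rule hull_minimal)
  \<comment> \<open>Any functional will do: it makes the free algebra a probability space, in which
    the rules for \<open>ncp_eval\<close> hold.\<close>
  obtain \<phi> :: "('k + 'k) ncpoly \<Rightarrow> complex" where "\<phi> \<in> D_alg" by (rule free_functional_exists)
  then interpret nc_prob_space ncp_scale \<phi> by (simp add: D_alg_iff_nc_prob_space)
  let ?e = "ncp_eval ncp_scale z"
  show "range z \<subseteq> range ?e"
    by (rule image_subsetI) (metis ncp_eval_var rangeI)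
  have "1 \<in> range ?e" by (metis ncp_eval_1 rangeI)
  moreover have "?e p + ?e q \<in> range ?e" "?e p * ?e q \<in> range ?e" "ncp_scale c (?e p) \<in> range ?e" for p q c
    by (metis ncp_eval_add rangeI, metis ncp_eval_mult rangeI, metis ncp_eval_scale rangeI)
  ultimately show "unital_subalgebra ncp_scale (range ?e)" by (auto simp: unital_subalgebra_def)
qed

theorem free_realization_exists:
  "\<exists>\<phi> :: ('k + 'k) ncpoly \<Rightarrow> complex.
    free_realization ncp_scale \<phi> (\<lambda>i. ncp_var (Inl i)) (\<lambda>i. ncp_var (Inr i)) \<mu> \<nu>"
proof -
  let ?X = "\<lambda>i. ncp_var (Inl i) :: ('k + 'k) ncpoly" and ?Y = "\<lambda>i. ncp_var (Inr i) :: ('k + 'k) ncpoly"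
  obtain \<phi> :: "('k + 'k) ncpoly \<Rightarrow> complex" where \<phi>: "\<phi> \<in> D_alg"
    and null: "\<And>w. w \<noteq> [] \<Longrightarrow> \<phi> (centred_word w) = 0"
    by (rule free_functional_exists) blast
  interpret nc_prob_space ncp_scale \<phi> using \<phi> by (simp add: D_alg_iff_nc_prob_space)
  \<comment> \<open>A word with a single run is its own run, so killing the centred word prescribes
    its moment.\<close>
  have mono: "\<phi> (word_prod ncp_var u) = run_moment u" if "monochrome u" for u
  proof -
    have "centred_word u = centred_run u"
      using runs_append[OF that, of "[]"] by (simp add: centred_word_def)
    moreover have "u \<noteq> []" using that by (simp add: monochrome_def)
    ultimately have "\<phi> (centred_run u) = 0" using null[of u] by simp
    then show ?thesis by (simp add: centred_run_def diff scale phi_one)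
  qed
  define inj where "inj r = (if r then Inl else Inr :: 'k \<Rightarrow> 'k + 'k)" for r
  have inj_mono: "monochrome (map (inj r) w)" "isl (hd (map (inj r) w)) = r" if "w \<noteq> []" for r w
    using that by (auto simp: monochrome_def inj_def hd_map)
  have word: "word_prod (\<lambda>i. ncp_var (inj r i)) w = word_prod ncp_var (map (inj r) w)" for r w
    by (simp add: word_prod_def comp_def)
  have dist: "has_joint_distribution \<phi> ?X \<mu>" "has_joint_distribution \<phi> ?Y \<nu>"
    unfolding has_joint_distribution_def
    using \<mu> \<nu> word[of True] word[of False] mono[OF inj_mono(1)[of _ True]] mono[OF inj_mono(1)[of _ False]]
    by (auto simp: inj_def run_moment_def hd_map comp_def)
  \<comment> \<open>Elements of a subalgebra are combinations of monochrome words and 1. If centred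
    runs are killed between x and y, then by linearity \<open>a\<close> comes out as its
    mean.\<close>
  have transfer: "\<phi> (x * a * y) = \<phi> a * \<phi> (x * y)"
    if a: "a \<in> unital_subalgebra ncp_scale hull (range (\<lambda>i. ncp_var (inj r i)))"
      and cent: "\<And>u. monochrome u \<Longrightarrow> isl (hd u) = r \<Longrightarrow> \<phi> (x * centred_run u * y) = 0" for x a y r
  proof -
    obtain p where p: "a = ncp_eval ncp_scale (\<lambda>i. ncp_var (inj r i)) p"
      using subsetD[OF hull_subset_ncp_eval a] by blast
    have w: "\<phi> (x * word_prod ncp_var (map (inj r) w) * y) = \<phi> (word_prod ncp_var (map (inj r) w)) * \<phi> (x * y)" for w
    proof (cases "w = []")
      case True
      then show ?thesis by (simp add: phi_one)
    next
      case False
      let ?u = "map (inj r) w"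
      have "\<phi> (x * centred_run ?u * y) = \<phi> (x * word_prod ncp_var ?u * y) - run_moment ?u * \<phi> (x * y)"
        by (simp add: centred_run_def left_diff_distrib right_diff_distrib diff scale
            ncp_scale_mult_left ncp_scale_mult_right)
      then show ?thesis using cent[OF inj_mono[OF False]] mono[OF inj_mono(1)[OF False]] by simp
    qed
    let ?c = "\<lambda>v. Poly_Mapping.lookup p v" and ?w = "\<lambda>v. word_prod ncp_var (map (inj r) (letters v))"
    have a': "a = (\<Sum>v\<in>Poly_Mapping.keys p. ncp_scale (?c v) (?w v))"
      unfolding p ncp_eval_def word ..
    have "x * a * y = (\<Sum>v\<in>Poly_Mapping.keys p. ncp_scale (?c v) (x * ?w v * y))"
      unfolding a' sum_distrib_left sum_distrib_right ncp_scale_mult_left ncp_scale_mult_right ..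
    then have "\<phi> (x * a * y) = (\<Sum>v\<in>Poly_Mapping.keys p. ?c v * (\<phi> (?w v) * \<phi> (x * y)))"
      by (simp only: sum scale w)
    also have "\<dots> = \<phi> a * \<phi> (x * y)"
      unfolding a' sum scale sum_distrib_right by (simp only: mult.assoc)
    finally show ?thesis .
  qed
  have "freely_independent ncp_scale \<phi> (range ?X) (range ?Y)"
    unfolding freely_independent_def
  proof (intro allI impI)
    fix as :: "(bool \<times> ('k + 'k) ncpoly) list"
    assume ne: "as \<noteq> []"
      and mem: "\<forall>(r, a)\<in>set as. a \<in> unital_subalgebra ncp_scale hull (if r then range ?X else range ?Y) \<and> \<phi> a = 0"
      and alt: "\<forall>j. Suc j < length as \<longrightarrow> fst (as ! j) \<noteq> fst (as ! Suc j)"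
    let ?good = "\<lambda>as. \<forall>(r, a)\<in>set as. a \<in> unital_subalgebra ncp_scale hull (range (\<lambda>i. ncp_var (inj r i))) \<and> \<phi> a = 0"
    have good: "?good as"
      using mem by (auto simp: inj_def split: if_splits)
    have alt: "successively (\<lambda>x y. fst x \<noteq> fst y) as"
      using alt by (auto simp: successively_conv_nth)
    \<comment> \<open>Hybrid products: centred runs first, arbitrary centred elements after. The
      induction turns these elements into centred runs one at a time from the left, until only a
      centred word is left.\<close>
    have "\<phi> (prod_list (map centred_run us) * prod_list (map snd as)) = 0"
      if "us \<noteq> [] \<or> as \<noteq> []" "\<forall>u\<in>set us. monochrome u" "?good as"
        "successively (\<noteq>) (map (\<lambda>u. isl (hd u)) us @ map fst as)" for us as
      using that
    proof (induction as arbitrary: us)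
      case Nil
      have "successively (\<lambda>u v. isl (hd u) \<noteq> isl (hd v)) us"
        using Nil.prems(4) by (simp only: list.map(1) append_Nil2 successively_map)
      then have "runs (concat us) = us" by (rule runs_concat[OF Nil.prems(2)])
      moreover obtain u us' where us: "us = u # us'" using Nil.prems(1) by (cases us) auto
      then have "concat us \<noteq> []" using Nil.prems(2) by (simp add: monochrome_def)
      ultimately show ?case using null[of "concat us"] by (simp add: centred_word_def)
    next
      case (Cons ra as)
      obtain r a where ra: "ra = (r, a)" by (cases ra)
      have a: "a \<in> unital_subalgebra ncp_scale hull (range (\<lambda>i. ncp_var (inj r i)))" "\<phi> a = 0"
        using Cons.prems(3) unfolding ra by auto
      have "\<phi> (prod_list (map centred_run us) * centred_run u * prod_list (map snd as)) = 0"
        if "monochrome u" "isl (hd u) = r" for u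
      proof -
        have "\<forall>v\<in>set (us @ [u]). monochrome v" using Cons.prems(2) that(1) by simp
        moreover have "\<forall>(r, a)\<in>set as. a \<in> unital_subalgebra ncp_scale hull (range (\<lambda>i. ncp_var (inj r i))) \<and> \<phi> a = 0"
          using Cons.prems(3) by simp
        moreover have "successively (\<noteq>) (map (\<lambda>u. isl (hd u)) (us @ [u]) @ map fst as)"
          using Cons.prems(4) that(2) by (simp add: ra)
        ultimately have "\<phi> (prod_list (map centred_run (us @ [u])) * prod_list (map snd as)) = 0"
          by (intro Cons.IH) simp_all
        then show ?thesis by simp
      qed
      then have "\<phi> (prod_list (map centred_run us) * a * prod_list (map snd as)) =
          \<phi> a * \<phi> (prod_list (map centred_run us) * prod_list (map snd as))"
        by (rule transfer[OF a(1)])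
      then show ?case using a(2) by (simp add: ra mult.assoc)
    qed
    from this[of "[]" as] show "\<phi> (prod_list (map snd as)) = 0"
      using ne good alt by (simp only: list.map(1) append_Nil successively_map prod_list.Nil mult_1_left) simp
  qed
  then show ?thesis
    using dist nc_prob_space_axioms unfolding free_realization_def by blast
qed

end

text \<open>The existence of a free realization lets \<open>boxtimes_eqI\<close> identify the
  convolution.\<close>

lemma boxtimes_realization:
  fixes \<mu> \<nu> :: "'k ncpoly \<Rightarrow> complex"
  assumes "\<mu> \<in> D_alg" "\<nu> \<in> D_alg"
  obtains \<phi> :: "('k + 'k) ncpoly \<Rightarrow> complex"
  where "free_realization ncp_scale \<phi> (\<lambda>i. ncp_var (Inl i)) (\<lambda>i. ncp_var (Inr i)) \<mu> \<nu>"
    "has_joint_distribution \<phi> (\<lambda>i. ncp_var (Inl i) * ncp_var (Inr i)) (\<mu> \<boxtimes> \<nu>)"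
proof -
  let ?z = "\<lambda>i. ncp_var (Inl i) * ncp_var (Inr i) :: ('k + 'k) ncpoly"
  obtain \<phi> :: "('k + 'k) ncpoly \<Rightarrow> complex"
    where \<phi>: "free_realization ncp_scale \<phi> (\<lambda>i. ncp_var (Inl i)) (\<lambda>i. ncp_var (Inr i)) \<mu> \<nu>"
    using free_realization_exists[OF assms] by blast
  interpret nc_prob_space ncp_scale \<phi> using \<phi> by (simp add: free_realization_def)
  have "has_joint_distribution \<phi> ?z (\<lambda>p. \<phi> (ncp_eval ncp_scale ?z p))"
    unfolding has_joint_distribution_def
    by (intro conjI allI impI ncp_eval_distribution) (rule arg_cong[OF ncp_eval_word])
  moreover from this have "\<mu> \<boxtimes> \<nu> = (\<lambda>p. \<phi> (ncp_eval ncp_scale ?z p))"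
    by (rule boxtimes_eqI[OF \<phi>])
  ultimately show thesis by (intro that[OF \<phi>]) simp
qed

section \<open>The bijection and the subordination equations\<close>

text \<open>The two coupled families form one family over a sum type; the factor
  \<open>var j\<close> in each equation gains the order that a contraction requires.\<close>

lemma subordination_exists:
  fixes f g :: "('k::finite, complex) ser"
  obtains A A' where "\<And>j. A j = var j * C.subst A' (ld j g)" "\<And>j. A' j = C.subst A (rd j f) * var j"
proof -
  define T where "T X s = (case s of
      Inl j \<Rightarrow> var j * C.subst (\<lambda>i. X (Inr i)) (ld j g)
    | Inr j \<Rightarrow> C.subst (\<lambda>i. X (Inl i)) (rd j f) * var j)" for X :: "'k + 'k \<Rightarrow> ('k, complex) ser" and s
  interpret series_contraction T "\<lambda>_. 0"
    by standard
      (auto simp: T_def agree_1 split: sum.splits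
        intro!: agree_mult_shift agree_mult_shift_right C.agree_subst)
  obtain X where X: "T X = X" by (rule fixpoint_exists)
  have "X (Inl j) = var j * C.subst (\<lambda>i. X (Inr i)) (ld j g)"
    "X (Inr j) = C.subst (\<lambda>i. X (Inl i)) (rd j f) * var j" for j
    using fun_cong[OF X, of "Inl j"] fun_cong[OF X, of "Inr j"] by (simp_all only: T_def sum.case)
  then show thesis by (rule that)
qed

text \<open>The free cumulants of the image are the coefficients of \<open>eta \<mu>\<close>, so
  this is the moment-cumulant functional equation.\<close>

lemma moment_bercovici_pata:
  fixes \<mu> :: "'k::finite ncpoly \<Rightarrow> complex"
  assumes "\<mu> \<in> D_alg"
  defines "F \<equiv> 1 + mom (\<bbbB> \<mu>)"
  shows "F = 1 + C.subst (\<lambda>i. var i * F) (eta \<mu>)"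
proof (rule moment_cumulant_functional_equation)
  have "coef (eta \<mu>) = R_transform (\<bbbB> \<mu>)" using bercovici_pata(2)[OF assms(1)] by (simp add: eta_def)
  then show "coef F v = (\<Sum>\<pi>\<in>NC (length v). cf_partition (coef (eta \<mu>)) v \<pi>)" if "v \<noteq> []" for v
    using moment_R_transform[OF that, of "\<bbbB> \<mu>"] that by (simp add: F_def coef_1 mom_def)
qed (simp_all add: F_def)

lemma eta_inverse: "(1 - eta \<mu>) * (1 + mom \<mu>) = 1" "(1 + mom \<mu>) * (1 - eta \<mu>) = 1"
  by (simp_all add: one_plus_mom star_left star_right)

text \<open>From g = 1 - F^(-1) follows g = f(zF) F^(-1). Expansion of \<open>f\<close> by first
  letters gives \<open>ld j g\<close>; by last letters, each term ends in z_i F and the F cancels,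
  which gives \<open>rd j g\<close>.\<close>

lemma inverse_functional_equation:
  fixes f F g :: "('k::finite, complex) ser"
  assumes f: "coef f [] = 0" and F: "F = 1 + C.subst (\<lambda>i. var i * F) f"
    and inv: "F * (1 - g) = 1"
  shows "ld j g = F * C.subst (\<lambda>i. var i * F) (ld j f) * (1 - g)"
    and "rd j g = C.subst (\<lambda>i. var i * F) (rd j f)"
proof -
  let ?S = "C.subst (\<lambda>i. var i * F)"
  have 0: "coef (var i * F) [] = 0" for i by simp
  have g: "g = ?S f * (1 - g)"
  proof -
    have "?S f = F - 1" using F by (metis add_diff_cancel_left')
    then have "?S f * (1 - g) = 1 - (1 - g)" by (simp add: left_diff_distrib inv)
    then show ?thesis by simp
  qed
  have "?S f = (\<Sum>i\<in>UNIV. var i * (F * ?S (ld i f)))"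
    by (subst C.subst_rec[OF 0]) (simp add: f mult.assoc)
  then have "g = (\<Sum>i\<in>UNIV. var i * (F * ?S (ld i f) * (1 - g)))"
    using g by (simp add: sum_distrib_right mult.assoc)
  then show "ld j g = F * ?S (ld j f) * (1 - g)"
    by (metis left_decomposition_unique[of j "\<lambda>i. F * ?S (ld i f) * (1 - g)"])
  have "?S f = (\<Sum>i\<in>UNIV. ?S (rd i f) * (var i * F))"
    by (subst right_decomposition) (simp add: f C.subst_sum C.subst_mult C.subst_var)
  then have "?S f * (1 - g) = (\<Sum>i\<in>UNIV. ?S (rd i f) * var i)"
    by (simp add: sum_distrib_right mult.assoc inv)
  then show "rd j g = ?S (rd j f)"
    using g right_decomposition_unique[of j "\<lambda>i. ?S (rd i f)"] by simp
qed

lemma implicit_series_unique: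
  fixes b :: "'k::finite \<Rightarrow> ('k, complex) ser"
  assumes b: "\<And>i. coef (b i) [] = 0"
    and X: "X = 1 + C.subst (\<lambda>i. b i * X) f" and Y: "Y = 1 + C.subst (\<lambda>i. b i * Y) f"
  shows "X = Y"
proof (rule agree_eqI)
  fix n show "agree n X Y"
  proof (induction n)
    case (Suc n)
    then have "agree (Suc n) (1 + C.subst (\<lambda>i. b i * X) f) (1 + C.subst (\<lambda>i. b i * Y) f)"
      by (intro agree_add agree_refl C.agree_subst agree_mult_shift) (simp_all add: b)
    then show ?case using X Y by simp
  qed simp
qed

text \<open>With M = N^(-1) the choice of \<open>b\<close> makes b_i N equal to a_i(zN). Then F(b)
  and \<open>N\<close> both solve X = 1 + f(bX), whose solution is unique.\<close>

lemma subst_implicit: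
  fixes f F N :: "('k::finite, complex) ser"
  assumes a: "\<And>i. coef (a i) [] = 0" and F: "F = 1 + C.subst (\<lambda>i. var i * F) f"
    and N: "N = 1 + C.subst (\<lambda>i. var i * N) (C.subst a f)" and inv: "M * N = 1"
  defines "b \<equiv> \<lambda>i. C.subst (\<lambda>i. var i * N) (a i) * M"
  shows "C.subst b F = N"
    and "C.subst b (C.subst (\<lambda>i. var i * F) k) = C.subst (\<lambda>i. var i * N) (C.subst a k)"
proof -
  have 0: "coef (var i * F) [] = 0" for i and F :: "('k, complex) ser" by simp
  have b: "coef (b i) [] = 0" for i by (simp add: b_def a)
  have bN: "b i * N = C.subst (\<lambda>i. var i * N) (a i)" for i
    by (simp add: b_def mult.assoc inv)
  have bF: "C.subst b (C.subst (\<lambda>i. var i * F) k) = C.subst (\<lambda>i. b i * C.subst b F) k" for k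
    by (subst subst_subst) (simp_all add: b C.subst_mult C.subst_var)
  have aN: "C.subst (\<lambda>i. b i * N) k = C.subst (\<lambda>i. var i * N) (C.subst a k)" for k
    unfolding bN by (subst subst_subst) (simp_all add: a)
  show eq: "C.subst b F = N"
  proof (rule implicit_series_unique[OF b])
    have "C.subst b F = C.subst b (1 + C.subst (\<lambda>i. var i * F) f)" using F by simp
    then show "C.subst b F = 1 + C.subst (\<lambda>i. b i * C.subst b F) f"
      by (simp add: C.subst_add C.subst_1 bF b)
    show "N = 1 + C.subst (\<lambda>i. b i * N) f" unfolding aN by (rule N)
  qed
  show "C.subst b (C.subst (\<lambda>i. var i * F) k) = C.subst (\<lambda>i. var i * N) (C.subst a k)"
    by (simp add: bF eq aN)
qed

theorem theorem2:
  fixes \<mu> \<nu> :: "'k::finite ncpoly \<Rightarrow> complex"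
  assumes "\<mu> \<in> D_alg" and "\<nu> \<in> D_alg"
  shows "\<bbbB> (\<mu> \<boxtimes> \<nu>) = \<bbbB> \<mu> \<boxtimes> \<bbbB> \<nu>"
proof -
  \<comment> \<open>Stated for arbitrary distributions, as it is applied both to \<mu>, \<nu> and to
    their images.\<close>
  have eta_boxtimes: "\<mu> \<boxtimes> \<nu> \<in> D_alg \<and> eta (\<mu> \<boxtimes> \<nu>) = C.subst A (eta \<mu>) \<and> C.subst A' (eta \<nu>) = C.subst A (eta \<mu>)"
    if D: "\<mu> \<in> D_alg" "\<nu> \<in> D_alg"
      and A: "\<And>j. A j = var j * C.subst A' (ld j (eta \<nu>))" "\<And>j. A' j = C.subst A (rd j (eta \<mu>)) * var j"
    for \<mu> \<nu> :: "'k ncpoly \<Rightarrow> complex" and A A'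
  proof -
    obtain \<phi> :: "('k + 'k) ncpoly \<Rightarrow> complex"
      where \<phi>: "free_realization ncp_scale \<phi> (\<lambda>i. ncp_var (Inl i)) (\<lambda>i. ncp_var (Inr i)) \<mu> \<nu>"
        "has_joint_distribution \<phi> (\<lambda>i. ncp_var (Inl i) * ncp_var (Inr i)) (\<mu> \<boxtimes> \<nu>)"
      using boxtimes_realization[OF D] by blast
    interpret nc_prob_space ncp_scale \<phi> using \<phi> by (simp add: free_realization_def)
    show ?thesis
      using eta_product[of "\<lambda>i. ncp_var (Inl i)" "\<lambda>i. ncp_var (Inr i)" \<mu> \<nu> "\<mu> \<boxtimes> \<nu>", OF _ _ _ _ A] \<phi>
      by (auto simp: free_realization_def has_joint_distribution_def[of _ _ "\<mu> \<boxtimes> \<nu>"])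
  qed
  define f where "f = eta \<mu>"
  define g where "g = eta \<nu>"
  have f0: "coef f [] = 0" and g0: "coef g [] = 0" by (simp_all add: f_def g_def)
  define \<rho> where "\<rho> = \<mu> \<boxtimes> \<nu>"
  obtain A A' where A: "\<And>j. A j = var j * C.subst A' (ld j g)" "\<And>j. A' j = C.subst A (rd j f) * var j"
    using subordination_exists[of g f] by blast
  have \<rho>: "\<rho> \<in> D_alg" and h: "eta \<rho> = C.subst A f" "eta \<rho> = C.subst A' g"
    using eta_boxtimes[OF assms, of A A'] A by (auto simp: f_def g_def \<rho>_def)
  have A0: "coef (A j) [] = 0" "coef (A' j) [] = 0" for j
    by (subst A, simp)+

  define F where "F = 1 + mom (\<bbbB> \<mu>)"
  define G where "G = 1 + mom (\<bbbB> \<nu>)"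
  define N where "N = 1 + mom (\<bbbB> \<rho>)"
  define f' where "f' = eta (\<bbbB> \<mu>)"
  define g' where "g' = eta (\<bbbB> \<nu>)"
  define M where "M = 1 - eta (\<bbbB> \<rho>)"
  have F: "F = 1 + C.subst (\<lambda>i. var i * F) f" and G: "G = 1 + C.subst (\<lambda>i. var i * G) g"
    using moment_bercovici_pata[OF assms(1)] moment_bercovici_pata[OF assms(2)]
    by (simp_all only: F_def G_def f_def g_def)
  have N: "N = 1 + C.subst (\<lambda>i. var i * N) (C.subst A f)" "N = 1 + C.subst (\<lambda>i. var i * N) (C.subst A' g)"
    using moment_bercovici_pata[OF \<rho>] by (simp_all only: N_def h[symmetric])
  have MN: "M * N = 1" "N * M = 1" by (simp_all add: M_def N_def eta_inverse)
  have inv: "(1 - f') * F = 1" "F * (1 - f') = 1" "(1 - g') * G = 1" "G * (1 - g') = 1"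
    by (simp_all add: f'_def g'_def F_def G_def eta_inverse)
  let ?S = "C.subst (\<lambda>i. var i * N)"
  \<comment> \<open>The candidate solution of the subordination equations for the images, in the
    form required by \<open>subst_implicit\<close>.\<close>
  define B where "B i = ?S (A i) * M" for i
  define B' where "B' i = ?S (A' i) * M" for i
  have B0: "coef (B i) [] = 0" "coef (B' i) [] = 0" for i by (simp_all add: B_def B'_def A0)
  have BF: "C.subst B F = N" "C.subst B (C.subst (\<lambda>i. var i * F) k) = ?S (C.subst A k)" for k
    unfolding B_def using subst_implicit[OF A0(1) F N(1) MN(1)] by simp_all
  have B'G: "C.subst B' G = N" "C.subst B' (C.subst (\<lambda>i. var i * G) k) = ?S (C.subst A' k)" for k
    unfolding B'_def using subst_implicit[OF A0(2) G N(2) MN(1)] by simp_all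
  have left_inverse_unique: "X = M" if "X * N = 1" for X
    by (metis MN(2) mult.assoc mult_1_left mult_1_right that)
  \<comment> \<open>Substituting \<open>B\<close> into (1 - f') F = 1 and using F(B) = N shows that
    (1 - f')(B) is the inverse of \<open>N\<close>.\<close>
  have Bf': "C.subst B (1 - f') = M"
    using C.subst_mult[of B "1 - f'" F] inv(1) B0 BF(1) by (intro left_inverse_unique) (simp add: C.subst_1)
  have B'g': "C.subst B' (1 - g') = M"
    using C.subst_mult[of B' "1 - g'" G] inv(3) B0 B'G(1) by (intro left_inverse_unique) (simp add: C.subst_1)
  have S: "?S (F * G) = ?S F * ?S G" "?S (var j) = var j * N" for F G j
    by (simp_all add: C.subst_mult C.subst_var)
  have "B j = var j * C.subst B' (ld j g')" for j
  proof -
    have "C.subst B' (ld j g') = N * ?S (C.subst A' (ld j g)) * M"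
      unfolding inverse_functional_equation(1)[OF g0 G inv(4)]
      by (simp add: C.subst_mult B0 B'G B'g')
    moreover have "B j = var j * N * ?S (C.subst A' (ld j g)) * M"
      unfolding B_def by (subst A) (simp add: S)
    ultimately show ?thesis by (simp add: mult.assoc)
  qed
  moreover have "B' j = C.subst B (rd j f') * var j" for j
  proof -
    have "C.subst B (rd j f') = ?S (C.subst A (rd j f))"
      unfolding inverse_functional_equation(2)[OF f0 F inv(2)] by (rule BF)
    moreover have "B' j = ?S (C.subst A (rd j f)) * (var j * N) * M"
      unfolding B'_def by (subst A) (simp add: S)
    ultimately show ?thesis by (simp add: mult.assoc MN)
  qed
  ultimately have "\<bbbB> \<mu> \<boxtimes> \<bbbB> \<nu> \<in> D_alg \<and> eta (\<bbbB> \<mu> \<boxtimes> \<bbbB> \<nu>) = C.subst B f'"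
    using eta_boxtimes[OF bercovici_pata(1)[OF assms(1)] bercovici_pata(1)[OF assms(2)], of B B']
    by (simp add: f'_def g'_def)
  \<comment> \<open>f'(B) = 1 - M, and 1 - M is the eta-series of the image of \<rho> by the
    definition of \<open>M\<close>.\<close>
  moreover have "C.subst B f' = eta (\<bbbB> \<rho>)"
    using Bf' by (simp add: C.subst_diff C.subst_1 B0 M_def)
  ultimately have D: "\<bbbB> \<mu> \<boxtimes> \<bbbB> \<nu> \<in> D_alg" and "eta (\<bbbB> \<mu> \<boxtimes> \<bbbB> \<nu>) = eta (\<bbbB> \<rho>)" by simp_all
  then have "eta_series (\<bbbB> \<mu> \<boxtimes> \<bbbB> \<nu>) = eta_series (\<bbbB> \<rho>)" by (metis coef_Ser eta_def)
  then show ?thesis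
    using bij_betw_eta_series D bercovici_pata(1)[OF \<rho>] unfolding \<rho>_def bij_betw_def by (metis inj_onD)
qed

end
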